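(* Let $\Sigma_{p,n}=M_{p,n}M_{p,n}^*$ be the sparse heavy tailed sample covariance matrix with parameters $\alpha>0$ and $\mu\in[0,1]$ (built from $x$ and $y$ as in the context). Suppose $0<\alpha<2(1+\mu^{-1})$. If $1+\mu^{-1}\le\alpha<2(1+\mu^{-1})$, assume in addition that $x$ is centered ($\mathbb E x=0$). Then, for each fixed $l\ge 1$, as $n\to\infty$, $$\frac{\lambda_l(\Sigma_{p,n})}{|m_{i_lj_l}|^2}\longrightarrow 1\quad\text{in probability},$$ and the eigenvectors are localized: for each fixed $l\ge1$, $$\big\|\mathbf v_l(\Sigma_{p,n})-\mathbf e_{i_l}\big\|_2\longrightarrow 0\quad\text{in probability}.$$
   Context: Setting. $x$ is a complex-valued random variable with $\mathbb P(|x|>t)=L(t)t^{-\alpha}$ for $t>0$, where $\alpha>0$ and $L$ is slowly varying, i.e. $\lim_{t\to\infty}L(st)/L(t)=1$ for every $s>0$. Fix $0\le\mu\le1$; for each $n\ge1$, $y=y(n)$ is a Bernoulli random variable independent of $x$ with $\mathbb P(y=1)=n^{\mu-1}=1-\mathbb P(y=0)$. Let $p=p(n)$ be positive integers with $p/n\to\rho$, where $0<\rho\le1$. Let $A_{p,n}=[a_{ij}]$ and $B_{p,n}=[b_{ij}]$ be independent $p\times n$ random matrices with entries i.i.d. copies of $x$ and of $y(n)$, respectively, and let $M_{p,n}=[m_{ij}]$ with $m_{ij}=a_{ij}b_{ij}$ and $\Sigma_{p,n}=M_{p,n}M_{p,n}^*$ (a $p\times p$ positive semidefinite matrix). Conventions.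 When $\mu=0$, $\mu^{-1}=+\infty$ (so every $\alpha>0$ satisfies $\alpha<1+\mu^{-1}$). $\lambda_l(A)$ is the $l$-th largest eigenvalue of a Hermitian matrix $A$ and $\mathbf v_l(A)$ a corresponding unit eigenvector, its phase (a unit complex scalar factor) being suitably chosen. $m_{i_lj_l}$ denotes the $l$-th largest entry in absolute value among all entries of $M_{p,n}$, located in row $i_l$ and column $j_l$ (ties broken arbitrarily). $\mathbf e_1,\dots,\mathbf e_p$ are the canonical basis vectors. *)

theory Defs
  imports "HOL-Probability.Probability" "Jordan_Normal_Form.Schur_Decomposition"
begin

section \<open>Probabilistic notions\<close>

definition slowly_varying :: "(real \<Rightarrow> real) \<Rightarrow> bool" where
  "slowly_varying L \<longleftrightarrow> (\<forall>s>0. ((\<lambda>t. L (s * t) / L t) \<longlongrightarrow> 1) at_top)"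

definition iid_copies ::
  "'a measure \<Rightarrow> 'i set \<Rightarrow> ('i \<Rightarrow> 'a \<Rightarrow> 'c::topological_space) \<Rightarrow> 'b measure \<Rightarrow> ('b \<Rightarrow> 'c) \<Rightarrow> bool" where
  "iid_copies M I X N x \<longleftrightarrow>
     prob_space.indep_vars M (\<lambda>_. borel) X I \<and> (\<forall>i\<in>I. distr M borel (X i) = distr N borel x)"

text \<open>Two families are independent of each other when they are independent as random elements
  of the respective product spaces.\<close>

definition indep_families ::
  "'a measure \<Rightarrow> 'i set \<Rightarrow> ('i \<Rightarrow> 'a \<Rightarrow> 'c::topological_space)
     \<Rightarrow> 'i set \<Rightarrow> ('i \<Rightarrow> 'a \<Rightarrow> 'c) \<Rightarrow> bool" where
  "indep_families M I X J Y \<longleftrightarrow>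
     prob_space.indep_var M
       (Pi\<^sub>M I (\<lambda>_. borel)) (\<lambda>\<omega>. \<lambda>i\<in>I. X i \<omega>)
       (Pi\<^sub>M J (\<lambda>_. borel)) (\<lambda>\<omega>. \<lambda>j\<in>J. Y j \<omega>)"

text \<open>Convergence in probability to a constant, where the n-th variable may live on its own
  probability space. The outer measure agrees with the measure on measurable sets, so for
  measurable variables this is the usual notion. It is used because \<^const>\<open>measure\<close> assigns 0 to
  non-measurable sets, and arbitrary (possibly non-measurable) choices of eigenvectors and of
  tie-breaking are allowed.\<close>

definition tendsto_in_prob ::
  "(nat \<Rightarrow> 'a measure) \<Rightarrow> (nat \<Rightarrow> 'a \<Rightarrow> real) \<Rightarrow> real \<Rightarrow> bool" where
  "tendsto_in_prob M X c \<longleftrightarrow>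
     (\<forall>\<epsilon>>0. (\<lambda>n. outer_measure_of (M n) {\<omega> \<in> space (M n). \<bar>X n \<omega> - c\<bar> > \<epsilon>}) \<longlonglongrightarrow> 0)"

section \<open>Matrices\<close>

text \<open>The l-th largest eigenvalue (l = 1, 2, \dots, counted with multiplicity) of a Hermitian
  matrix. The eigenvalues of such a matrix are real, so taking real parts loses nothing.
  Only meaningful for l between 1 and the dimension.\<close>

definition eigval_desc :: "complex Matrix.mat \<Rightarrow> nat \<Rightarrow> real" where
  "eigval_desc A l = rev (sorted_list_of_multiset (image_mset Re (proots (char_poly A)))) ! (l - 1)"

definition norm2 :: "complex Matrix.vec \<Rightarrow> real" where
  "norm2 v = sqrt (\<Sum>i<dim_vec v. (cmod (vec_index v i))\<^sup>2)"

definition unit_eigenvector :: "complex Matrix.mat \<Rightarrow> nat \<Rightarrow> complex Matrix.vec \<Rightarrow> bool" where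
  "unit_eigenvector A l v \<longleftrightarrow> eigenvector A v (complex_of_real (eigval_desc A l)) \<and> norm2 v = 1"

definition positions :: "nat \<Rightarrow> nat \<Rightarrow> (nat \<times> nat) set" where
  "positions p n = {..<p} \<times> {..<n}"

definition sample_covariance :: "nat \<Rightarrow> nat \<Rightarrow> (nat \<times> nat \<Rightarrow> complex) \<Rightarrow> complex Matrix.mat" where
  "sample_covariance p n m = (let A = Matrix.mat p n m in A * mat_adjoint A)"

text \<open>\<open>ranks_entries p n m r\<close>: the positions \<open>r 1\<close>, \<open>r 2\<close>, \dots, \<open>r (p * n)\<close> list all
  entries of the matrix m, each once, by decreasing absolute value. Ties may be ordered in any
  way; the theorem quantifies over all such r.\<close>

definition ranks_entries ::
  "nat \<Rightarrow> nat \<Rightarrow> (nat \<times> nat \<Rightarrow> complex) \<Rightarrow> (nat \<Rightarrow> nat \<times> nat) \<Rightarrow> bool" where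
  "ranks_entries p n m r \<longleftrightarrow>
     bij_betw r {1..p * n} (positions p n) \<and>
     (\<forall>k l. 1 \<le> k \<longrightarrow> k \<le> l \<longrightarrow> l \<le> p * n \<longrightarrow> cmod (m (r l)) \<le> cmod (m (r k)))"

end

theory Submission
  imports Defs
begin

text \<open>
  Write \<open>\<beta> = (1 + \<mu>) / \<alpha>\<close>. The matrix has about \<open>n^(1 + \<mu>)\<close> nonzero entries with a tail of index \<open>\<alpha>\<close>, so for every
  fixed \<open>l\<close> the \<open>l\<close>-th largest modulus is \<open>n^(\<beta> + o(1))\<close>. Split the matrix at the level \<open>n^(\<beta> - 8 \<epsilon>)\<close> for a small
  \<open>\<epsilon>\<close> into a part \<open>B\<close> of large entries and a truncated part \<open>S\<close>. There are only \<open>n^(O(\<epsilon>))\<close> large entries, so with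
  high probability no two of them share a row or a column. Then \<open>B B\<^sup>*\<close> is a diagonal matrix that carries the squared
  moduli of the large entries, and \<open>\<Sigma>\<close> is this diagonal matrix plus a perturbation of norm at most
  \<open>2 |B| |S| + |S|^2\<close>. The whole proof rests on the fact that the norm of \<open>S\<close> is smaller than \<open>n^\<beta>\<close> by a power of \<open>n\<close>.
  That makes the perturbation negligible against the square of the \<open>l\<close>-th largest modulus, and the eigenvalue statement
  follows from the min-max principle. For the eigenvectors the diagonal entries must in addition be separated on the
  relative scale; regular variation provides this (\<open>close_scales\<close>, \<open>eventually_separated\<close>). The deterministic
  part is \<open>isolated_large_entries\<close>.

  The norm of \<open>S\<close> is estimated by the moment method, which is elementary here because a fixed power of \<open>n\<close> may be lost.
  After rescaling, \<open>S\<close> has independent entries of modulus at most one. If all their mixed moments of positive order are at most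
  \<open>q\<close>, then the expected trace of a power of \<open>S S\<^sup>*\<close> is at most the sum over walks of \<open>q\<close> to the number of distinct
  edges. Revealing a walk step by step, each step has a weighted number of at most \<open>N q + O(k)\<close> choices; if \<open>N q\<close> is
  bounded, the norm is \<open>n^(o(1))\<close> (\<open>walk_sum_power_card\<close>, \<open>random_matrix_norm_tail\<close>). The bound on \<open>q\<close> comes from a
  finite moment of \<open>x\<close> of order \<open>s < \<alpha>\<close> and needs \<open>s \<beta> > \<mu>\<close>. Moments of order \<open>s \<le> 1\<close> control the entries directly;
  orders \<open>1 \<le> s \<le> 2\<close> control them after recentering. This dichotomy yields exactly the two ranges of
  \<open>\<alpha>\<close> (\<open>truncated_matrix_norm_tail\<close>, \<open>choose_moment\<close>).

  Eigenvalues, eigenvectors and rankings need not be measurable. Every bad event is covered by a measurable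
  one of small probability (\<open>rare\<close>), and this is all that the outer measure requires.
\<close>

(* the symbol stands for vec_index below *)
no_notation vec_nth (infixl \<open>$\<close> 90)

section \<open>Unitary diagonalization of Hermitian matrices\<close>

lemma dim_mat_adjoint [simp]:
  "dim_row (mat_adjoint A) = dim_col A" "dim_col (mat_adjoint A) = dim_row A"
  by (simp_all add: mat_adjoint_def)

lemma mat_adjoint_carrier [simp]:
  "A \<in> carrier_mat n k \<Longrightarrow> mat_adjoint A \<in> carrier_mat k n"
  by (auto simp: mat_adjoint_def)

lemma mat_adjoint_index:
  assumes "A \<in> carrier_mat n k" "i < k" "j < n"
  shows "mat_adjoint A $$ (i, j) = conjugate (A $$ (j, i))"
  using assms by (auto simp: mat_adjoint_def mat_of_rows_def)

lemma mat_adjoint_mult: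
  fixes A B :: "complex Matrix.mat"
  assumes A: "A \<in> carrier_mat n k" and B: "B \<in> carrier_mat k r"
  shows "mat_adjoint (A * B) = mat_adjoint B * mat_adjoint A"
proof (rule eq_matI)
  have AB: "A * B \<in> carrier_mat n r" by (rule mult_carrier_mat[OF A B])
  fix i j assume "i < dim_row (mat_adjoint B * mat_adjoint A)" "j < dim_col (mat_adjoint B * mat_adjoint A)"
  then have i: "i < r" and j: "j < n" using mat_adjoint_carrier[OF A] mat_adjoint_carrier[OF B] by auto
  show "mat_adjoint (A * B) $$ (i, j) = (mat_adjoint B * mat_adjoint A) $$ (i, j)"
    using i j A B mat_adjoint_carrier[OF A] mat_adjoint_carrier[OF B]
    by (simp add: mat_adjoint_index[OF AB] scalar_prod_def mat_adjoint_index[OF A] mat_adjoint_index[OF B]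
         mult.commute)
qed (use mat_adjoint_carrier[OF A] mat_adjoint_carrier[OF B] mat_adjoint_carrier[of "A*B" n r] A B in auto)

lemma mat_adjoint_adjoint:
  fixes A :: "complex Matrix.mat"
  assumes A: "A \<in> carrier_mat n k"
  shows "mat_adjoint (mat_adjoint A) = A"
  by (rule eq_matI)
     (use A mat_adjoint_carrier[OF A] in \<open>auto simp: mat_adjoint_index[OF mat_adjoint_carrier[OF A]] mat_adjoint_index[OF A]
        dest!: mat_adjoint_carrier[OF mat_adjoint_carrier]\<close>)

text \<open>Completing \<open>v\<close> to a basis, orthogonalizing and then normalizing the columns.\<close>

lemma unitary_with_first_column:
  fixes v :: "complex Matrix.vec"
  assumes v: "v \<in> carrier_vec n" and v0: "v \<noteq> 0\<^sub>v n" and n: "n > 0"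
  shows "\<exists>W c. W \<in> carrier_mat n n \<and> mat_adjoint W * W = 1\<^sub>m n \<and> col W 0 = c \<cdot>\<^sub>v v \<and> c \<noteq> 0"
proof -
  interpret cof_vec_space n "TYPE(complex)" .
  define b where "b = basis_completion v"
  define ws where "ws = gram_schmidt n b"
  from basis_completion[OF v v0, folded b_def]
  have dist_b: "distinct b" and indep: "\<not> lin_dep (set b)" and b: "set b \<subseteq> carrier_vec n"
    and hdb: "hd b = v" and len_b: "length b = n" by auto
  from hdb len_b n obtain vs where bv: "b = v # vs" by (cases b, auto)
  from gram_schmidt_result[OF b dist_b indep refl, folded ws_def]
  have ws: "set ws \<subseteq> carrier_vec n" "corthogonal ws" "length ws = n" by (auto simp: len_b)
  from gram_schmidt_hd[OF v, of vs, folded bv] have hdws: "hd ws = v" unfolding ws_def .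
  define c where "c i = complex_of_real (1 / sqrt (Re (ws ! i \<bullet>c ws ! i)))" for i
  define W where "W = Matrix.mat n n (\<lambda>(i, j). c j * (ws ! j) $ i)"
  have W: "W \<in> carrier_mat n n" by (simp add: W_def)
  have wsn: "ws ! i \<in> carrier_vec n" if "i < n" for i using ws that by auto
  have pos: "Re (ws ! i \<bullet>c ws ! i) > 0 \<and> ws ! i \<bullet>c ws ! i = complex_of_real (Re (ws ! i \<bullet>c ws ! i))"
    if "i < n" for i
  proof -
    have "ws ! i \<bullet>c ws ! i \<noteq> 0" using corthogonalD[OF ws(2)] that ws(3) by auto
    moreover have "ws ! i \<bullet>c ws ! i \<ge> 0" by (rule conjugate_square_ge_0_vec)
    ultimately show ?thesis by (auto simp: less_eq_complex_def complex_eq_iff)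
  qed
  have dot: "ws ! j \<bullet>c ws ! i = (\<Sum>k<n. (ws ! j) $ k * cnj ((ws ! i) $ k))" if "i < n" "j < n" for i j
    using wsn[OF that(1)] wsn[OF that(2)] by (auto simp: scalar_prod_def atLeast0LessThan)
  have "mat_adjoint W * W = 1\<^sub>m n"
  proof (rule eq_matI)
    fix i j assume "i < dim_row (1\<^sub>m n :: complex Matrix.mat)" "j < dim_col (1\<^sub>m n :: complex Matrix.mat)"
    then have i: "i < n" and j: "j < n" by auto
    have "(mat_adjoint W * W) $$ (i, j) = (\<Sum>k<n. cnj (c i * (ws ! i) $ k) * (c j * (ws ! j) $ k))"
      using i j W mat_adjoint_carrier[OF W]
      by (simp add: scalar_prod_def mat_adjoint_index[OF W] atLeast0LessThan) (simp add: W_def)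
    also have "\<dots> = c i * c j * (ws ! j \<bullet>c ws ! i)"
      unfolding dot[OF i j] sum_distrib_left
      by (intro sum.cong refl) (simp add: c_def)
    also have "\<dots> = (if i = j then 1 else 0)"
    proof (cases "i = j")
      case True
      define t where "t = Re (ws ! i \<bullet>c ws ! i)"
      have t: "t > 0" "ws ! i \<bullet>c ws ! i = complex_of_real t" using pos[OF i] by (auto simp: t_def)
      have "c i * c i * complex_of_real t = complex_of_real (1 / sqrt t * (1 / sqrt t) * t)"
        unfolding c_def t_def by (simp only: of_real_mult)
      also have "\<dots> = 1" using t(1) by simp
      finally show ?thesis using True t by simp
    next
      case False
      then show ?thesis using corthogonalD[OF ws(2)] i j ws(3) by auto
    qed
    finally show "(mat_adjoint W * W) $$ (i, j) = 1\<^sub>m n $$ (i, j)" using i j by simp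
  qed (use W mat_adjoint_carrier[OF W] in auto)
  moreover have "col W 0 = c 0 \<cdot>\<^sub>v v"
  proof -
    have "ws ! 0 = v" using hdws n ws(3) by (cases ws) auto
    then show ?thesis using n v by (auto simp: W_def)
  qed
  moreover have "c 0 \<noteq> 0" using pos[OF n] by (auto simp: c_def)
  ultimately show ?thesis using W by blast
qed

text \<open>Conjugating by a unitary matrix whose first column is an eigenvector clears the first column,
  and by symmetry also the first row; the remaining block is Hermitian and smaller.\<close>

lemma hermitian_unitary_diagonalization:
  fixes A :: "complex Matrix.mat"
  assumes "A \<in> carrier_mat n n" and "mat_adjoint A = A"
  shows "\<exists>U D. U \<in> carrier_mat n n \<and> D \<in> carrier_mat n n \<and> mat_adjoint U * U = 1\<^sub>m n
            \<and> diagonal_mat D \<and> mat_adjoint U * A * U = D"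
  using assms
proof (induction n arbitrary: A)
  case 0
  show ?case
    by (rule exI[of _ "1\<^sub>m 0"], rule exI[of _ A]) (use 0 in \<open>auto simp: diagonal_mat_def mat_adjoint_def\<close>)
next
  case (Suc n)
  note A = Suc.prems(1)
  obtain as where as: "char_poly A = (\<Prod>a\<leftarrow>as. [:- a, 1:])" "length as = Suc n"
    using char_poly_factorized[OF A] by auto
  then obtain e es where "as = e # es" by (cases as) auto
  then have "poly (char_poly A) e = 0" using as by simp
  then have "eigenvalue A e" using eigenvalue_root_char_poly[OF A] by simp
  then obtain v where "eigenvector A v e" unfolding eigenvalue_def by blast
  then have v: "v \<in> carrier_vec (Suc n)" "v \<noteq> 0\<^sub>v (Suc n)" and Av: "A *\<^sub>v v = e \<cdot>\<^sub>v v"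
    using A by (auto simp: eigenvector_def)
  obtain W c where W: "W \<in> carrier_mat (Suc n) (Suc n)" and WW: "mat_adjoint W * W = 1\<^sub>m (Suc n)"
    and colW: "col W 0 = c \<cdot>\<^sub>v v" and c: "c \<noteq> 0"
    using unitary_with_first_column[OF v] by auto
  have W': "mat_adjoint W \<in> carrier_mat (Suc n) (Suc n)" using W by simp
  define B where "B = mat_adjoint W * A * W"
  have B: "B \<in> carrier_mat (Suc n) (Suc n)" unfolding B_def by (rule mult_carrier_mat[OF mult_carrier_mat[OF W' A] W])
  have Bh: "mat_adjoint B = B"
  proof -
    have "mat_adjoint B = mat_adjoint W * mat_adjoint (mat_adjoint W * A)"
      unfolding B_def by (rule mat_adjoint_mult[of _ "Suc n" "Suc n" _ "Suc n"]) (use W W' A in auto)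
    also have "mat_adjoint (mat_adjoint W * A) = A * W"
      using mat_adjoint_mult[OF W' A] Suc.prems(2) mat_adjoint_adjoint[OF W] by simp
    finally show ?thesis using assoc_mult_mat[OF W' A W] by (simp only: B_def)
  qed
  have Bcol: "B $$ (i, 0) = (if i = 0 then e else 0)" if "i < Suc n" for i
  proof -
    have "col B 0 = mat_adjoint W *\<^sub>v (A *\<^sub>v col W 0)"
      unfolding B_def
      by (simp only: assoc_mult_mat[OF W' A W] col_mult2[OF W' mult_carrier_mat[OF A W] zero_less_Suc] col_mult2[OF A W zero_less_Suc])
    also have "A *\<^sub>v col W 0 = e \<cdot>\<^sub>v col W 0"
      unfolding colW using A v Av by (simp add: mult_mat_vec smult_smult_assoc mult.commute)
    also have "mat_adjoint W *\<^sub>v (e \<cdot>\<^sub>v col W 0) = e \<cdot>\<^sub>v (mat_adjoint W *\<^sub>v col W 0)"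
      using mult_mat_vec[OF W', of "col W 0" e] W by (simp add: carrier_vecI)
    also have "mat_adjoint W *\<^sub>v col W 0 = col (mat_adjoint W * W) 0"
      using W W' by (simp add: col_mult2[of _ "Suc n" "Suc n" _ "Suc n"])
    finally have "col B 0 = e \<cdot>\<^sub>v unit_vec (Suc n) 0" by (simp add: WW)
    from arg_cong[OF this, of "\<lambda>w. w $ i"] show ?thesis using that B by (auto simp: unit_vec_def)
  qed
  have Brow: "B $$ (0, i) = (if i = 0 then e else 0)" if i: "i < Suc n" for i
  proof -
    have *: "B $$ (0, i) = conjugate (B $$ (i, 0))"
      using mat_adjoint_index[OF B, of 0 i] i Bh by simp
    moreover have "conjugate e = e" if "i = 0" using * Bcol[of 0] that by simp
    ultimately show ?thesis using Bcol[OF i] by auto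
  qed
  define A3 where "A3 = Matrix.mat n n (\<lambda>(i, j). B $$ (Suc i, Suc j))"
  have A3: "A3 \<in> carrier_mat n n" by (simp add: A3_def)
  have "mat_adjoint A3 = A3"
  proof (rule eq_matI)
    fix i j assume "i < dim_row A3" "j < dim_col A3"
    then have ij: "i < n" "j < n" using A3 by auto
    then show "mat_adjoint A3 $$ (i, j) = A3 $$ (i, j)"
      using mat_adjoint_index[OF B, of "Suc i" "Suc j"] Bh
      by (simp add: mat_adjoint_index[OF A3]) (simp add: A3_def)
  qed (use A3 mat_adjoint_carrier[OF A3] in auto)
  from Suc.IH[OF A3 this] obtain U D where U: "U \<in> carrier_mat n n" and D: "D \<in> carrier_mat n n"
    and UU: "mat_adjoint U * U = 1\<^sub>m n" and dD: "diagonal_mat D" and UAU: "mat_adjoint U * A3 * U = D" by blast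
  have U': "mat_adjoint U \<in> carrier_mat n n" using U by simp
  define E where "E = Matrix.mat 1 1 (\<lambda>_. e)"
  have E: "E \<in> carrier_mat 1 1" by (simp add: E_def)
  define V where "V = four_block_mat (1\<^sub>m 1) (0\<^sub>m 1 n) (0\<^sub>m n 1) U"
  have V: "V \<in> carrier_mat (Suc n) (Suc n)" using U by (auto simp: V_def)
  have Bblock: "B = four_block_mat E (0\<^sub>m 1 n) (0\<^sub>m n 1) A3"
    by (rule eq_matI) (use B A3 E Bcol Brow in \<open>auto simp: E_def A3_def\<close>)
  have V': "mat_adjoint V = four_block_mat (1\<^sub>m 1) (0\<^sub>m 1 n) (0\<^sub>m n 1) (mat_adjoint U)"
  proof (rule eq_matI)
    fix i j assume "i < dim_row (four_block_mat (1\<^sub>m 1) (0\<^sub>m 1 n) (0\<^sub>m n 1) (mat_adjoint U))"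
      "j < dim_col (four_block_mat (1\<^sub>m 1) (0\<^sub>m 1 n) (0\<^sub>m n 1) (mat_adjoint U))"
    then have ij: "i < Suc n" "j < Suc n" using U' by auto
    then show "mat_adjoint V $$ (i, j) = four_block_mat (1\<^sub>m 1) (0\<^sub>m 1 n) (0\<^sub>m n 1) (mat_adjoint U) $$ (i, j)"
      using U U' by (simp add: mat_adjoint_index[OF V]) (auto simp: V_def mat_adjoint_index[OF U])
  qed (use V U' mat_adjoint_carrier[OF V] in auto)
  have VV: "mat_adjoint V * V = 1\<^sub>m (Suc n)"
  proof -
    have "mat_adjoint V * V = four_block_mat (1\<^sub>m 1) (0\<^sub>m 1 n) (0\<^sub>m n 1) (1\<^sub>m n)"
      unfolding V' unfolding V_def
      by (subst mult_four_block_mat[of _ 1 1 _ n _ n _ _ 1 _ n]) (use U U' UU in auto)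
    then show ?thesis by (auto intro!: eq_matI)
  qed
  have U'A3: "mat_adjoint U * A3 \<in> carrier_mat n n" by (rule mult_carrier_mat[OF U' A3])
  have s1: "mat_adjoint V * B = four_block_mat E (0\<^sub>m 1 n) (0\<^sub>m n 1) (mat_adjoint U * A3)"
    unfolding V' Bblock
    by (subst mult_four_block_mat[of _ 1 1 _ n _ n _ _ 1 _ n]) (use U' A3 E U'A3 right_mult_zero_mat[OF U', of 1] in auto)
  have VBV: "mat_adjoint V * B * V = four_block_mat E (0\<^sub>m 1 n) (0\<^sub>m n 1) D"
    unfolding s1 unfolding V_def
    by (subst mult_four_block_mat[of _ 1 1 _ n _ n _ _ 1 _ n])
       (use U U'A3 E UAU mult_carrier_mat[OF U'A3 U] in auto)
  define X where "X = W * V"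
  have X: "X \<in> carrier_mat (Suc n) (Suc n)" unfolding X_def by (rule mult_carrier_mat[OF W V])
  have Vc: "mat_adjoint V \<in> carrier_mat (Suc n) (Suc n)" using V by simp
  have Xadj: "mat_adjoint X = mat_adjoint V * mat_adjoint W" unfolding X_def by (rule mat_adjoint_mult[OF W V])
  have "mat_adjoint X * X = mat_adjoint V * ((mat_adjoint W * W) * V)"
    unfolding Xadj unfolding X_def
    by (simp only: assoc_mult_mat[OF Vc W' mult_carrier_mat[OF W V]] assoc_mult_mat[OF W' W V])
  also have "\<dots> = 1\<^sub>m (Suc n)" using WW V VV by simp
  finally have XX: "mat_adjoint X * X = 1\<^sub>m (Suc n)" .
  have "mat_adjoint X * A * X = mat_adjoint V * B * V"
    unfolding Xadj unfolding X_def B_def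
    by (simp only: assoc_mult_mat[OF mult_carrier_mat[OF Vc W'] A mult_carrier_mat[OF W V]]
      assoc_mult_mat[OF Vc W' mult_carrier_mat[OF A mult_carrier_mat[OF W V]]]
      assoc_mult_mat[OF W' A W] assoc_mult_mat[OF Vc mult_carrier_mat[OF W' mult_carrier_mat[OF A W]] V]
      assoc_mult_mat[OF W' mult_carrier_mat[OF A W] V] assoc_mult_mat[OF A W V])
  then have XAX: "mat_adjoint X * A * X = four_block_mat E (0\<^sub>m 1 n) (0\<^sub>m n 1) D" using VBV by simp
  have "diagonal_mat (four_block_mat E (0\<^sub>m 1 n) (0\<^sub>m n 1) D)"
    using dD D E by (auto simp: diagonal_mat_def)
  then show ?case using X XX XAX D E by (intro exI[of _ X] exI[of _ "four_block_mat E (0\<^sub>m 1 n) (0\<^sub>m n 1) D"]) auto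
qed

text \<open>The second identity, completeness, holds because a left inverse of a square matrix is also
  a right inverse.\<close>

lemma hermitian_eigenbasis:
  fixes A :: "complex Matrix.mat"
  assumes A: "A \<in> carrier_mat n n" and H: "\<And>i j. i < n \<Longrightarrow> j < n \<Longrightarrow> A $$ (i, j) = cnj (A $$ (j, i))"
  obtains u :: "nat \<Rightarrow> nat \<Rightarrow> complex" and ev :: "nat \<Rightarrow> real" where
    "\<And>i j. i < n \<Longrightarrow> j < n \<Longrightarrow> (\<Sum>k<n. cnj (u i k) * u j k) = (if i = j then 1 else 0)"
    "\<And>k k'. k < n \<Longrightarrow> k' < n \<Longrightarrow> (\<Sum>i<n. u i k * cnj (u i k')) = (if k = k' then 1 else 0)"
    "\<And>i k. i < n \<Longrightarrow> k < n \<Longrightarrow> (\<Sum>k'<n. A $$ (k, k') * u i k') = complex_of_real (ev i) * u i k"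
    "image_mset Re (proots (char_poly A)) = mset (map ev [0..<n])"
proof -
  have "mat_adjoint A = A"
  proof (rule eq_matI)
    fix i j assume "i < dim_row A" "j < dim_col A"
    then show "mat_adjoint A $$ (i, j) = A $$ (i, j)"
      using A H[of j i] by (simp add: mat_adjoint_index[OF A])
  qed (use A in auto)
  then obtain U D where U: "U \<in> carrier_mat n n" and D: "D \<in> carrier_mat n n"
    and UU: "mat_adjoint U * U = 1\<^sub>m n" and dD: "diagonal_mat D" and UAU: "mat_adjoint U * A * U = D"
    using hermitian_unitary_diagonalization[OF A] by blast
  have U': "mat_adjoint U \<in> carrier_mat n n" using U by simp
  have UU': "U * mat_adjoint U = 1\<^sub>m n" by (rule mat_mult_left_right_inverse[OF U' U UU])
  have AU: "A * U \<in> carrier_mat n n" by (rule mult_carrier_mat[OF A U])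
  have UD: "A * U = U * D"
  proof -
    have "U * D = U * (mat_adjoint U * (A * U))" using UAU assoc_mult_mat[OF U' A U] by simp
    also have "\<dots> = (U * mat_adjoint U) * (A * U)" using assoc_mult_mat[OF U U' AU] by simp
    finally show ?thesis using UU' left_mult_one_mat[OF AU] by simp
  qed
  define u where "u i k = U $$ (k, i)" for i k
  define ev where "ev i = Re (D $$ (i, i))" for i
  have Dii: "D $$ (i, i) = complex_of_real (ev i)" if i: "i < n" for i
  proof -
    have "mat_adjoint D = mat_adjoint U * mat_adjoint (mat_adjoint U * A)"
      unfolding UAU[symmetric] by (rule mat_adjoint_mult[OF mult_carrier_mat[OF U' A] U])
    also have "\<dots> = mat_adjoint U * (A * U)"
      using mat_adjoint_mult[OF U' A] \<open>mat_adjoint A = A\<close> mat_adjoint_adjoint[OF U] by simp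
    also have "\<dots> = D" using UAU assoc_mult_mat[OF U' A U] by simp
    finally have "D $$ (i, i) = cnj (D $$ (i, i))" using mat_adjoint_index[OF D i i] by simp
    then show ?thesis unfolding ev_def by (simp add: complex_eq_iff)
  qed
  show ?thesis
  proof
    fix i j assume ij: "i < n" "j < n"
    have "(mat_adjoint U * U) $$ (i, j) = (\<Sum>k<n. cnj (u i k) * u j k)"
      using ij U by (simp add: scalar_prod_def atLeast0LessThan mat_adjoint_index[OF U] u_def)
    then show "(\<Sum>k<n. cnj (u i k) * u j k) = (if i = j then 1 else 0)" using UU ij by simp
  next
    fix i j assume ij: "i < n" "j < n"
    have "(U * mat_adjoint U) $$ (i, j) = (\<Sum>k<n. u k i * cnj (u k j))"
      using ij U by (simp add: scalar_prod_def atLeast0LessThan mat_adjoint_index[OF U] u_def)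
    then show "(\<Sum>k<n. u k i * cnj (u k j)) = (if i = j then 1 else 0)" using UU' ij by simp
  next
    fix i k assume ik: "i < n" "k < n"
    have "(A * U) $$ (k, i) = (\<Sum>k'<n. A $$ (k, k') * u i k')"
      using ik U A by (simp add: scalar_prod_def atLeast0LessThan u_def)
    moreover have "(U * D) $$ (k, i) = (\<Sum>k'<n. U $$ (k, k') * D $$ (k', i))"
      using ik U D by (simp add: scalar_prod_def atLeast0LessThan)
    moreover have "\<dots> = (\<Sum>k'<n. if k' = i then U $$ (k, i) * D $$ (i, i) else 0)"
      by (intro sum.cong refl) (use dD D ik in \<open>auto simp: diagonal_mat_def\<close>)
    ultimately show "(\<Sum>k'<n. A $$ (k, k') * u i k') = complex_of_real (ev i) * u i k"
      using UD ik Dii by (simp add: u_def mult.commute)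
  next
    have "similar_mat_wit A D U (mat_adjoint U)"
    proof (rule similar_mat_witI[OF UU' UU _ A D U U'])
      have "U * D * mat_adjoint U = A * (U * mat_adjoint U)" using UD assoc_mult_mat[OF A U U'] by simp
      then show "A = U * D * mat_adjoint U" using UU' A by simp
    qed
    then have "char_poly A = char_poly D" using char_poly_similar similar_mat_def by blast
    also have "\<dots> = (\<Prod>a\<leftarrow>diag_mat D. [:- a, 1:])"
      by (rule char_poly_upper_triangular[OF D]) (use dD D in \<open>auto simp: diagonal_mat_def upper_triangular_def\<close>)
    also have "diag_mat D = map (\<lambda>i. complex_of_real (ev i)) [0..<n]"
      using D Dii by (auto simp: diag_mat_def)
    finally have cp: "char_poly A = (\<Prod>i\<leftarrow>[0..<n]. [:- complex_of_real (ev i), 1:])" by (simp add: o_def)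
    have "proots (\<Prod>i\<leftarrow>xs. [:- complex_of_real (ev i), 1:]) = mset (map (\<lambda>i. complex_of_real (ev i)) xs)" for xs :: "nat list"
    proof (induction xs)
      case (Cons x xs)
      have "(\<Prod>i\<leftarrow>xs. [:- complex_of_real (ev i), 1:]) \<noteq> 0" by (auto simp: prod_list_zero_iff)
      then show ?case using Cons by (simp add: proots_mult del: mult_pCons_left mult_pCons_right)
    qed simp
    then show "image_mset Re (proots (char_poly A)) = mset (map ev [0..<n])"
      unfolding cp by (simp flip: mset_map add: o_def multiset.map_comp)
  qed
qed

section \<open>Min-max bounds for ordered eigenvalues\<close>

lemma descending_nth_ge:
  fixes f :: "nat \<Rightarrow> real"
  assumes "card {i. i < n \<and> f i \<ge> c} \<ge> l" "1 \<le> l" "l \<le> n"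
  shows "rev (sort (map f [0..<n])) ! (l - 1) \<ge> c"
proof (rule ccontr)
  define ys where "ys = rev (sort (map f [0..<n]))"
  have len: "length ys = n" by (simp add: ys_def)
  assume "\<not> ?thesis"
  then have lt: "ys ! (l - 1) < c" by (simp add: ys_def)
  have ge: "sorted_wrt (\<ge>) ys" by (simp add: ys_def sorted_wrt_rev)
  have mono: "ys ! j \<le> ys ! i" if "i \<le> j" "j < n" for i j
    using ge that len by (cases "i = j") (auto simp: sorted_wrt_iff_nth_less)
  have "{j. j < n \<and> ys ! j \<ge> c} \<subseteq> {..<l - 1}"
  proof
    fix j assume j: "j \<in> {j. j < n \<and> ys ! j \<ge> c}"
    show "j \<in> {..<l - 1}"
    proof (rule ccontr)
      assume "j \<notin> {..<l - 1}"
      then have "ys ! j \<le> ys ! (l - 1)" using mono[of "l - 1" j] j by auto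
      then show False using j lt by auto
    qed
  qed
  then have "card {j. j < n \<and> ys ! j \<ge> c} \<le> l - 1" using card_mono[of "{..<l - 1}"] by fastforce
  moreover have "card {j. j < n \<and> ys ! j \<ge> c} = length (filter (\<lambda>x. x \<ge> c) ys)"
    using len by (simp add: length_filter_conv_card)
  moreover have "length (filter (\<lambda>x. x \<ge> c) ys) = length (filter (\<lambda>x. x \<ge> c) (map f [0..<n]))"
    by (simp add: ys_def rev_filter[symmetric] filter_sort)
  moreover have "\<dots> = card {i. i < n \<and> f i \<ge> c}"
    by (auto simp: length_filter_conv_card intro!: arg_cong[of _ _ card])
  ultimately show False using assms by simp
qed

lemma descending_nth_le:
  fixes f :: "nat \<Rightarrow> real"
  assumes "card {i. i < n \<and> f i > c} < l" "1 \<le> l" "l \<le> n"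
  shows "rev (sort (map f [0..<n])) ! (l - 1) \<le> c"
proof (rule ccontr)
  define ys where "ys = rev (sort (map f [0..<n]))"
  have len: "length ys = n" by (simp add: ys_def)
  assume "\<not> ?thesis"
  then have lt: "ys ! (l - 1) > c" by (simp add: ys_def)
  have ge: "sorted_wrt (\<ge>) ys" by (simp add: ys_def sorted_wrt_rev)
  have mono: "ys ! j \<le> ys ! i" if "i \<le> j" "j < n" for i j
    using ge that len by (cases "i = j") (auto simp: sorted_wrt_iff_nth_less)
  have "{..<l} \<subseteq> {j. j < n \<and> ys ! j > c}"
  proof
    fix j assume j: "j \<in> {..<l}"
    then have "ys ! (l - 1) \<le> ys ! j" using mono[of j "l - 1"] assms by auto
    then show "j \<in> {j. j < n \<and> ys ! j > c}" using j lt assms by auto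
  qed
  then have "l \<le> card {j. j < n \<and> ys ! j > c}" using card_mono[of "{j. j < n \<and> ys ! j > c}" "{..<l}"] by fastforce
  moreover have "card {j. j < n \<and> ys ! j > c} = length (filter (\<lambda>x. x > c) ys)"
    using len by (simp add: length_filter_conv_card)
  moreover have "length (filter (\<lambda>x. x > c) ys) = length (filter (\<lambda>x. x > c) (map f [0..<n]))"
    by (simp add: ys_def rev_filter[symmetric] filter_sort)
  moreover have "\<dots> = card {i. i < n \<and> f i > c}"
    by (auto simp: length_filter_conv_card intro!: arg_cong[of _ _ card])
  ultimately show False using assms by simp
qed

text \<open>Gaussian elimination of one equation and one unknown. This is the dimension count behind the
  min-max principle: two subspaces meet as soon as their dimensions are large enough.\<close>

lemma underdetermined_system:
  fixes f :: "'r \<Rightarrow> 'k \<Rightarrow> complex"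
  assumes "finite R" "finite K" "card R < card K"
  shows "\<exists>z. (\<exists>k\<in>K. z k \<noteq> 0) \<and> (\<forall>k. k \<notin> K \<longrightarrow> z k = 0) \<and> (\<forall>r\<in>R. (\<Sum>k\<in>K. f r k * z k) = 0)"
  using assms
proof (induction R arbitrary: K f rule: finite_induct)
  case empty
  then obtain k0 where "k0 \<in> K" by fastforce
  then show ?case by (intro exI[of _ "\<lambda>k. if k = k0 then 1 else 0"]) auto
next
  case (insert r R)
  show ?case
  proof (cases "\<forall>k\<in>K. f r k = 0")
    case True
    have "card R < card K" using insert by simp
    from insert.IH[OF insert.prems(1) this, of f] True show ?thesis by auto
  next
    case False
    then obtain k0 where k0: "k0 \<in> K" "f r k0 \<noteq> 0" by blast
    define K' where "K' = K - {k0}"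
    have K': "finite K'" "K = insert k0 K'" "k0 \<notin> K'" using insert k0 by (auto simp: K'_def)
    have "card R < card K'" using insert K' by auto
    from insert.IH[OF K'(1) this, of "\<lambda>r' k. f r' k - f r' k0 * f r k / f r k0"]
    obtain z where z: "\<exists>k\<in>K'. z k \<noteq> 0" "\<And>k. k \<notin> K' \<Longrightarrow> z k = 0"
      and eq: "\<And>r'. r' \<in> R \<Longrightarrow> (\<Sum>k\<in>K'. (f r' k - f r' k0 * f r k / f r k0) * z k) = 0" by blast
    define z0 where "z0 = - (\<Sum>k\<in>K'. f r k * z k) / f r k0"
    have s: "(\<Sum>k\<in>K. f r' k * (z(k0 := z0)) k) = f r' k0 * z0 + (\<Sum>k\<in>K'. f r' k * z k)" for r'
      unfolding K'(2) using K' by (simp, intro sum.cong) auto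
    have "f r' k0 * z0 + (\<Sum>k\<in>K'. f r' k * z k) = 0" if "r' \<in> R" for r'
    proof -
      have "f r' k0 * z0 = - (\<Sum>k\<in>K'. f r' k0 * f r k / f r k0 * z k)"
        unfolding z0_def by (simp add: sum_distrib_left sum_divide_distrib sum_negf divide_simps mult_ac)
      then show ?thesis using eq[OF that] by (simp add: left_diff_distrib sum_subtractf)
    qed
    moreover have "f r k0 * z0 + (\<Sum>k\<in>K'. f r k * z k) = 0" using k0 by (simp add: z0_def)
    ultimately have "\<forall>r'\<in>insert r R. (\<Sum>k\<in>K. f r' k * (z(k0 := z0)) k) = 0"
      unfolding s by simp
    moreover obtain k1 where "k1 \<in> K'" "z k1 \<noteq> 0" using z(1) by blast
    then have "\<exists>k\<in>K. (z(k0 := z0)) k \<noteq> 0" using K' by (intro bexI[of _ k1]) auto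
    moreover have "\<forall>k. k \<notin> K \<longrightarrow> (z(k0 := z0)) k = 0" using z(2) K' by auto
    ultimately show ?thesis by blast
  qed
qed

definition l2norm :: "nat \<Rightarrow> (nat \<Rightarrow> complex) \<Rightarrow> real" where
  "l2norm n x = L2_set (\<lambda>i. cmod (x i)) {..<n}"

lemma l2norm_nonneg [simp]: "0 \<le> l2norm n x"
  by (simp add: l2norm_def)

lemma l2norm_sq: "(l2norm n x)\<^sup>2 = (\<Sum>i<n. (cmod (x i))\<^sup>2)"
  by (simp add: l2norm_def L2_set_def sum_nonneg)

lemma l2norm_pos: "i < n \<Longrightarrow> x i \<noteq> 0 \<Longrightarrow> 0 < l2norm n x"
proof -
  assume i: "i < n" "x i \<noteq> 0"
  then have "l2norm n x \<noteq> 0" unfolding l2norm_def by (auto simp: L2_set_eq_0_iff)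
  then show ?thesis using l2norm_nonneg[of n x] by linarith
qed

lemma l2norm_cong: "(\<And>i. i < n \<Longrightarrow> x i = y i) \<Longrightarrow> l2norm n x = l2norm n y"
  unfolding l2norm_def by (rule L2_set_cong) auto

lemma l2norm_triangle: "l2norm n (\<lambda>i. x i + y i) \<le> l2norm n x + l2norm n y"
proof -
  have "l2norm n (\<lambda>i. x i + y i) \<le> L2_set (\<lambda>i. cmod (x i) + cmod (y i)) {..<n}"
    unfolding l2norm_def by (rule L2_set_mono) (auto simp: norm_triangle_ineq)
  also have "\<dots> \<le> l2norm n x + l2norm n y" unfolding l2norm_def by (rule L2_set_triangle_ineq)
  finally show ?thesis .
qed

lemma l2norm_cauchy_schwarz: "cmod (\<Sum>i<n. cnj (x i) * y i) \<le> l2norm n x * l2norm n y"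
proof -
  have "cmod (\<Sum>i<n. cnj (x i) * y i) \<le> (\<Sum>i<n. cmod (cnj (x i) * y i))" by (rule norm_sum)
  also have "\<dots> = (\<Sum>i<n. \<bar>cmod (x i)\<bar> * \<bar>cmod (y i)\<bar>)" by (simp add: norm_mult)
  also have "\<dots> \<le> l2norm n x * l2norm n y" unfolding l2norm_def by (rule L2_set_mult_ineq)
  finally show ?thesis .
qed

lemma sum_cnj_self: "(\<Sum>i<n. cnj (x i) * x i) = complex_of_real ((l2norm n x)\<^sup>2)"
  by (simp add: l2norm_sq complex_norm_square mult.commute del: of_real_power)

lemma eigen_expansion:
  fixes u :: "nat \<Rightarrow> nat \<Rightarrow> complex" and ev :: "nat \<Rightarrow> real"
  assumes on: "\<And>i j. i < n \<Longrightarrow> j < n \<Longrightarrow> (\<Sum>k<n. cnj (u i k) * u j k) = (if i = j then 1 else 0)"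
    and comp: "\<And>k k'. k < n \<Longrightarrow> k' < n \<Longrightarrow> (\<Sum>i<n. u i k * cnj (u i k')) = (if k = k' then 1 else 0)"
    and eig: "\<And>i k. i < n \<Longrightarrow> k < n \<Longrightarrow> (\<Sum>k'<n. A k k' * u i k') = complex_of_real (ev i) * u i k"
  defines "c x i \<equiv> \<Sum>k<n. cnj (u i k) * x k"
  shows "(\<Sum>k<n. cnj (x k) * (\<Sum>k'<n. A k k' * x k')) = complex_of_real (\<Sum>i<n. ev i * (cmod (c x i))\<^sup>2)"
    and "(l2norm n x)\<^sup>2 = (\<Sum>i<n. (cmod (c x i))\<^sup>2)"
proof -
  have x: "x k = (\<Sum>i<n. c x i * u i k)" if k: "k < n" for k
  proof -
    have "(\<Sum>i<n. c x i * u i k) = (\<Sum>i<n. \<Sum>k'<n. u i k * cnj (u i k') * x k')"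
      by (simp add: c_def sum_distrib_right sum_distrib_left mult_ac)
    also have "\<dots> = (\<Sum>k'<n. (\<Sum>i<n. u i k * cnj (u i k')) * x k')"
      by (subst sum.swap) (simp add: sum_distrib_right)
    also have "\<dots> = (\<Sum>k'<n. if k = k' then x k' else 0)"
      by (intro sum.cong refl) (auto simp: comp k)
    finally show ?thesis using k by simp
  qed
  have cc: "cnj (c x i) = (\<Sum>k<n. cnj (x k) * u i k)" for i
    by (simp add: c_def mult.commute)
  have gen: "(\<Sum>k<n. cnj (x k) * (\<Sum>i<n. complex_of_real (e i) * c x i * u i k))
      = complex_of_real (\<Sum>i<n. e i * (cmod (c x i))\<^sup>2)" for e
  proof -
    have "(\<Sum>k<n. cnj (x k) * (\<Sum>i<n. complex_of_real (e i) * c x i * u i k))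
        = (\<Sum>i<n. \<Sum>k<n. complex_of_real (e i) * c x i * (cnj (x k) * u i k))"
      by (subst sum.swap) (simp add: sum_distrib_left mult_ac)
    also have "\<dots> = (\<Sum>i<n. complex_of_real (e i) * c x i * cnj (c x i))"
      unfolding cc by (simp only: sum_distrib_left)
    also have "\<dots> = (\<Sum>i<n. complex_of_real (e i * (cmod (c x i))\<^sup>2))"
      by (intro sum.cong refl) (simp only: of_real_mult complex_norm_square mult.assoc)
    finally show ?thesis by simp
  qed
  have Ax: "(\<Sum>k'<n. A k k' * x k') = (\<Sum>i<n. complex_of_real (ev i) * c x i * u i k)" if k: "k < n" for k
  proof -
    have "(\<Sum>k'<n. A k k' * x k') = (\<Sum>k'<n. \<Sum>i<n. c x i * (A k k' * u i k'))"
      by (intro sum.cong refl) (simp add: x sum_distrib_left mult_ac)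
    also have "\<dots> = (\<Sum>i<n. c x i * (\<Sum>k'<n. A k k' * u i k'))"
      by (subst sum.swap) (simp add: sum_distrib_left)
    also have "\<dots> = (\<Sum>i<n. complex_of_real (ev i) * c x i * u i k)"
      by (intro sum.cong refl) (simp add: eig k)
    finally show ?thesis .
  qed
  show "(\<Sum>k<n. cnj (x k) * (\<Sum>k'<n. A k k' * x k')) = complex_of_real (\<Sum>i<n. ev i * (cmod (c x i))\<^sup>2)"
    using gen[of ev] by (simp add: Ax)
  have "complex_of_real ((l2norm n x)\<^sup>2) = (\<Sum>k<n. cnj (x k) * (\<Sum>i<n. c x i * u i k))"
    unfolding sum_cnj_self[symmetric] by (intro sum.cong refl) (simp add: x)
  also have "\<dots> = complex_of_real (\<Sum>i<n. (cmod (c x i))\<^sup>2)" using gen[of "\<lambda>_. 1"] by simp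
  finally show "(l2norm n x)\<^sup>2 = (\<Sum>i<n. (cmod (c x i))\<^sup>2)" by (simp only: of_real_eq_iff)
qed

definition quad_form :: "complex Matrix.mat \<Rightarrow> nat \<Rightarrow> (nat \<Rightarrow> complex) \<Rightarrow> real" where
  "quad_form A n x = Re (\<Sum>k<n. cnj (x k) * (\<Sum>k'<n. A $$ (k, k') * x k'))"

text \<open>If fewer than \<open>l\<close> eigenvalues were at least \<open>c\<close>, then the \<open>l\<close>-dimensional coordinate space over \<open>I\<close>
  would contain a nonzero vector orthogonal to all their eigenvectors, and there the form is below \<open>c\<close>.\<close>

lemma eigval_desc_lower:
  assumes A: "A \<in> carrier_mat n n" and H: "\<And>i j. i < n \<Longrightarrow> j < n \<Longrightarrow> A $$ (i, j) = cnj (A $$ (j, i))"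
    and I: "I \<subseteq> {..<n}" "card I = l" and l: "1 \<le> l"
    and form: "\<And>x. (\<And>i. i \<notin> I \<Longrightarrow> x i = 0) \<Longrightarrow> quad_form A n x \<ge> c * (l2norm n x)\<^sup>2"
  shows "eigval_desc A l \<ge> c"
proof -
  obtain u ev where on: "\<And>i j. i < n \<Longrightarrow> j < n \<Longrightarrow> (\<Sum>k<n. cnj (u i k) * u j k) = (if i = j then 1 else 0)"
    and comp: "\<And>k k'. k < n \<Longrightarrow> k' < n \<Longrightarrow> (\<Sum>i<n. u i k * cnj (u i k')) = (if k = k' then 1 else 0)"
    and eig: "\<And>i k. i < n \<Longrightarrow> k < n \<Longrightarrow> (\<Sum>k'<n. A $$ (k, k') * u i k') = complex_of_real (ev i) * u i k"
    and ms: "image_mset Re (proots (char_poly A)) = mset (map ev [0..<n])"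
    by (rule hermitian_eigenbasis[OF A H]) blast+
  have finI: "finite I" using I finite_subset by auto
  have ln: "l \<le> n" using I card_mono[of "{..<n}" I] by auto
  have "card {i. i < n \<and> ev i \<ge> c} \<ge> l"
  proof (rule ccontr)
    assume "\<not> ?thesis"
    then have "card {i. i < n \<and> ev i \<ge> c} < card I" using I by simp
    then obtain z where z: "\<exists>k\<in>I. z k \<noteq> 0" "\<And>k. k \<notin> I \<Longrightarrow> z k = 0"
      and zT: "\<And>i. i < n \<Longrightarrow> ev i \<ge> c \<Longrightarrow> (\<Sum>k\<in>I. cnj (u i k) * z k) = 0"
      using underdetermined_system[of "{i. i < n \<and> ev i \<ge> c}" I "\<lambda>i k. cnj (u i k)"] finI by auto
    define b where "b i = (\<Sum>k<n. cnj (u i k) * z k)" for i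
    have b0: "b i = 0" if "i < n" "ev i \<ge> c" for i
      unfolding b_def using zT[OF that] I z(2)
      by (subst sum.mono_neutral_right[of "{..<n}" I]) auto
    have "(\<Sum>k<n. cnj (z k) * (\<Sum>k'<n. A $$ (k, k') * z k')) = complex_of_real (\<Sum>i<n. ev i * (cmod (b i))\<^sup>2)"
      unfolding b_def by (rule eigen_expansion(1)[OF on comp eig])
    then have q: "quad_form A n z = (\<Sum>i<n. ev i * (cmod (b i))\<^sup>2)" unfolding quad_form_def by simp
    have nz: "(l2norm n z)\<^sup>2 = (\<Sum>i<n. (cmod (b i))\<^sup>2)"
      unfolding b_def by (rule eigen_expansion(2)[OF on comp eig])
    have "0 < l2norm n z" using z(1) I l2norm_pos by blast
    then have "(l2norm n z)\<^sup>2 > 0" by simp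
    then have "(\<Sum>i<n. (cmod (b i))\<^sup>2) > 0" using nz by argo
    have "\<exists>i0<n. b i0 \<noteq> 0"
    proof (rule ccontr)
      assume "\<not> ?thesis"
      then have "(\<Sum>i<n. (cmod (b i))\<^sup>2) = 0" by simp
      then show False using \<open>(\<Sum>i<n. (cmod (b i))\<^sup>2) > 0\<close> by simp
    qed
    then obtain i0 where i0: "i0 < n" "b i0 \<noteq> 0" by blast
    then have "ev i0 < c" using b0 by force
    have "(\<Sum>i<n. ev i * (cmod (b i))\<^sup>2) < (\<Sum>i<n. c * (cmod (b i))\<^sup>2)"
    proof (rule sum_strict_mono_ex1)
      show "\<forall>i\<in>{..<n}. ev i * (cmod (b i))\<^sup>2 \<le> c * (cmod (b i))\<^sup>2"
      proof
        fix i assume "i \<in> {..<n}"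
        then show "ev i * (cmod (b i))\<^sup>2 \<le> c * (cmod (b i))\<^sup>2"
          using b0[of i] by (cases "ev i \<ge> c") (auto intro!: mult_right_mono)
      qed
      show "\<exists>i\<in>{..<n}. ev i * (cmod (b i))\<^sup>2 < c * (cmod (b i))\<^sup>2"
        using i0 \<open>ev i0 < c\<close> by (intro bexI[of _ i0]) auto
    qed auto
    then have "quad_form A n z < c * (l2norm n z)\<^sup>2" using q nz by (simp add: sum_distrib_left)
    then show False using form[of z] z(2) by force
  qed
  from descending_nth_ge[OF this l ln] show ?thesis
    unfolding eigval_desc_def ms sorted_list_of_multiset_mset .
qed

text \<open>If \<open>l\<close> eigenvalues exceeded \<open>c\<close>, then their eigenvectors would span a nonzero vector that vanishes
  on the fewer than \<open>l\<close> coordinates in \<open>J\<close>, and there the form is above \<open>c\<close>.\<close>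

lemma eigval_desc_upper:
  assumes A: "A \<in> carrier_mat n n" and H: "\<And>i j. i < n \<Longrightarrow> j < n \<Longrightarrow> A $$ (i, j) = cnj (A $$ (j, i))"
    and J: "finite J" "card J < l" and l: "l \<le> n"
    and form: "\<And>x. (\<And>i. i \<in> J \<Longrightarrow> x i = 0) \<Longrightarrow> quad_form A n x \<le> c * (l2norm n x)\<^sup>2"
  shows "eigval_desc A l \<le> c"
proof -
  obtain u ev where on: "\<And>i j. i < n \<Longrightarrow> j < n \<Longrightarrow> (\<Sum>k<n. cnj (u i k) * u j k) = (if i = j then 1 else 0)"
    and comp: "\<And>k k'. k < n \<Longrightarrow> k' < n \<Longrightarrow> (\<Sum>i<n. u i k * cnj (u i k')) = (if k = k' then 1 else 0)"
    and eig: "\<And>i k. i < n \<Longrightarrow> k < n \<Longrightarrow> (\<Sum>k'<n. A $$ (k, k') * u i k') = complex_of_real (ev i) * u i k"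
    and ms: "image_mset Re (proots (char_poly A)) = mset (map ev [0..<n])"
    by (rule hermitian_eigenbasis[OF A H]) blast+
  define T where "T = {i. i < n \<and> ev i > c}"
  have T: "T \<subseteq> {..<n}" "finite T" by (auto simp: T_def)
  have "card T < l"
  proof (rule ccontr)
    assume "\<not> ?thesis"
    then have "card J < card T" using J by simp
    then obtain z where z: "\<exists>k\<in>T. z k \<noteq> 0" "\<And>k. k \<notin> T \<Longrightarrow> z k = 0"
      and zJ: "\<And>k. k \<in> J \<Longrightarrow> (\<Sum>i\<in>T. u i k * z i) = 0"
      using underdetermined_system[OF J(1) T(2), of "\<lambda>k i. u i k"] by auto
    define x where "x k = (\<Sum>i\<in>T. u i k * z i)" for k
    have b: "(\<Sum>k<n. cnj (u i k) * x k) = z i" if i: "i < n" for i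
    proof -
      have "(\<Sum>k<n. cnj (u i k) * x k) = (\<Sum>j\<in>T. (\<Sum>k<n. cnj (u i k) * u j k) * z j)"
        unfolding x_def sum_distrib_left sum_distrib_right by (subst sum.swap) (simp add: mult_ac)
      also have "\<dots> = (\<Sum>j\<in>T. if i = j then z j else 0)"
        by (intro sum.cong refl) (use T i on in auto)
      also have "\<dots> = z i" using T z(2)[of i] by auto
      finally show ?thesis .
    qed
    have "(\<Sum>k<n. cnj (x k) * (\<Sum>k'<n. A $$ (k, k') * x k'))
        = complex_of_real (\<Sum>i<n. ev i * (cmod (\<Sum>k<n. cnj (u i k) * x k))\<^sup>2)"
      by (rule eigen_expansion(1)[OF on comp eig])
    then have q: "quad_form A n x = (\<Sum>i<n. ev i * (cmod (z i))\<^sup>2)" unfolding quad_form_def by (simp add: b)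
    have "(l2norm n x)\<^sup>2 = (\<Sum>i<n. (cmod (\<Sum>k<n. cnj (u i k) * x k))\<^sup>2)"
      by (rule eigen_expansion(2)[OF on comp eig])
    then have nx: "(l2norm n x)\<^sup>2 = (\<Sum>i<n. (cmod (z i))\<^sup>2)" by (simp add: b)
    obtain i0 where i0: "i0 \<in> T" "z i0 \<noteq> 0" using z(1) by blast
    have "(\<Sum>i<n. c * (cmod (z i))\<^sup>2) < (\<Sum>i<n. ev i * (cmod (z i))\<^sup>2)"
    proof (rule sum_strict_mono_ex1)
      show "\<forall>i\<in>{..<n}. c * (cmod (z i))\<^sup>2 \<le> ev i * (cmod (z i))\<^sup>2"
      proof
        fix i show "c * (cmod (z i))\<^sup>2 \<le> ev i * (cmod (z i))\<^sup>2"
          by (cases "i \<in> T") (auto simp: z(2) T_def intro!: mult_right_mono)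
      qed
      show "\<exists>i\<in>{..<n}. c * (cmod (z i))\<^sup>2 < ev i * (cmod (z i))\<^sup>2"
        using i0 by (intro bexI[of _ i0]) (auto simp: T_def)
    qed auto
    then have "quad_form A n x > c * (l2norm n x)\<^sup>2" using q nx by (simp add: sum_distrib_left)
    moreover have "quad_form A n x \<le> c * (l2norm n x)\<^sup>2" by (rule form) (simp add: x_def zJ)
    ultimately show False by simp
  qed
  moreover have "1 \<le> l" using J by simp
  ultimately show ?thesis using descending_nth_le[of n c ev l] l
    unfolding eigval_desc_def ms T_def sorted_list_of_multiset_mset by blast
qed

section \<open>Operator norm bounds\<close>

text \<open>The spectral norm of the \<open>p\<close> by \<open>n\<close> matrix \<open>F\<close> is at most \<open>s\<close>. Matrices are plain functions here: sums,
  products and adjoints then need no carrier conditions.\<close>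

definition op_bound :: "nat \<Rightarrow> nat \<Rightarrow> (nat \<Rightarrow> nat \<Rightarrow> complex) \<Rightarrow> real \<Rightarrow> bool" where
  "op_bound p n F s \<longleftrightarrow> 0 \<le> s \<and> (\<forall>x. l2norm p (\<lambda>i. \<Sum>j<n. F i j * x j) \<le> s * l2norm n x)"

lemma op_boundD: "op_bound p n F s \<Longrightarrow> l2norm p (\<lambda>i. \<Sum>j<n. F i j * x j) \<le> s * l2norm n x"
  and op_bound_nonneg: "op_bound p n F s \<Longrightarrow> 0 \<le> s"
  by (auto simp: op_bound_def)

lemma op_bound_cong:
  "op_bound p n F s \<Longrightarrow> (\<And>i j. i < p \<Longrightarrow> j < n \<Longrightarrow> F i j = G i j) \<Longrightarrow> op_bound p n G s"
  unfolding op_bound_def by (metis (no_types, lifting) l2norm_cong lessThan_iff sum.cong)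

lemma op_bound_mono: "op_bound p n F s \<Longrightarrow> s \<le> t \<Longrightarrow> op_bound p n F t"
  unfolding op_bound_def by (meson l2norm_nonneg mult_right_mono order_trans)

lemma op_bound_add:
  assumes "op_bound p n F s" "op_bound p n G t"
  shows "op_bound p n (\<lambda>i j. F i j + G i j) (s + t)"
  unfolding op_bound_def
proof (intro conjI allI)
  fix x
  have "l2norm p (\<lambda>i. \<Sum>j<n. (F i j + G i j) * x j)
      = l2norm p (\<lambda>i. (\<Sum>j<n. F i j * x j) + (\<Sum>j<n. G i j * x j))"
    by (simp add: distrib_right sum.distrib)
  also have "\<dots> \<le> l2norm p (\<lambda>i. \<Sum>j<n. F i j * x j) + l2norm p (\<lambda>i. \<Sum>j<n. G i j * x j)"
    by (rule l2norm_triangle)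
  also have "\<dots> \<le> (s + t) * l2norm n x"
    using op_boundD[OF assms(1), of x] op_boundD[OF assms(2), of x] by (simp add: distrib_right)
  finally show "l2norm p (\<lambda>i. \<Sum>j<n. (F i j + G i j) * x j) \<le> (s + t) * l2norm n x" .
qed (use assms op_bound_nonneg in auto)

lemma op_bound_mult:
  assumes "op_bound p n F s" "op_bound n q G t"
  shows "op_bound p q (\<lambda>i k. \<Sum>j<n. F i j * G j k) (s * t)"
  unfolding op_bound_def
proof (intro conjI allI)
  fix x
  have "(\<Sum>k<q. (\<Sum>j<n. F i j * G j k) * x k) = (\<Sum>j<n. F i j * (\<Sum>k<q. G j k * x k))" for i
    unfolding sum_distrib_right sum_distrib_left by (subst sum.swap) (simp add: mult.assoc)
  then have "l2norm p (\<lambda>i. \<Sum>k<q. (\<Sum>j<n. F i j * G j k) * x k)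
      \<le> s * l2norm n (\<lambda>j. \<Sum>k<q. G j k * x k)"
    using op_boundD[OF assms(1)] by simp
  also have "\<dots> \<le> s * (t * l2norm q x)"
    using op_boundD[OF assms(2)] op_bound_nonneg[OF assms(1)] by (intro mult_left_mono) auto
  finally show "l2norm p (\<lambda>i. \<Sum>k<q. (\<Sum>j<n. F i j * G j k) * x k) \<le> s * t * l2norm q x"
    by (simp add: mult.assoc)
qed (use assms op_bound_nonneg in auto)

text \<open>For \<open>y = F\<^sup>* x\<close> one has \<open>|y|^2 = <x, F y>\<close>, which is at most \<open>s |x| |y|\<close>.\<close>

lemma op_bound_adjoint:
  assumes "op_bound p n F s"
  shows "op_bound n p (\<lambda>j i. cnj (F i j)) s"
  unfolding op_bound_def
proof (intro conjI allI)
  fix x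
  define y where "y j = (\<Sum>i<p. cnj (F i j) * x i)" for j
  have "complex_of_real ((l2norm n y)\<^sup>2) = (\<Sum>j<n. cnj (y j) * y j)" by (rule sum_cnj_self[symmetric])
  also have "\<dots> = (\<Sum>j<n. \<Sum>i<p. cnj (x i) * (F i j * y j))"
    by (intro sum.cong refl, subst (1) y_def) (simp add: sum_distrib_right sum_distrib_left mult_ac)
  also have "\<dots> = (\<Sum>i<p. cnj (x i) * (\<Sum>j<n. F i j * y j))"
    by (subst sum.swap) (simp add: sum_distrib_left)
  finally have "(l2norm n y)\<^sup>2 = cmod (\<Sum>i<p. cnj (x i) * (\<Sum>j<n. F i j * y j))"
    by (metis abs_power2 norm_of_real)
  also have "\<dots> \<le> l2norm p x * l2norm p (\<lambda>i. \<Sum>j<n. F i j * y j)" by (rule l2norm_cauchy_schwarz)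
  also have "\<dots> \<le> l2norm p x * (s * l2norm n y)"
    using op_boundD[OF assms] by (intro mult_left_mono) auto
  finally have "l2norm n y * l2norm n y \<le> (s * l2norm p x) * l2norm n y"
    by (simp add: power2_eq_square mult_ac)
  then show "l2norm n y \<le> s * l2norm p x"
    using op_bound_nonneg[OF assms] by (cases "l2norm n y = 0") (auto simp: less_le)
qed (use assms op_bound_nonneg in auto)

lemma cmod_sum_sparse:
  fixes f :: "'a \<Rightarrow> complex"
  assumes "finite A" and "\<And>a a'. a \<in> A \<Longrightarrow> a' \<in> A \<Longrightarrow> f a \<noteq> 0 \<Longrightarrow> f a' \<noteq> 0 \<Longrightarrow> a = a'"
  shows "(cmod (\<Sum>a\<in>A. f a))\<^sup>2 = (\<Sum>a\<in>A. (cmod (f a))\<^sup>2)"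
proof (cases "\<exists>a\<in>A. f a \<noteq> 0")
  case True
  then obtain a where a: "a \<in> A" "f a \<noteq> 0" by blast
  have z: "f a' = 0" if "a' \<in> A - {a}" for a' using assms(2)[OF a(1) _ a(2)] that by auto
  show ?thesis using assms(1) a(1) z by (simp add: sum.remove[of A a])
qed auto

text \<open>A matrix with at most one nonzero entry in each row and column permutes and scales coordinates.\<close>

lemma op_bound_isolated:
  assumes b: "0 \<le> b" "\<And>i j. i < p \<Longrightarrow> j < n \<Longrightarrow> cmod (F i j) \<le> b"
    and row: "\<And>i j j'. i < p \<Longrightarrow> j < n \<Longrightarrow> j' < n \<Longrightarrow> F i j \<noteq> 0 \<Longrightarrow> F i j' \<noteq> 0 \<Longrightarrow> j = j'"
    and col: "\<And>i i' j. i < p \<Longrightarrow> i' < p \<Longrightarrow> j < n \<Longrightarrow> F i j \<noteq> 0 \<Longrightarrow> F i' j \<noteq> 0 \<Longrightarrow> i = i'"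
  shows "op_bound p n F b"
  unfolding op_bound_def
proof (intro conjI allI)
  fix x
  have colb: "(\<Sum>i<p. (cmod (F i j))\<^sup>2) \<le> b\<^sup>2" if j: "j < n" for j
  proof -
    have "(\<Sum>i<p. (cmod (F i j))\<^sup>2) = (cmod (\<Sum>i<p. F i j))\<^sup>2"
      by (rule cmod_sum_sparse[symmetric]) (use col j in auto)
    moreover have "cmod (\<Sum>i<p. F i j) \<le> b"
    proof (cases "\<exists>i<p. F i j \<noteq> 0")
      case True
      then obtain i where i: "i < p" "F i j \<noteq> 0" by blast
      have "F i' j = 0" if "i' \<in> {..<p} - {i}" for i' using col[OF i(1) _ j i(2)] that by auto
      then show ?thesis using i b(2)[OF i(1) j] by (simp add: sum.remove[of "{..<p}" i])
    qed (use b in auto)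
    ultimately show ?thesis by (simp add: power_mono)
  qed
  have "(l2norm p (\<lambda>i. \<Sum>j<n. F i j * x j))\<^sup>2 = (\<Sum>i<p. \<Sum>j<n. (cmod (F i j))\<^sup>2 * (cmod (x j))\<^sup>2)"
    unfolding l2norm_sq
  proof (intro sum.cong refl)
    fix i assume "i \<in> {..<p}"
    then have "(cmod (\<Sum>j<n. F i j * x j))\<^sup>2 = (\<Sum>j<n. (cmod (F i j * x j))\<^sup>2)"
      by (intro cmod_sum_sparse) (use row in auto)
    then show "(cmod (\<Sum>j<n. F i j * x j))\<^sup>2 = (\<Sum>j<n. (cmod (F i j))\<^sup>2 * (cmod (x j))\<^sup>2)"
      by (simp add: norm_mult power_mult_distrib)
  qed
  also have "\<dots> = (\<Sum>j<n. (\<Sum>i<p. (cmod (F i j))\<^sup>2) * (cmod (x j))\<^sup>2)"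
    by (subst sum.swap) (simp add: sum_distrib_right)
  also have "\<dots> \<le> (\<Sum>j<n. b\<^sup>2 * (cmod (x j))\<^sup>2)"
    by (intro sum_mono mult_right_mono) (use colb in auto)
  also have "\<dots> = (b * l2norm n x)\<^sup>2" by (simp add: power_mult_distrib l2norm_sq sum_distrib_left)
  finally show "l2norm p (\<lambda>i. \<Sum>j<n. F i j * x j) \<le> b * l2norm n x"
    by (rule power2_le_imp_le) (use b in auto)
qed (rule b)

section \<open>Perturbation of a diagonal matrix\<close>

text \<open>The quadratic form of \<open>A\<close> differs from that of the diagonal \<open>d\<close> by at most \<open>e\<close> on unit vectors, so the
  coordinate spaces over \<open>I\<close> and off \<open>J\<close> serve as test spaces for the min-max bounds.\<close>

lemma eigval_desc_diagonal_perturbation: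
  fixes A :: "complex Matrix.mat" and d :: "nat \<Rightarrow> real"
  assumes A: "A \<in> carrier_mat p p" and H: "\<And>i j. i < p \<Longrightarrow> j < p \<Longrightarrow> A $$ (i, j) = cnj (A $$ (j, i))"
    and dec: "\<And>i j. i < p \<Longrightarrow> j < p \<Longrightarrow> A $$ (i, j) = (if i = j then complex_of_real (d i) else 0) + E i j"
    and E: "op_bound p p E e"
    and I: "I \<subseteq> {..<p}" "card I = l" "\<And>i. i \<in> I \<Longrightarrow> c \<le> d i"
    and J: "finite J" "card J < l" "\<And>i. i < p \<Longrightarrow> i \<notin> J \<Longrightarrow> d i \<le> c"
  shows "\<bar>eigval_desc A l - c\<bar> \<le> e"
proof -
  have q: "\<bar>quad_form A p x - (\<Sum>i<p. d i * (cmod (x i))\<^sup>2)\<bar> \<le> e * (l2norm p x)\<^sup>2" for x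
  proof -
    define w where "w = (\<Sum>i<p. cnj (x i) * (\<Sum>j<p. E i j * x j))"
    have "(\<Sum>i<p. cnj (x i) * (\<Sum>j<p. A $$ (i, j) * x j))
        = (\<Sum>i<p. cnj (x i) * (complex_of_real (d i) * x i + (\<Sum>j<p. E i j * x j)))"
    proof (intro sum.cong refl arg_cong2[of _ _ _ _ times])
      fix i assume i: "i \<in> {..<p}"
      have "(\<Sum>j<p. A $$ (i, j) * x j) = (\<Sum>j<p. (if i = j then complex_of_real (d i) * x i else 0) + E i j * x j)"
        by (intro sum.cong refl) (use i dec in \<open>auto simp: distrib_right\<close>)
      also have "\<dots> = complex_of_real (d i) * x i + (\<Sum>j<p. E i j * x j)"
        using i by (simp add: sum.distrib)
      finally show "(\<Sum>j<p. A $$ (i, j) * x j) = complex_of_real (d i) * x i + (\<Sum>j<p. E i j * x j)" .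
    qed
    also have "\<dots> = (\<Sum>i<p. complex_of_real (d i * (cmod (x i))\<^sup>2)) + w"
      unfolding w_def by (simp add: distrib_left sum.distrib complex_norm_square mult_ac del: of_real_power)
    finally have "quad_form A p x = (\<Sum>i<p. d i * (cmod (x i))\<^sup>2) + Re w"
      unfolding quad_form_def by (simp flip: of_real_sum)
    moreover have "cmod w \<le> l2norm p x * l2norm p (\<lambda>i. \<Sum>j<p. E i j * x j)"
      unfolding w_def by (rule l2norm_cauchy_schwarz)
    moreover have "\<dots> \<le> l2norm p x * (e * l2norm p x)"
      by (intro mult_left_mono op_boundD[OF E]) auto
    ultimately show ?thesis using abs_Re_le_cmod[of w] by (simp add: power2_eq_square mult_ac)
  qed
  have l: "1 \<le> l" "l \<le> p" using J(2) I(1,2) card_mono[of "{..<p}" I] by auto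
  have "eigval_desc A l \<ge> c - e"
  proof (rule eigval_desc_lower[OF A H I(1,2) l(1)])
    fix x :: "nat \<Rightarrow> complex" assume x: "\<And>i. i \<notin> I \<Longrightarrow> x i = 0"
    have "c * (l2norm p x)\<^sup>2 \<le> (\<Sum>i<p. d i * (cmod (x i))\<^sup>2)"
      unfolding l2norm_sq sum_distrib_left
    proof (rule sum_mono)
      fix i show "c * (cmod (x i))\<^sup>2 \<le> d i * (cmod (x i))\<^sup>2"
        by (cases "i \<in> I") (auto simp: x intro!: mult_right_mono I(3))
    qed
    then show "(c - e) * (l2norm p x)\<^sup>2 \<le> quad_form A p x" using q[of x] by (simp add: left_diff_distrib)
  qed
  moreover have "eigval_desc A l \<le> c + e"
  proof (rule eigval_desc_upper[OF A H J(1,2) l(2)])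
    fix x :: "nat \<Rightarrow> complex" assume x: "\<And>i. i \<in> J \<Longrightarrow> x i = 0"
    have "(\<Sum>i<p. d i * (cmod (x i))\<^sup>2) \<le> c * (l2norm p x)\<^sup>2"
      unfolding l2norm_sq sum_distrib_left
    proof (rule sum_mono)
      fix i assume "i \<in> {..<p}"
      then show "d i * (cmod (x i))\<^sup>2 \<le> c * (cmod (x i))\<^sup>2"
        by (cases "i \<in> J") (auto simp: x intro!: mult_right_mono J(3))
    qed
    then show "quad_form A p x \<le> (c + e) * (l2norm p x)\<^sup>2" using q[of x] by (simp add: distrib_right)
  qed
  ultimately show ?thesis by linarith
qed

text \<open>The unit scalar that rotates \<open>z\<close> to the nonnegative real axis; it fixes the phase of the
  eigenvector through its dominant coordinate.\<close>

definition phase_to_real :: "complex \<Rightarrow> complex" where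
  "phase_to_real z = (if z = 0 then 1 else cnj z / complex_of_real (cmod z))"

lemma cmod_phase_to_real [simp]: "cmod (phase_to_real z) = 1"
  by (simp add: phase_to_real_def norm_divide)

lemma phase_to_real_mult: "phase_to_real z * z = complex_of_real (cmod z)"
proof (cases "z = 0")
  case False
  have "cnj z * z = complex_of_real (cmod z) * complex_of_real (cmod z)"
    using complex_norm_square[of z] by (simp add: power2_eq_square mult.commute)
  then show ?thesis using False by (simp add: phase_to_real_def)
qed (simp add: phase_to_real_def)

text \<open>Coordinatewise the eigenvalue equation reads \<open>(t - d i) v i = (E v) i\<close>. Off \<open>i0\<close> the factor is at least
  \<open>g - e\<close>, so the mass of \<open>v\<close> outside \<open>i0\<close> is at most \<open>(e / (g - e))^2\<close>, and the remaining coordinate has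
  modulus close to one.\<close>

lemma eigenvector_localization:
  fixes A :: "complex Matrix.mat" and d :: "nat \<Rightarrow> real"
  assumes A: "A \<in> carrier_mat p p"
    and dec: "\<And>i j. i < p \<Longrightarrow> j < p \<Longrightarrow> A $$ (i, j) = (if i = j then complex_of_real (d i) else 0) + E i j"
    and E: "op_bound p p E e"
    and v: "eigenvector A v (complex_of_real t)" "norm2 v = 1"
    and i0: "i0 < p" and t: "\<bar>t - d i0\<bar> \<le> e" and gap: "\<And>i. i < p \<Longrightarrow> i \<noteq> i0 \<Longrightarrow> g \<le> \<bar>d i - d i0\<bar>" and g: "e < g"
  shows "norm2 (phase_to_real (v $ i0) \<cdot>\<^sub>v v - unit_vec p i0) \<le> 2 * (e / (g - e))"
proof -
  define \<theta> where "\<theta> = phase_to_real (v $ i0)"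
  define x where "x i = v $ i" for i
  have vc: "v \<in> carrier_vec p" and Av: "A *\<^sub>v v = complex_of_real t \<cdot>\<^sub>v v"
    using v(1) A by (auto simp: eigenvector_def)
  have n1: "(\<Sum>i<p. (cmod (x i))\<^sup>2) = 1" using v(2) vc by (simp add: norm2_def x_def)
  have Ex: "cmod (\<Sum>j<p. E i j * x j) = \<bar>t - d i\<bar> * cmod (x i)" if i: "i < p" for i
  proof -
    have "(A *\<^sub>v v) $ i = (\<Sum>j<p. A $$ (i, j) * x j)"
      using i A vc by (simp add: scalar_prod_def atLeast0LessThan x_def)
    also have "\<dots> = (\<Sum>j<p. (if i = j then complex_of_real (d i) * x i else 0) + E i j * x j)"
      by (intro sum.cong refl) (use i dec in \<open>auto simp: distrib_right\<close>)
    also have "\<dots> = complex_of_real (d i) * x i + (\<Sum>j<p. E i j * x j)" using i by (simp add: sum.distrib)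
    finally have "(\<Sum>j<p. E i j * x j) = complex_of_real (t - d i) * x i"
      using i vc unfolding Av by (simp add: x_def left_diff_distrib)
    then show ?thesis by (simp only: norm_mult norm_of_real)
  qed
  define R where "R = (\<Sum>i\<in>{..<p} - {i0}. (cmod (x i))\<^sup>2)"
  have R0: "0 \<le> R" unfolding R_def by (intro sum_nonneg) auto
  have split: "(cmod (x i0))\<^sup>2 + R = 1" using n1 i0 unfolding R_def by (simp add: sum.remove[of "{..<p}" i0])
  have "(g - e)\<^sup>2 * R \<le> (\<Sum>i\<in>{..<p} - {i0}. (cmod (\<Sum>j<p. E i j * x j))\<^sup>2)"
    unfolding R_def sum_distrib_left
  proof (rule sum_mono)
    fix i assume i: "i \<in> {..<p} - {i0}"
    have "g - e \<le> \<bar>t - d i\<bar>" using gap[of i] i t by auto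
    then have "(g - e) * cmod (x i) \<le> \<bar>t - d i\<bar> * cmod (x i)" by (intro mult_right_mono) auto
    then have "((g - e) * cmod (x i))\<^sup>2 \<le> (\<bar>t - d i\<bar> * cmod (x i))\<^sup>2" using g by (intro power_mono) auto
    then show "(g - e)\<^sup>2 * (cmod (x i))\<^sup>2 \<le> (cmod (\<Sum>j<p. E i j * x j))\<^sup>2"
      using Ex[of i] i by (simp add: power_mult_distrib)
  qed
  also have "\<dots> \<le> (\<Sum>i<p. (cmod (\<Sum>j<p. E i j * x j))\<^sup>2)" by (intro sum_mono2) auto
  also have "\<dots> = (l2norm p (\<lambda>i. \<Sum>j<p. E i j * x j))\<^sup>2" by (simp add: l2norm_sq)
  also have "\<dots> \<le> (e * l2norm p x)\<^sup>2" using op_boundD[OF E, of x] by (intro power_mono) auto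
  also have "\<dots> = e\<^sup>2" using n1 by (simp add: power_mult_distrib l2norm_sq)
  finally have R: "R \<le> (e / (g - e))\<^sup>2" using g by (simp add: power_divide pos_le_divide_eq mult.commute)
  have a1: "cmod (x i0) \<le> 1" using split R0 by (simp add: power2_le_imp_le[of _ 1])
  have "(norm2 (\<theta> \<cdot>\<^sub>v v - unit_vec p i0))\<^sup>2 = (\<Sum>i<p. (cmod (\<theta> * x i - (if i = i0 then 1 else 0)))\<^sup>2)"
  proof -
    have "(norm2 (\<theta> \<cdot>\<^sub>v v - unit_vec p i0))\<^sup>2 = (\<Sum>i<p. (cmod ((\<theta> \<cdot>\<^sub>v v - unit_vec p i0) $ i))\<^sup>2)"
      by (simp add: norm2_def sum_nonneg)
    also have "\<dots> = (\<Sum>i<p. (cmod (\<theta> * x i - (if i = i0 then 1 else 0)))\<^sup>2)"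
      by (intro sum.cong refl) (use vc in \<open>auto simp: x_def unit_vec_def\<close>)
    finally show ?thesis .
  qed
  also have "\<dots> = (cmod (\<theta> * x i0 - 1))\<^sup>2 + (\<Sum>i\<in>{..<p} - {i0}. (cmod (\<theta> * x i - (if i = i0 then 1 else 0)))\<^sup>2)"
    using i0 by (simp add: sum.remove[of "{..<p}" i0])
  also have "(\<Sum>i\<in>{..<p} - {i0}. (cmod (\<theta> * x i - (if i = i0 then 1 else 0)))\<^sup>2) = R"
    unfolding R_def by (intro sum.cong refl) (auto simp: norm_mult \<theta>_def)
  also have "\<theta> * x i0 - 1 = complex_of_real (cmod (x i0) - 1)" by (simp add: \<theta>_def x_def phase_to_real_mult)
  also have "(cmod (complex_of_real (cmod (x i0) - 1)))\<^sup>2 = (1 - cmod (x i0))\<^sup>2"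
    unfolding norm_of_real by (simp add: power2_commute)
  also have "\<dots> \<le> (1 - cmod (x i0)) * (1 + cmod (x i0))"
    unfolding power2_eq_square using a1 by (intro mult_left_mono) auto
  also have "\<dots> = R" using split by (simp add: power2_eq_square algebra_simps)
  finally have "(norm2 (\<theta> \<cdot>\<^sub>v v - unit_vec p i0))\<^sup>2 \<le> 2 * R" by simp
  also have "\<dots> \<le> (2 * (e / (g - e)))\<^sup>2" using R R0 by (simp add: power_mult_distrib power_divide)
  finally show ?thesis unfolding \<theta>_def
    by (rule power2_le_imp_le) (use g op_bound_nonneg[OF E] in auto)
qed

text \<open>Split the matrix as \<open>B + S\<close>, with \<open>B\<close> the entries above the level \<open>K\<close>. Since these are isolated,
  \<open>B B\<^sup>*\<close> is diagonal and its diagonal consists of zeros and of the squared moduli of the large entries.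
  The other three products make up a perturbation of norm at most \<open>2 b s + s^2\<close>, where \<open>b\<close> bounds the norm of \<open>B\<close>.\<close>

theorem isolated_large_entries:
  fixes m :: "nat \<times> nat \<Rightarrow> complex"
  assumes r: "ranks_entries p n m r" and l: "1 \<le> l" "l \<le> p * n" and K: "0 \<le> K"
    and iso: "\<And>q q'. q \<in> positions p n \<Longrightarrow> q' \<in> positions p n \<Longrightarrow> q \<noteq> q' \<Longrightarrow>
       cmod (m q) > K \<Longrightarrow> cmod (m q') > K \<Longrightarrow> fst q \<noteq> fst q' \<and> snd q \<noteq> snd q'"
    and big: "K < cmod (m (r l))" and b: "\<And>q. q \<in> positions p n \<Longrightarrow> cmod (m q) \<le> b"
    and S: "op_bound p n (\<lambda>i j. if cmod (m (i, j)) \<le> K then m (i, j) else 0) s"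
  defines "e \<equiv> 2 * b * s + s\<^sup>2" and "ml \<equiv> cmod (m (r l))"
  shows "l \<le> p" and "\<bar>eigval_desc (sample_covariance p n m) l - ml\<^sup>2\<bar> \<le> e"
    and "\<And>c v. 1 < c \<Longrightarrow> (\<And>q. q \<in> positions p n \<Longrightarrow> q \<noteq> r l \<Longrightarrow> c * cmod (m q) \<le> ml \<or> c * ml \<le> cmod (m q)) \<Longrightarrow>
        e < (1 - 1 / c\<^sup>2) * ml\<^sup>2 \<Longrightarrow> unit_eigenvector (sample_covariance p n m) l v \<Longrightarrow>
        norm2 (phase_to_real (v $ fst (r l)) \<cdot>\<^sub>v v - unit_vec p (fst (r l))) \<le> 2 * (e / ((1 - 1 / c\<^sup>2) * ml\<^sup>2 - e))"
proof -
  define A where "A = sample_covariance p n m"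
  define B where "B i j = (if cmod (m (i, j)) \<le> K then 0 else m (i, j))" for i j
  define T where "T i j = (if cmod (m (i, j)) \<le> K then m (i, j) else 0)" for i j
  define E where "E i k = (\<Sum>j<n. B i j * cnj (T k j)) + (\<Sum>j<n. T i j * cnj (B k j)) + (\<Sum>j<n. T i j * cnj (T k j))" for i k
  define d where "d i = (\<Sum>j<n. (cmod (B i j))\<^sup>2)" for i
  have rb: "bij_betw r {1..p * n} ({..<p} \<times> {..<n})"
    and rmono: "\<And>k k'. 1 \<le> k \<Longrightarrow> k \<le> k' \<Longrightarrow> k' \<le> p * n \<Longrightarrow> cmod (m (r k')) \<le> cmod (m (r k))"
    using r by (auto simp: ranks_entries_def positions_def)
  have rpos: "r k \<in> positions p n" if "1 \<le> k" "k \<le> p * n" for k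
    using bij_betwE[OF rb] that unfolding positions_def by simp
  have b0: "0 \<le> b" using b[OF rpos[OF l]] norm_ge_zero order_trans by blast
  have A: "A \<in> carrier_mat p p" by (auto simp: A_def sample_covariance_def Let_def)
  have Aij: "A $$ (i, k) = (\<Sum>j<n. m (i, j) * cnj (m (k, j)))" if "i < p" "k < p" for i k
    using that by (simp add: A_def sample_covariance_def Let_def scalar_prod_def atLeast0LessThan
        mat_adjoint_index[of _ p n])
  have H: "A $$ (i, j) = cnj (A $$ (j, i))" if "i < p" "j < p" for i j
    using that by (simp add: Aij mult.commute)
  have rowB: "j = j'" if "i < p" "j < n" "j' < n" "B i j \<noteq> 0" "B i j' \<noteq> 0" for i j j'
    using iso[of "(i, j)" "(i, j')"] that by (auto simp: B_def positions_def split: if_splits)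
  have colB: "i = i'" if "i < p" "i' < p" "j < n" "B i j \<noteq> 0" "B i' j \<noteq> 0" for i i' j
    using iso[of "(i, j)" "(i', j)"] that by (auto simp: B_def positions_def split: if_splits)
  have opB: "op_bound p n B b"
    by (rule op_bound_isolated) (use b0 b rowB colB in \<open>auto simp: B_def positions_def split: if_splits\<close>)
  have opT: "op_bound p n T s" by (rule op_bound_cong[OF S]) (simp add: T_def)
  have E: "op_bound p p E e"
    unfolding E_def
    by (rule op_bound_mono[OF op_bound_add[OF op_bound_add[OF op_bound_mult[OF opB op_bound_adjoint[OF opT]]
       op_bound_mult[OF opT op_bound_adjoint[OF opB]]] op_bound_mult[OF opT op_bound_adjoint[OF opT]]]])
       (simp add: e_def power2_eq_square)
  have dec: "A $$ (i, k) = (if i = k then complex_of_real (d i) else 0) + E i k" if ik: "i < p" "k < p" for i k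
  proof -
    have "A $$ (i, k) = (\<Sum>j<n. B i j * cnj (B k j)) + E i k"
      unfolding Aij[OF ik] E_def sum.distrib[symmetric] add.assoc[symmetric]
      by (intro sum.cong refl) (auto simp: B_def T_def)
    moreover have "(\<Sum>j<n. B i j * cnj (B k j)) = (if i = k then complex_of_real (d i) else 0)"
    proof (cases "i = k")
      case True
      then show ?thesis by (simp add: d_def complex_norm_square del: of_real_power)
    next
      case False
      have "B i j * cnj (B k j) = 0" if "j < n" for j using colB[OF ik that] False by auto
      then have "(\<Sum>j<n. B i j * cnj (B k j)) = 0" by (intro sum.neutral) blast
      then show ?thesis using False by simp
    qed
    ultimately show ?thesis by simp
  qed
  have d_big: "d i = (cmod (m (i, j)))\<^sup>2" if "i < p" "j < n" "K < cmod (m (i, j))" for i j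
  proof -
    have "B i j' = 0" if "j' \<in> {..<n} - {j}" for j'
    proof -
      have "B i j \<noteq> 0" using \<open>K < cmod (m (i, j))\<close> K by (auto simp: B_def)
      then show ?thesis using rowB[of i j j'] that \<open>i < p\<close> \<open>j < n\<close> by auto
    qed
    then show ?thesis using that unfolding d_def by (simp add: sum.remove[of "{..<n}" j] B_def)
  qed
  have d_cases: "d i = 0 \<or> (\<exists>k. 1 \<le> k \<and> k \<le> p * n \<and> fst (r k) = i \<and> d i = (cmod (m (r k)))\<^sup>2)" if i: "i < p" for i
  proof (cases "\<exists>j<n. K < cmod (m (i, j))")
    case True
    then obtain j where j: "j < n" "K < cmod (m (i, j))" by blast
    have "(i, j) \<in> r ` {1..p * n}" using rb i j by (auto simp: bij_betw_def)
    then obtain k where "k \<in> {1..p * n}" "r k = (i, j)" by force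
    then show ?thesis using d_big[OF i j] by (intro disjI2 exI[of _ k]) auto
  next
    case False
    then have "B i j = 0" if "j < n" for j
      using False that by (metis B_def not_le_imp_less)
    then show ?thesis by (simp add: d_def)
  qed
  have bigk: "K < cmod (m (r k))" if "1 \<le> k" "k \<le> l" for k using rmono[of k l] big l that by linarith
  have d_r: "d (fst (r k)) = (cmod (m (r k)))\<^sup>2" if "1 \<le> k" "k \<le> l" for k
    using d_big[of "fst (r k)" "snd (r k)"] bigk[OF that] rpos[of k] that l by (auto simp: positions_def)
  define I where "I = (\<lambda>k. fst (r k)) ` {1..l}"
  define J where "J = (\<lambda>k. fst (r k)) ` {1..<l}"
  have inj: "inj_on (\<lambda>k. fst (r k)) {1..l}"
  proof (rule inj_onI)
    fix k k' assume k: "k \<in> {1..l}" "k' \<in> {1..l}" and eq: "fst (r k) = fst (r k')"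
    then have "r k = r k'" using iso[of "r k" "r k'"] rpos[of k] rpos[of k'] bigk[of k] bigk[of k'] l by auto
    moreover have "inj_on r {1..p * n}" using rb by (simp add: bij_betw_def)
    ultimately show "k = k'" using k l by (auto dest: inj_onD)
  qed
  have I: "I \<subseteq> {..<p}" "card I = l" "\<And>i. i \<in> I \<Longrightarrow> ml\<^sup>2 \<le> d i"
  proof -
    show "I \<subseteq> {..<p}" unfolding I_def using rpos l by (auto simp: positions_def) (metis le_trans mem_Sigma_iff lessThan_iff prod.collapse)
    show "card I = l" unfolding I_def using inj by (simp add: card_image)
    fix i assume "i \<in> I"
    then obtain k where k: "1 \<le> k" "k \<le> l" "i = fst (r k)" by (auto simp: I_def)
    then show "ml\<^sup>2 \<le> d i" using d_r[OF k(1,2)] rmono[of k l] l unfolding ml_def by (auto intro!: power_mono)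
  qed
  have J: "finite J" "card J < l" "\<And>i. i < p \<Longrightarrow> i \<notin> J \<Longrightarrow> d i \<le> ml\<^sup>2"
  proof -
    show "finite J" by (simp add: J_def)
    show "card J < l" using card_image_le[of "{1..<l}" "\<lambda>k. fst (r k)"] l unfolding J_def by simp
    fix i assume i: "i < p" "i \<notin> J"
    from d_cases[OF i(1)] show "d i \<le> ml\<^sup>2"
    proof
      assume "\<exists>k. 1 \<le> k \<and> k \<le> p * n \<and> fst (r k) = i \<and> d i = (cmod (m (r k)))\<^sup>2"
      then obtain k where k: "1 \<le> k" "k \<le> p * n" "fst (r k) = i" "d i = (cmod (m (r k)))\<^sup>2" by blast
      then have "l \<le> k" using i(2) by (force simp: J_def)
      then show ?thesis using k rmono[of l k] l unfolding ml_def by (auto intro!: power_mono)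
    qed simp
  qed
  show "l \<le> p" using I card_mono[of "{..<p}" I] by auto
  show ev: "\<bar>eigval_desc (sample_covariance p n m) l - ml\<^sup>2\<bar> \<le> e"
    using eigval_desc_diagonal_perturbation[OF A H dec E I J] by (simp add: A_def)
  fix c v assume c: "1 < c" and sep: "\<And>q. q \<in> positions p n \<Longrightarrow> q \<noteq> r l \<Longrightarrow> c * cmod (m q) \<le> ml \<or> c * ml \<le> cmod (m q)"
    and g: "e < (1 - 1 / c\<^sup>2) * ml\<^sup>2" and v: "unit_eigenvector (sample_covariance p n m) l v"
  have dl: "d (fst (r l)) = ml\<^sup>2" using d_r[of l] l by (simp add: ml_def)
  show "norm2 (phase_to_real (v $ fst (r l)) \<cdot>\<^sub>v v - unit_vec p (fst (r l))) \<le> 2 * (e / ((1 - 1 / c\<^sup>2) * ml\<^sup>2 - e))"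
  proof (rule eigenvector_localization[OF A dec E _ _ _ _ _ g])
    show "eigenvector A v (complex_of_real (eigval_desc A l))" "norm2 v = 1"
      using v by (auto simp: unit_eigenvector_def A_def)
    show "fst (r l) < p" using rpos[OF l] by (auto simp: positions_def)
    show "\<bar>eigval_desc A l - d (fst (r l))\<bar> \<le> e" using ev by (simp add: dl A_def)
    fix i assume i: "i < p" "i \<noteq> fst (r l)"
    have c2: "1 < c\<^sup>2" using c by (simp add: one_less_power)
    have g1: "(1 - 1 / c\<^sup>2) * ml\<^sup>2 \<le> ml\<^sup>2" by (simp add: algebra_simps)
    have c3: "1 - 1 / c\<^sup>2 \<le> c\<^sup>2 - 1"
    proof -
      have "(c\<^sup>2 - 1) / c\<^sup>2 \<le> c\<^sup>2 - 1" using c2 c by (simp add: divide_le_eq)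
      then show ?thesis using c2 c by (simp add: diff_divide_distrib)
    qed
    from d_cases[OF i(1)] show "(1 - 1 / c\<^sup>2) * ml\<^sup>2 \<le> \<bar>d i - d (fst (r l))\<bar>"
    proof
      assume "\<exists>k. 1 \<le> k \<and> k \<le> p * n \<and> fst (r k) = i \<and> d i = (cmod (m (r k)))\<^sup>2"
      then obtain k where k: "1 \<le> k" "k \<le> p * n" "fst (r k) = i" "d i = (cmod (m (r k)))\<^sup>2" by blast
      then have "r k \<noteq> r l" using i(2) by auto
      from sep[OF rpos[OF k(1,2)] this] show ?thesis
      proof
        assume "c * cmod (m (r k)) \<le> ml"
        then have "(c * cmod (m (r k)))\<^sup>2 \<le> ml\<^sup>2" using c by (intro power_mono) auto
        then have "d i \<le> ml\<^sup>2 / c\<^sup>2" using c2 c k(4) by (simp add: power_mult_distrib pos_le_divide_eq mult.commute)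
        then show ?thesis by (simp add: dl algebra_simps)
      next
        assume "c * ml \<le> cmod (m (r k))"
        then have "(c * ml)\<^sup>2 \<le> d i" using c k(4) by (simp add: ml_def power_mono)
        then have "(c\<^sup>2 - 1) * ml\<^sup>2 \<le> d i - ml\<^sup>2" by (simp add: power_mult_distrib algebra_simps)
        moreover have "(1 - 1 / c\<^sup>2) * ml\<^sup>2 \<le> (c\<^sup>2 - 1) * ml\<^sup>2" using c3 by (intro mult_right_mono) auto
        ultimately show ?thesis by (simp add: dl)
      qed
    qed (use g1 in \<open>simp add: dl\<close>)
  qed
qed

section \<open>Powers of a Gram matrix as sums over walks\<close>

text \<open>A walk of \<open>k\<close> double steps row - column - row is encoded as the list of its pairs (column, next row);
  the starting row is kept separately. Summing by recursion on the length avoids index sets of lists.\<close>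

fun walk_sum :: "nat \<Rightarrow> nat \<Rightarrow> nat \<Rightarrow> ((nat \<times> nat) list \<Rightarrow> 'b) \<Rightarrow> 'b::comm_monoid_add" where
  "walk_sum p n 0 g = g []"
| "walk_sum p n (Suc k) g = (\<Sum>j<n. \<Sum>a<p. walk_sum p n k (\<lambda>w. g ((j, a) # w)))"

fun walk_end :: "nat \<Rightarrow> (nat \<times> nat) list \<Rightarrow> nat" where
  "walk_end i [] = i"
| "walk_end i ((j, a) # w) = walk_end a w"

fun walk_edges :: "nat \<Rightarrow> (nat \<times> nat) list \<Rightarrow> (nat \<times> nat) set" where
  "walk_edges i [] = {}"
| "walk_edges i ((j, a) # w) = insert (i, j) (insert (a, j) (walk_edges a w))"

fun walk_prod :: "(nat \<times> nat \<Rightarrow> complex) \<Rightarrow> nat \<Rightarrow> (nat \<times> nat) list \<Rightarrow> complex" where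
  "walk_prod Z i [] = 1"
| "walk_prod Z i ((j, a) # w) = Z (i, j) * cnj (Z (a, j)) * walk_prod Z a w"

definition walks :: "nat \<Rightarrow> nat \<Rightarrow> nat \<Rightarrow> (nat \<times> nat) list set" where
  "walks p n k = {w. length w = k \<and> set w \<subseteq> {..<n} \<times> {..<p}}"

lemma walks_Cons: "w \<in> walks p n k \<Longrightarrow> j < n \<Longrightarrow> a < p \<Longrightarrow> (j, a) # w \<in> walks p n (Suc k)"
  by (simp add: walks_def)

lemma walk_sum_cong:
  "(\<And>w. w \<in> walks p n k \<Longrightarrow> f w = g w) \<Longrightarrow> walk_sum p n k f = walk_sum p n k g"
proof (induction k arbitrary: f g)
  case (Suc k)
  show ?case unfolding walk_sum.simps
    by (intro sum.cong refl Suc.IH Suc.prems walks_Cons) simp_all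
qed (simp add: walks_def)

lemma walk_sum_mono:
  fixes f g :: "(nat \<times> nat) list \<Rightarrow> real"
  shows "(\<And>w. w \<in> walks p n k \<Longrightarrow> f w \<le> g w) \<Longrightarrow> walk_sum p n k f \<le> walk_sum p n k g"
proof (induction k arbitrary: f g)
  case (Suc k)
  show ?case unfolding walk_sum.simps
    by (intro sum_mono Suc.IH Suc.prems walks_Cons) simp_all
qed (simp add: walks_def)

lemma norm_walk_sum_le:
  fixes f :: "(nat \<times> nat) list \<Rightarrow> 'b::real_normed_vector"
  shows "norm (walk_sum p n k f) \<le> walk_sum p n k (\<lambda>w. norm (f w))"
proof (induction k arbitrary: f)
  case (Suc k)
  show ?case
    by (auto intro!: order_trans[OF norm_sum] sum_mono Suc)
qed simp

lemma walk_sum_distrib_left: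
  fixes f :: "(nat \<times> nat) list \<Rightarrow> 'b::semiring_0"
  shows "c * walk_sum p n k f = walk_sum p n k (\<lambda>w. c * f w)"
  by (induction k arbitrary: f) (simp_all add: sum_distrib_left)

lemma walk_sum_distrib_right:
  fixes f :: "(nat \<times> nat) list \<Rightarrow> 'b::semiring_0"
  shows "walk_sum p n k f * c = walk_sum p n k (\<lambda>w. f w * c)"
  by (induction k arbitrary: f) (simp_all add: sum_distrib_right)

lemma walk_sum_sum: "(\<Sum>x\<in>A. walk_sum p n k (f x)) = walk_sum p n k (\<lambda>w. \<Sum>x\<in>A. f x w)"
proof (induction k arbitrary: f)
  case (Suc k)
  have "(\<Sum>x\<in>A. walk_sum p n (Suc k) (f x)) = (\<Sum>x\<in>A. \<Sum>j<n. \<Sum>a<p. walk_sum p n k (\<lambda>w. f x ((j, a) # w)))"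
    by simp
  also have "\<dots> = (\<Sum>j<n. \<Sum>x\<in>A. \<Sum>a<p. walk_sum p n k (\<lambda>w. f x ((j, a) # w)))" by (rule sum.swap)
  also have "\<dots> = (\<Sum>j<n. \<Sum>a<p. \<Sum>x\<in>A. walk_sum p n k (\<lambda>w. f x ((j, a) # w)))"
    by (intro sum.cong refl sum.swap)
  finally show ?case by (simp add: Suc)
qed simp

lemma cnj_walk_sum: "cnj (walk_sum p n k f) = walk_sum p n k (\<lambda>w. cnj (f w))"
  by (induction k arbitrary: f) simp_all

lemma walk_end_less: "i < p \<Longrightarrow> w \<in> walks p n k \<Longrightarrow> walk_end i w < p"
  by (induction i w arbitrary: k rule: walk_end.induct) (auto simp: walks_def)

lemma walk_edges_finite [simp]: "finite (walk_edges i w)"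
  by (induction i w rule: walk_edges.induct) auto

lemma card_walk_edges: "card (walk_edges i w) \<le> 2 * length w"
proof (induction i w rule: walk_edges.induct)
  case (2 i j a w)
  have "card (walk_edges i ((j, a) # w)) \<le> Suc (Suc (card (walk_edges a w)))"
    by (simp add: card_insert_le_m1 card_insert_if)
  then show ?case using 2 by simp
qed simp

lemma walk_edges_positions:
  assumes "i < p" "w \<in> walks p n k"
  shows "walk_edges i w \<subseteq> positions p n"
proof -
  have "walk_edges i w \<subseteq> positions p n" if "i < p" "set w \<subseteq> {..<n} \<times> {..<p}" for i
    using that
  proof (induction w arbitrary: i)
    case (Cons x w)
    obtain j a where x: "x = (j, a)" by (cases x)
    have "a < p" "j < n" "set w \<subseteq> {..<n} \<times> {..<p}" using Cons.prems(2) x by auto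
    then show ?case using Cons.IH[of a] Cons.prems(1) unfolding x positions_def by simp
  qed simp
  then show ?thesis using assms by (simp add: walks_def)
qed

text \<open>The action of \<open>Z Z\<^sup>*\<close> on a vector.\<close>

definition gram :: "nat \<Rightarrow> nat \<Rightarrow> (nat \<times> nat \<Rightarrow> complex) \<Rightarrow> (nat \<Rightarrow> complex) \<Rightarrow> nat \<Rightarrow> complex" where
  "gram p n Z x i = (\<Sum>j<n. \<Sum>a<p. Z (i, j) * cnj (Z (a, j)) * x a)"

definition gram_power_entry :: "nat \<Rightarrow> nat \<Rightarrow> (nat \<times> nat \<Rightarrow> complex) \<Rightarrow> nat \<Rightarrow> nat \<Rightarrow> nat \<Rightarrow> complex" where
  "gram_power_entry p n Z k i b = walk_sum p n k (\<lambda>w. walk_prod Z i w * of_bool (walk_end i w = b))"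

text \<open>The squared Frobenius norm of \<open>(Z Z\<^sup>*)^k\<close>, that is the trace of \<open>(Z Z\<^sup>*)^(2k)\<close>.\<close>

definition gram_power_frobenius :: "nat \<Rightarrow> nat \<Rightarrow> (nat \<times> nat \<Rightarrow> complex) \<Rightarrow> nat \<Rightarrow> real" where
  "gram_power_frobenius p n Z k = (\<Sum>i<p. \<Sum>b<p. (cmod (gram_power_entry p n Z k i b))\<^sup>2)"

lemma gram_power_apply:
  "i < p \<Longrightarrow> (gram p n Z ^^ k) x i = (\<Sum>b<p. gram_power_entry p n Z k i b * x b)"
proof (induction k arbitrary: i)
  case 0
  then show ?case by (simp add: gram_power_entry_def of_bool_def if_distrib if_distribR cong: if_cong)
next
  case (Suc k)
  have "(gram p n Z ^^ Suc k) x i = (\<Sum>j<n. \<Sum>a<p. Z (i, j) * cnj (Z (a, j)) * (gram p n Z ^^ k) x a)"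
    by (simp add: gram_def)
  also have "\<dots> = (\<Sum>j<n. \<Sum>a<p. Z (i, j) * cnj (Z (a, j)) * (\<Sum>b<p. gram_power_entry p n Z k a b * x b))"
    by (intro sum.cong refl) (simp add: Suc)
  also have "\<dots> = (\<Sum>j<n. \<Sum>a<p. \<Sum>b<p. Z (i, j) * cnj (Z (a, j)) * gram_power_entry p n Z k a b * x b)"
    by (simp add: sum_distrib_left mult.assoc)
  also have "\<dots> = (\<Sum>j<n. \<Sum>b<p. \<Sum>a<p. Z (i, j) * cnj (Z (a, j)) * gram_power_entry p n Z k a b * x b)"
    by (intro sum.cong refl sum.swap)
  also have "\<dots> = (\<Sum>b<p. \<Sum>j<n. \<Sum>a<p. Z (i, j) * cnj (Z (a, j)) * gram_power_entry p n Z k a b * x b)"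
    by (rule sum.swap)
  also have "\<dots> = (\<Sum>b<p. gram_power_entry p n Z (Suc k) i b * x b)"
    by (simp add: gram_power_entry_def sum_distrib_right walk_sum_distrib_left mult.assoc)
  finally show ?case .
qed

lemma l2norm_gram_power: "l2norm p ((gram p n Z ^^ k) x) \<le> sqrt (gram_power_frobenius p n Z k) * l2norm p x"
proof (rule power2_le_imp_le)
  have "(l2norm p ((gram p n Z ^^ k) x))\<^sup>2 = (\<Sum>i<p. (cmod (\<Sum>b<p. gram_power_entry p n Z k i b * x b))\<^sup>2)"
    unfolding l2norm_sq by (intro sum.cong refl) (simp add: gram_power_apply)
  also have "\<dots> \<le> (\<Sum>i<p. (\<Sum>b<p. (cmod (gram_power_entry p n Z k i b))\<^sup>2) * (l2norm p x)\<^sup>2)"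
  proof (intro sum_mono)
    fix i
    have "cmod (\<Sum>b<p. gram_power_entry p n Z k i b * x b)
        \<le> l2norm p (\<lambda>b. cnj (gram_power_entry p n Z k i b)) * l2norm p x"
      using l2norm_cauchy_schwarz[where n = p and x = "\<lambda>b. cnj (gram_power_entry p n Z k i b)" and y = x] by simp
    then have "(cmod (\<Sum>b<p. gram_power_entry p n Z k i b * x b))\<^sup>2
        \<le> (l2norm p (\<lambda>b. cnj (gram_power_entry p n Z k i b)) * l2norm p x)\<^sup>2"
      by (intro power_mono) auto
    then show "(cmod (\<Sum>b<p. gram_power_entry p n Z k i b * x b))\<^sup>2
        \<le> (\<Sum>b<p. (cmod (gram_power_entry p n Z k i b))\<^sup>2) * (l2norm p x)\<^sup>2"
      by (simp add: power_mult_distrib l2norm_sq)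
  qed
  also have "\<dots> = (sqrt (gram_power_frobenius p n Z k) * l2norm p x)\<^sup>2"
    by (simp add: gram_power_frobenius_def sum_distrib_right power_mult_distrib sum_nonneg)
  finally show "(l2norm p ((gram p n Z ^^ k) x))\<^sup>2 \<le> (sqrt (gram_power_frobenius p n Z k) * l2norm p x)\<^sup>2" .
qed (simp add: gram_power_frobenius_def sum_nonneg)

lemma gram_self_adjoint:
  "(\<Sum>i<p. cnj (gram p n Z x i) * y i) = (\<Sum>i<p. cnj (x i) * gram p n Z y i)"
proof -
  have "(\<Sum>i<p. cnj (gram p n Z x i) * y i) = (\<Sum>j<n. \<Sum>i<p. \<Sum>a<p. cnj (Z (i, j)) * Z (a, j) * cnj (x a) * y i)"
    by (subst sum.swap) (simp add: gram_def sum_distrib_right)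
  also have "\<dots> = (\<Sum>j<n. \<Sum>a<p. \<Sum>i<p. cnj (Z (i, j)) * Z (a, j) * cnj (x a) * y i)"
    by (intro sum.cong refl sum.swap)
  also have "\<dots> = (\<Sum>i<p. cnj (x i) * gram p n Z y i)"
    by (subst (2) sum.swap) (simp add: gram_def sum_distrib_left mult_ac)
  finally show ?thesis .
qed

lemma gram_power_self_adjoint:
  "(\<Sum>i<p. cnj ((gram p n Z ^^ k) x i) * y i) = (\<Sum>i<p. cnj (x i) * (gram p n Z ^^ k) y i)"
proof (induction k arbitrary: y)
  case (Suc k)
  have "(\<Sum>i<p. cnj ((gram p n Z ^^ Suc k) x i) * y i) = (\<Sum>i<p. cnj ((gram p n Z ^^ k) x i) * gram p n Z y i)"
    by (simp add: gram_self_adjoint)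
  also have "\<dots> = (\<Sum>i<p. cnj (x i) * (gram p n Z ^^ k) (gram p n Z y) i)" by (rule Suc)
  finally show ?case by (simp only: funpow_Suc_right o_def)
qed simp

text \<open>\<open>|H^k x|^2 = <x, H^(2k) x>\<close> because \<open>H = Z Z\<^sup>*\<close> is self-adjoint.\<close>

lemma l2norm_gram_power_double:
  "(l2norm p ((gram p n Z ^^ k) x))\<^sup>2 \<le> l2norm p ((gram p n Z ^^ (k + k)) x) * l2norm p x"
proof -
  define y where "y = (gram p n Z ^^ k) x"
  have "complex_of_real ((l2norm p y)\<^sup>2) = (\<Sum>i<p. cnj (y i) * y i)" by (rule sum_cnj_self[symmetric])
  also have "\<dots> = (\<Sum>i<p. cnj (x i) * (gram p n Z ^^ k) y i)" by (simp only: gram_power_self_adjoint y_def)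
  also have "(gram p n Z ^^ k) y = (gram p n Z ^^ (k + k)) x" by (simp add: y_def funpow_add)
  finally have "(l2norm p y)\<^sup>2 = cmod (\<Sum>i<p. cnj (x i) * (gram p n Z ^^ (k + k)) x i)"
    by (metis abs_power2 norm_of_real)
  also have "\<dots> \<le> l2norm p x * l2norm p ((gram p n Z ^^ (k + k)) x)" by (rule l2norm_cauchy_schwarz)
  finally show ?thesis by (simp add: y_def mult.commute)
qed

text \<open>Iterated doubling: \<open>|H x|^K |x| \<le> |H^K x| |x|^K\<close> for \<open>K = 2^j\<close>. It bounds the norm of \<open>H\<close> by the
  Frobenius norm of a power of \<open>H\<close> without reference to eigenvalues.\<close>

lemma l2norm_gram_power_dyadic:
  "(l2norm p (gram p n Z x)) ^ (2 ^ j) * l2norm p x \<le> l2norm p ((gram p n Z ^^ (2 ^ j)) x) * (l2norm p x) ^ (2 ^ j)"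
proof (induction j)
  case (Suc j)
  define f where "f k = l2norm p ((gram p n Z ^^ k) x)" for k
  define K :: nat where "K = 2 ^ j"
  have f0: "0 \<le> f k" for k by (simp add: f_def)
  have IH: "f 1 ^ K * f 0 \<le> f K * f 0 ^ K" using Suc by (simp add: f_def K_def)
  have "(f 1 ^ K * f 0)\<^sup>2 \<le> (f K * f 0 ^ K)\<^sup>2" by (rule power_mono[OF IH]) (simp add: f0)
  also have "\<dots> = (f K)\<^sup>2 * f 0 ^ (2 * K)" by (simp add: power_mult_distrib power_mult[symmetric] mult.commute)
  also have "\<dots> \<le> (f (K + K) * f 0) * f 0 ^ (2 * K)"
    using l2norm_gram_power_double[where p = p and n = n and Z = Z and k = K and x = x] by (intro mult_right_mono) (auto simp: f_def)
  finally have "f 1 ^ (2 * K) * f 0 * f 0 \<le> f (2 * K) * f 0 ^ (2 * K) * f 0"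
    unfolding mult_2 by (simp add: power_mult_distrib power2_eq_square mult_ac power_add)
  then have "f 1 ^ (2 * K) * f 0 \<le> f (2 * K) * f 0 ^ (2 * K)"
    using f0[of 0] by (cases "f 0 = 0") (auto simp: f0 intro!: mult_nonneg_nonneg)
  then show ?case by (simp add: f_def K_def)
qed (simp add: mult.commute)

text \<open>\<open>|Z\<^sup>* x|^2 = <x, H x>\<close> is at most \<open>|x| |H x|\<close>, and the norm of \<open>H\<close> is at most the \<open>2 \<cdot> 2^j\<close>-th root of the
  squared Frobenius norm of its \<open>2^j\<close>-th power.\<close>

lemma op_bound_gram_power_frobenius:
  assumes F: "gram_power_frobenius p n Z (2 ^ j) \<le> t ^ (4 * 2 ^ j)" and t: "0 \<le> t"
  shows "op_bound p n (\<lambda>i j. Z (i, j)) t"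
proof -
  define K :: nat where "K = 2 ^ j"
  have K: "0 < K" by (simp add: K_def)
  have "op_bound n p (\<lambda>j i. cnj (Z (i, j))) t"
    unfolding op_bound_def
  proof (intro conjI allI t)
    fix x
    define y where "y j = (\<Sum>a<p. cnj (Z (a, j)) * x a)" for j
    have g: "l2norm p (gram p n Z x) \<le> t\<^sup>2 * l2norm p x"
    proof (cases "l2norm p x = 0")
      case True
      then have "x a = 0" if "a < p" for a using l2norm_pos[of a p x] that by force
      then have "gram p n Z x i = 0" for i by (simp add: gram_def)
      then show ?thesis by (simp add: l2norm_def L2_set_def sum_nonneg)
    next
      case False
      then have pos: "0 < l2norm p x" by (simp add: less_le)
      have "sqrt (gram_power_frobenius p n Z K) \<le> t ^ (2 * K)"
        by (rule real_le_lsqrt)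
           (use F t in \<open>auto simp: gram_power_frobenius_def sum_nonneg K_def power_mult[symmetric]\<close>)
      then have "sqrt (gram_power_frobenius p n Z K) * l2norm p x \<le> (t\<^sup>2) ^ K * l2norm p x"
        unfolding power_mult by (rule mult_right_mono) simp
      then have "l2norm p ((gram p n Z ^^ K) x) \<le> (t\<^sup>2) ^ K * l2norm p x"
        using l2norm_gram_power[where p = p and n = n and Z = Z and k = K and x = x] by linarith
      then have "l2norm p ((gram p n Z ^^ K) x) * (l2norm p x) ^ K \<le> (t\<^sup>2) ^ K * l2norm p x * (l2norm p x) ^ K"
        by (rule mult_right_mono) simp
      then have "(l2norm p (gram p n Z x)) ^ K * l2norm p x \<le> (t\<^sup>2) ^ K * l2norm p x * (l2norm p x) ^ K"
        using l2norm_gram_power_dyadic[where p = p and n = n and Z = Z and j = j and x = x, folded K_def] by linarith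
      then have "(l2norm p (gram p n Z x)) ^ K \<le> (t\<^sup>2 * l2norm p x) ^ K"
        using pos by (simp add: power_mult_distrib mult_ac)
      then show ?thesis
        using power_mono_iff[of "l2norm p (gram p n Z x)" "t\<^sup>2 * l2norm p x" K] K by simp
    qed
    have "complex_of_real ((l2norm n y)\<^sup>2) = (\<Sum>j<n. cnj (y j) * y j)" by (rule sum_cnj_self[symmetric])
    also have "\<dots> = (\<Sum>j<n. \<Sum>i<p. cnj (x i) * (\<Sum>a<p. Z (i, j) * cnj (Z (a, j)) * x a))"
      by (intro sum.cong refl) (simp add: y_def sum_distrib_right sum_distrib_left mult_ac)
    also have "\<dots> = (\<Sum>i<p. cnj (x i) * gram p n Z x i)"
      by (subst sum.swap) (simp add: gram_def sum_distrib_left)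
    finally have "(l2norm n y)\<^sup>2 = cmod (\<Sum>i<p. cnj (x i) * gram p n Z x i)"
      by (metis abs_power2 norm_of_real)
    also have "\<dots> \<le> l2norm p x * l2norm p (gram p n Z x)" by (rule l2norm_cauchy_schwarz)
    also have "\<dots> \<le> l2norm p x * (t\<^sup>2 * l2norm p x)" by (intro mult_left_mono g) simp
    also have "\<dots> = (t * l2norm p x)\<^sup>2" by (simp add: power2_eq_square)
    finally show "l2norm n y \<le> t * l2norm p x" by (rule power2_le_imp_le) (use t in simp)
  qed
  from op_bound_adjoint[OF this] show ?thesis by simp
qed

section \<open>Counting walks by their distinct edges\<close>

text \<open>One step of the exploration of a walk: a target that gives a new edge costs a factor \<open>q\<close> and there are
  at most \<open>N\<close> of them; a target along a known edge is free, but there are at most \<open>card G\<close> of them.\<close>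

lemma sum_power_new_element:
  fixes q :: real
  assumes "finite G" "0 \<le> q"
  shows "(\<Sum>a<N. q ^ of_bool (a \<notin> G)) \<le> real N * q + real (card G)"
proof -
  have "(\<Sum>a<N. q ^ of_bool (a \<notin> G)) \<le> (\<Sum>a<N. q + of_bool (a \<in> G))"
    by (intro sum_mono) (use assms in \<open>auto simp: of_bool_def\<close>)
  also have "\<dots> = real N * q + real (card {a. a < N \<and> a \<in> G})"
    by (simp add: sum.distrib of_bool_def sum.If_cases lessThan_def Int_def conj_commute)
  also have "\<dots> \<le> real N * q + real (card G)"
    using assms by (auto intro!: card_mono)
  finally show ?thesis .
qed

lemma sum_power_new_edge:
  fixes q :: real and F :: "(nat \<times> nat) set"
  assumes "finite F" "0 \<le> q" "inj e"
  shows "(\<Sum>a<N. q ^ of_bool (e a \<notin> F)) \<le> real N * q + real (card F)"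
proof -
  have fin: "finite (e -` F)" using assms by (simp add: finite_vimageI)
  have "card (e -` F) = card (e ` (e -` F))" by (rule card_image[symmetric], rule inj_on_subset[OF assms(3)]) simp
  also have "\<dots> \<le> card F" using assms by (intro card_mono) auto
  finally have "card (e -` F) \<le> card F" .
  then show ?thesis using sum_power_new_element[OF fin assms(2), of N] by (simp add: vimage_def)
qed

lemma card_insert_Diff:
  assumes "finite A"
  shows "card (insert x A - G) = of_bool (x \<notin> G) + card (A - insert x G)"
proof (cases "x \<in> G")
  case False
  then have "insert x A - G = insert x (A - insert x G)" by blast
  then show ?thesis using assms False by simp
qed (simp add: insert_absorb)

text \<open>The walk is revealed one edge at a time. At every half step the weighted number of choices is at most
  \<open>N q\<close> for a new edge plus the number of edges seen so far, which never exceeds \<open>f + 2 k\<close>. The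
  bound holds for all walks, and the closed ones are among them; this crude count replaces the usual enumeration of graphs.\<close>

lemma walk_sum_power_card:
  fixes q :: real
  assumes q: "0 \<le> q" and N: "p \<le> N" "n \<le> N" and F: "finite F" "card F \<le> f"
  shows "walk_sum p n k (\<lambda>w. q ^ card (walk_edges i w - F)) \<le> (real N * q + real (f + 2 * k)) ^ (2 * k)"
  using F
proof (induction k arbitrary: i F f)
  case (Suc k)
  define C where "C = real N * q + real (f + 2 * Suc k)"
  have C0: "0 \<le> C" using q by (simp add: C_def)
  note card_split = card_insert_Diff[OF walk_edges_finite] card_insert_Diff[OF finite.insertI[OF walk_edges_finite]]
  have "walk_sum p n (Suc k) (\<lambda>w. q ^ card (walk_edges i w - F))
    = (\<Sum>j<n. \<Sum>a<p. q ^ of_bool ((i, j) \<notin> F) * (q ^ of_bool ((a, j) \<notin> insert (i, j) F) *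
         walk_sum p n k (\<lambda>w. q ^ card (walk_edges a w - insert (a, j) (insert (i, j) F)))))"
    by (simp add: card_split power_add walk_sum_distrib_left)
  also have "\<dots> \<le> (\<Sum>j<n. \<Sum>a<p. q ^ of_bool ((i, j) \<notin> F) * (q ^ of_bool ((a, j) \<notin> insert (i, j) F) * C ^ (2 * k)))"
  proof (intro sum_mono mult_left_mono)
    fix j a
    have "card (insert (a, j) (insert (i, j) F)) \<le> f + 2" using Suc.prems by (simp add: card_insert_if)
    from Suc.IH[OF _ this] show "walk_sum p n k (\<lambda>w. q ^ card (walk_edges a w - insert (a, j) (insert (i, j) F))) \<le> C ^ (2 * k)"
      using Suc.prems by (simp add: C_def algebra_simps)
  qed (use q in auto)
  also have "\<dots> = (\<Sum>j<n. q ^ of_bool ((i, j) \<notin> F) * (\<Sum>a<p. q ^ of_bool ((a, j) \<notin> insert (i, j) F)) * C ^ (2 * k))"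
    by (simp add: sum_distrib_left sum_distrib_right mult.assoc)
  also have "\<dots> \<le> (\<Sum>j<n. q ^ of_bool ((i, j) \<notin> F) * C * C ^ (2 * k))"
  proof (intro sum_mono mult_right_mono mult_left_mono)
    fix j
    have "(\<Sum>a<p. q ^ of_bool ((a, j) \<notin> insert (i, j) F)) \<le> real p * q + real (card (insert (i, j) F))"
      by (rule sum_power_new_edge) (use Suc.prems q in \<open>auto simp: inj_def\<close>)
    also have "\<dots> \<le> C"
      unfolding C_def using Suc.prems q N by (intro add_mono mult_right_mono) (auto simp: card_insert_if)
    finally show "(\<Sum>a<p. q ^ of_bool ((a, j) \<notin> insert (i, j) F)) \<le> C" .
  qed (use q C0 in auto)
  also have "\<dots> = (\<Sum>j<n. q ^ of_bool ((i, j) \<notin> F)) * C * C ^ (2 * k)" by (simp add: sum_distrib_right)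
  also have "\<dots> \<le> C * C * C ^ (2 * k)"
  proof (intro mult_right_mono)
    have "(\<Sum>j<n. q ^ of_bool ((i, j) \<notin> F)) \<le> real n * q + real (card F)"
      by (rule sum_power_new_edge) (use Suc.prems q in \<open>auto simp: inj_def\<close>)
    also have "\<dots> \<le> C"
      unfolding C_def using Suc.prems q N by (intro add_mono mult_right_mono) auto
    finally show "(\<Sum>j<n. q ^ of_bool ((i, j) \<notin> F)) \<le> C" .
  qed (use C0 in auto)
  also have "\<dots> = C ^ (2 * Suc k)" by (simp add: power_add power2_eq_square)
  finally show ?case unfolding C_def .
qed simp

text \<open>The second walk is explored when the edges of the first one are already known.\<close>

lemma walk_pair_sum_power_card:
  fixes q :: real
  assumes q: "0 \<le> q" and N: "p \<le> N" "n \<le> N"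
  shows "walk_sum p n k (\<lambda>w. walk_sum p n k (\<lambda>w'. q ^ card (walk_edges i w \<union> walk_edges i w')))
      \<le> (real N * q + real (4 * k)) ^ (4 * k)"
proof -
  define C where "C = real N * q + real (4 * k)"
  have C0: "0 \<le> C" using q by (simp add: C_def)
  have "walk_sum p n k (\<lambda>w. walk_sum p n k (\<lambda>w'. q ^ card (walk_edges i w \<union> walk_edges i w')))
     \<le> walk_sum p n k (\<lambda>w. C ^ (2 * k) * q ^ card (walk_edges i w - {}))"
  proof (rule walk_sum_mono)
    fix w assume w: "w \<in> walks p n k"
    have c: "card (walk_edges i w \<union> walk_edges i w') = card (walk_edges i w) + card (walk_edges i w' - walk_edges i w)" for w'
      by (subst card_Un_disjoint[symmetric]) auto
    have "card (walk_edges i w) \<le> 2 * k" using card_walk_edges[of i w] w by (simp add: walks_def)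
    from walk_sum_power_card[OF q N walk_edges_finite this, of k i]
    have "walk_sum p n k (\<lambda>w'. q ^ card (walk_edges i w' - walk_edges i w)) \<le> C ^ (2 * k)"
      by (simp add: C_def)
    then show "walk_sum p n k (\<lambda>w'. q ^ card (walk_edges i w \<union> walk_edges i w')) \<le> C ^ (2 * k) * q ^ card (walk_edges i w - {})"
      unfolding c power_add walk_sum_distrib_left[symmetric] Diff_empty mult.commute[of "C ^ (2 * k)"]
      by (intro mult_left_mono) (use q in auto)
  qed
  also have "\<dots> = C ^ (2 * k) * walk_sum p n k (\<lambda>w. q ^ card (walk_edges i w - {}))"
    by (simp only: walk_sum_distrib_left)
  also have "\<dots> \<le> C ^ (2 * k) * (real N * q + real (0 + 2 * k)) ^ (2 * k)"
    using C0 by (intro mult_left_mono walk_sum_power_card q N) auto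
  also have "\<dots> \<le> C ^ (2 * k) * C ^ (2 * k)"
    using C0 q by (intro mult_left_mono power_mono) (auto simp: C_def)
  also have "\<dots> = C ^ (4 * k)" by (simp flip: power_add)
  finally show ?thesis unfolding C_def .
qed

section \<open>Norm of a random matrix with small moments\<close>

text \<open>How often the walk traverses an edge from its row to its column, where the weight carries no conjugate;
  \<open>walk_count_back\<close> counts the traversals in the other direction, which carry the conjugate.\<close>

fun walk_count :: "nat \<Rightarrow> (nat \<times> nat) list \<Rightarrow> nat \<times> nat \<Rightarrow> nat" where
  "walk_count i [] e = 0"
| "walk_count i ((j, a) # w) e = of_bool (e = (i, j)) + walk_count a w e"

fun walk_count_back :: "nat \<Rightarrow> (nat \<times> nat) list \<Rightarrow> nat \<times> nat \<Rightarrow> nat" where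
  "walk_count_back i [] e = 0"
| "walk_count_back i ((j, a) # w) e = of_bool (e = (a, j)) + walk_count_back a w e"

lemma walk_edges_count: "e \<in> walk_edges i w \<longleftrightarrow> walk_count i w e + walk_count_back i w e \<ge> 1"
  by (induction i w rule: walk_edges.induct) auto

lemma prod_power_of_bool:
  fixes f :: "'a \<Rightarrow> 'b::comm_monoid_mult"
  assumes "finite P" "x \<in> P"
  shows "(\<Prod>e\<in>P. f e ^ of_bool (e = x)) = f x"
proof -
  have "(\<Prod>e\<in>P. f e ^ of_bool (e = x)) = (\<Prod>e\<in>P. if e = x then f e else 1)"
    by (intro prod.cong refl) auto
  then show ?thesis using assms by simp
qed

lemma walk_prod_eq:
  assumes "finite P" "walk_edges i w \<subseteq> P"
  shows "walk_prod Z i w = (\<Prod>e\<in>P. Z e ^ walk_count i w e * cnj (Z e) ^ walk_count_back i w e)"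
  using assms(2)
proof (induction i w rule: walk_edges.induct)
  case (2 i j a w)
  have "(\<Prod>e\<in>P. Z e ^ walk_count i ((j, a) # w) e * cnj (Z e) ^ walk_count_back i ((j, a) # w) e)
     = (\<Prod>e\<in>P. Z e ^ of_bool (e = (i, j))) * (\<Prod>e\<in>P. cnj (Z e) ^ of_bool (e = (a, j)))
       * (\<Prod>e\<in>P. Z e ^ walk_count a w e * cnj (Z e) ^ walk_count_back a w e)"
    unfolding prod.distrib[symmetric] by (intro prod.cong refl) (simp add: power_add mult_ac)
  also have "(\<Prod>e\<in>P. Z e ^ of_bool (e = (i, j))) = Z (i, j)"
    using 2 by (intro prod_power_of_bool assms(1)) simp
  also have "(\<Prod>e\<in>P. cnj (Z e) ^ of_bool (e = (a, j))) = cnj (Z (a, j))"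
    using 2 by (intro prod_power_of_bool assms(1)) simp
  finally show ?case using 2 by simp
qed simp

lemma cnj_of_bool [simp]: "cnj (of_bool b) = of_bool b"
  by (cases b) simp_all

text \<open>The squared modulus of an entry is a sum over pairs of walks with the same ends.\<close>

lemma gram_power_frobenius_eq:
  "complex_of_real (gram_power_frobenius p n Z k) = (\<Sum>i<p. walk_sum p n k (\<lambda>w. walk_sum p n k (\<lambda>w'.
      of_bool (walk_end i w = walk_end i w') * (walk_prod Z i w * cnj (walk_prod Z i w')))))"
proof -
  have "complex_of_real (gram_power_frobenius p n Z k)
      = (\<Sum>i<p. \<Sum>b<p. gram_power_entry p n Z k i b * cnj (gram_power_entry p n Z k i b))"
    by (simp add: gram_power_frobenius_def complex_norm_square del: of_real_power)
  also have "\<dots> = (\<Sum>i<p. walk_sum p n k (\<lambda>w. walk_sum p n k (\<lambda>w'. \<Sum>b<p.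
      of_bool (walk_end i w = b) * of_bool (walk_end i w' = b) * (walk_prod Z i w * cnj (walk_prod Z i w')))))"
    unfolding gram_power_entry_def cnj_walk_sum walk_sum_distrib_right
    unfolding walk_sum_distrib_left walk_sum_sum by (simp add: mult_ac)
  also have "\<dots> = (\<Sum>i<p. walk_sum p n k (\<lambda>w. walk_sum p n k (\<lambda>w'.
      of_bool (walk_end i w = walk_end i w') * (walk_prod Z i w * cnj (walk_prod Z i w')))))"
  proof (intro sum.cong refl walk_sum_cong)
    fix i w w' assume *: "i \<in> {..<p}" "w \<in> walks p n k" "w' \<in> walks p n k"
    have e: "walk_end i w < p" using * by (intro walk_end_less) auto
    have "(\<Sum>b<p. of_bool (walk_end i w = b) * of_bool (walk_end i w' = b) * c)
        = (\<Sum>b<p. if b = walk_end i w then of_bool (walk_end i w = walk_end i w') * c else 0)" for c :: complex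
      by (intro sum.cong refl) auto
    then show "(\<Sum>b<p. of_bool (walk_end i w = b) * of_bool (walk_end i w' = b) * (walk_prod Z i w * cnj (walk_prod Z i w')))
        = of_bool (walk_end i w = walk_end i w') * (walk_prod Z i w * cnj (walk_prod Z i w'))"
      using e by simp
  qed
  finally show ?thesis .
qed

lemma measurable_cnj [measurable]: "cnj \<in> borel_measurable borel"
  by (intro borel_measurable_continuous_onI continuous_intros)

lemma integral_walk_sum:
  fixes f :: "(nat \<times> nat) list \<Rightarrow> 'a \<Rightarrow> complex"
  assumes "\<And>w. w \<in> walks p n k \<Longrightarrow> integrable M (f w)"
  shows "integrable M (\<lambda>\<omega>. walk_sum p n k (\<lambda>w. f w \<omega>))
    \<and> (\<integral>\<omega>. walk_sum p n k (\<lambda>w. f w \<omega>) \<partial>M) = walk_sum p n k (\<lambda>w. \<integral>\<omega>. f w \<omega> \<partial>M)"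
  using assms
proof (induction k arbitrary: f)
  case (Suc k)
  have *: "integrable M (\<lambda>\<omega>. walk_sum p n k (\<lambda>w. f ((j, a) # w) \<omega>))
    \<and> (\<integral>\<omega>. walk_sum p n k (\<lambda>w. f ((j, a) # w) \<omega>) \<partial>M) = walk_sum p n k (\<lambda>w. \<integral>\<omega>. f ((j, a) # w) \<omega> \<partial>M)"
    if "j < n" "a < p" for j a
    by (rule Suc.IH) (intro Suc.prems walks_Cons that)
  have int: "integrable M (\<lambda>\<omega>. \<Sum>a<p. walk_sum p n k (\<lambda>w. f ((j, a) # w) \<omega>))" if "j < n" for j
    using * that by (intro Bochner_Integration.integrable_sum) simp
  have "(\<integral>\<omega>. (\<Sum>j<n. \<Sum>a<p. walk_sum p n k (\<lambda>w. f ((j, a) # w) \<omega>)) \<partial>M)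
      = (\<Sum>j<n. \<integral>\<omega>. (\<Sum>a<p. walk_sum p n k (\<lambda>w. f ((j, a) # w) \<omega>)) \<partial>M)"
    using int by (intro Bochner_Integration.integral_sum) simp
  also have "\<dots> = (\<Sum>j<n. \<Sum>a<p. \<integral>\<omega>. walk_sum p n k (\<lambda>w. f ((j, a) # w) \<omega>) \<partial>M)"
    using * by (intro sum.cong refl Bochner_Integration.integral_sum) simp
  also have "\<dots> = (\<Sum>j<n. \<Sum>a<p. walk_sum p n k (\<lambda>w. \<integral>\<omega>. f ((j, a) # w) \<omega> \<partial>M))"
    using * by (intro sum.cong refl) simp
  finally show ?case using * by (auto intro!: Bochner_Integration.integrable_sum)
qed (simp add: walks_def)

text \<open>By independence the expectation of a pair of walks factors over the edges. Each distinct edge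
  contributes a mixed moment of positive order, hence a factor of modulus at most \<open>q\<close>. The moment hypothesis covers at
  once entries with small first absolute moment and centered entries with small second moment.\<close>

lemma (in prob_space) expectation_gram_power_frobenius_le:
  fixes Z :: "nat \<times> nat \<Rightarrow> 'a \<Rightarrow> complex"
  assumes indep: "indep_vars (\<lambda>_. borel) Z (positions p n)"
    and bnd: "\<And>e \<omega>. e \<in> positions p n \<Longrightarrow> \<omega> \<in> space M \<Longrightarrow> cmod (Z e \<omega>) \<le> 1"
    and q: "0 \<le> q" and N: "p \<le> N" "n \<le> N"
    and mom: "\<And>e a b. e \<in> positions p n \<Longrightarrow> a + b \<ge> 1 \<Longrightarrow> cmod (expectation (\<lambda>\<omega>. Z e \<omega> ^ a * cnj (Z e \<omega>) ^ b)) \<le> q"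
  shows "integrable M (\<lambda>\<omega>. gram_power_frobenius p n (\<lambda>e. Z e \<omega>) k)" (is ?I)
    and "expectation (\<lambda>\<omega>. gram_power_frobenius p n (\<lambda>e. Z e \<omega>) k) \<le> real p * (real N * q + real (4 * k)) ^ (4 * k)" (is ?E)
proof -
  define P where "P = positions p n"
  have finP: "finite P" by (simp add: P_def positions_def)
  have rv: "random_variable borel (Z e)" if "e \<in> P" for e
    using indep that by (auto simp: indep_vars_def P_def)
  define T where "T i w w' \<omega> = of_bool (walk_end i w = walk_end i w') *
     (walk_prod (\<lambda>e. Z e \<omega>) i w * cnj (walk_prod (\<lambda>e. Z e \<omega>) i w'))" for i w w' \<omega>
  have T: "integrable M (T i w w')"
     "cmod (expectation (T i w w')) \<le> q ^ card (walk_edges i w \<union> walk_edges i w')"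
    if i: "i < p" and w: "w \<in> walks p n k" "w' \<in> walks p n k" for i w w'
  proof -
    define \<alpha> where "\<alpha> e = walk_count i w e + walk_count_back i w' e" for e
    define \<beta> where "\<beta> e = walk_count_back i w e + walk_count i w' e" for e
    define X where "X e \<omega> = Z e \<omega> ^ \<alpha> e * cnj (Z e \<omega>) ^ \<beta> e" for e \<omega>
    have Xe: "X e = (\<lambda>\<omega>. Z e \<omega> ^ \<alpha> e * cnj (Z e \<omega>) ^ \<beta> e)" for e by (rule ext) (simp add: X_def)
    have U: "walk_edges i w \<union> walk_edges i w' \<subseteq> P"
      using walk_edges_positions[OF i w(1)] walk_edges_positions[OF i w(2)] by (simp add: P_def)
    have TX: "T i w w' = (\<lambda>\<omega>. of_bool (walk_end i w = walk_end i w') * (\<Prod>e\<in>P. X e \<omega>))"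
    proof
      fix \<omega>
      have "walk_prod (\<lambda>e. Z e \<omega>) i w * cnj (walk_prod (\<lambda>e. Z e \<omega>) i w') = (\<Prod>e\<in>P. X e \<omega>)"
      proof -
        have "walk_edges i w \<subseteq> P" "walk_edges i w' \<subseteq> P" using U by auto
        note e = walk_prod_eq[OF finP this(1)] walk_prod_eq[OF finP this(2)]
        show ?thesis unfolding e cnj_prod prod.distrib[symmetric]
          by (intro prod.cong refl) (simp add: X_def \<alpha>_def \<beta>_def power_add mult_ac)
      qed
      then show "T i w w' \<omega> = of_bool (walk_end i w = walk_end i w') * (\<Prod>e\<in>P. X e \<omega>)" by (simp add: T_def)
    qed
    have indX: "indep_vars (\<lambda>_. borel) X P"
      unfolding X_def by (rule indep_vars_compose2[OF indep[folded P_def]]) measurable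
    have intX: "integrable M (X e)" if e: "e \<in> P" for e
    proof (rule integrable_const_bound[of _ 1])
      show "AE \<omega> in M. norm (X e \<omega>) \<le> 1"
      proof (rule AE_I2)
        fix \<omega> assume "\<omega> \<in> space M"
        then have "cmod (Z e \<omega>) \<le> 1" using bnd e by (simp add: P_def)
        then show "norm (X e \<omega>) \<le> 1"
          by (simp add: X_def norm_mult norm_power mult_le_one power_le_one)
      qed
      show "X e \<in> borel_measurable M" unfolding X_def using rv[OF e] by measurable
    qed
    have intP: "integrable M (\<lambda>\<omega>. \<Prod>e\<in>P. X e \<omega>)" by (rule indep_vars_integrable[OF finP indX intX])
    then show "integrable M (T i w w')" unfolding TX by simp
    have "cmod (expectation (T i w w')) \<le> cmod (expectation (\<lambda>\<omega>. \<Prod>e\<in>P. X e \<omega>))"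
      unfolding TX by (simp add: of_bool_def)
    also have "\<dots> = (\<Prod>e\<in>P. cmod (expectation (X e)))"
      by (simp add: indep_vars_lebesgue_integral[OF finP indX intX] prod_norm)
    also have "\<dots> \<le> (\<Prod>e\<in>P. if e \<in> walk_edges i w \<union> walk_edges i w' then q else 1)"
    proof (intro prod_mono conjI norm_ge_zero)
      fix e assume e: "e \<in> P"
      show "cmod (expectation (X e)) \<le> (if e \<in> walk_edges i w \<union> walk_edges i w' then q else 1)"
      proof (cases "e \<in> walk_edges i w \<union> walk_edges i w'")
        case True
        then have "\<alpha> e + \<beta> e \<ge> 1" by (auto simp: walk_edges_count \<alpha>_def \<beta>_def)
        then show ?thesis using mom[of e "\<alpha> e" "\<beta> e"] e True by (simp add: Xe P_def)
      next
        case False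
        then have "\<alpha> e = 0" "\<beta> e = 0" by (auto simp: walk_edges_count \<alpha>_def \<beta>_def)
        then show ?thesis using False by (simp add: Xe prob_space)
      qed
    qed
    also have "\<dots> = q ^ card (walk_edges i w \<union> walk_edges i w')"
      using finP U by (simp add: prod.If_cases Int_absorb1 del: Un_iff)
    finally show "cmod (expectation (T i w w')) \<le> q ^ card (walk_edges i w \<union> walk_edges i w')" .
  qed
  define G where "G \<omega> = complex_of_real (gram_power_frobenius p n (\<lambda>e. Z e \<omega>) k)" for \<omega>
  have G: "G = (\<lambda>\<omega>. \<Sum>i<p. walk_sum p n k (\<lambda>w. walk_sum p n k (\<lambda>w'. T i w w' \<omega>)))"
    unfolding G_def T_def gram_power_frobenius_eq ..
  have inner: "integrable M (\<lambda>\<omega>. walk_sum p n k (\<lambda>w'. T i w w' \<omega>))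
      \<and> expectation (\<lambda>\<omega>. walk_sum p n k (\<lambda>w'. T i w w' \<omega>)) = walk_sum p n k (\<lambda>w'. expectation (T i w w'))"
    if "i < p" "w \<in> walks p n k" for i w
    by (rule integral_walk_sum) (intro T(1) that)
  have outer: "integrable M (\<lambda>\<omega>. walk_sum p n k (\<lambda>w. walk_sum p n k (\<lambda>w'. T i w w' \<omega>)))
      \<and> expectation (\<lambda>\<omega>. walk_sum p n k (\<lambda>w. walk_sum p n k (\<lambda>w'. T i w w' \<omega>)))
        = walk_sum p n k (\<lambda>w. expectation (\<lambda>\<omega>. walk_sum p n k (\<lambda>w'. T i w w' \<omega>)))"
    if "i < p" for i
    by (rule integral_walk_sum) (rule conjunct1[OF inner[OF that]])
  have intG: "integrable M G" unfolding G
    by (rule Bochner_Integration.integrable_sum) (rule conjunct1[OF outer], simp)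
  then have "integrable M (\<lambda>\<omega>. Re (G \<omega>))" by (rule integrable_Re)
  then show ?I by (simp add: G_def)
  have "complex_of_real (expectation (\<lambda>\<omega>. gram_power_frobenius p n (\<lambda>e. Z e \<omega>) k)) = expectation G"
    unfolding G_def[abs_def] by simp
  also have "\<dots> = (\<Sum>i<p. walk_sum p n k (\<lambda>w. walk_sum p n k (\<lambda>w'. expectation (T i w w'))))"
  proof -
    have "expectation G = (\<Sum>i<p. expectation (\<lambda>\<omega>. walk_sum p n k (\<lambda>w. walk_sum p n k (\<lambda>w'. T i w w' \<omega>))))"
      unfolding G using outer by (intro Bochner_Integration.integral_sum) simp
    also have "\<dots> = (\<Sum>i<p. walk_sum p n k (\<lambda>w. expectation (\<lambda>\<omega>. walk_sum p n k (\<lambda>w'. T i w w' \<omega>))))"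
      using outer by (intro sum.cong refl) simp
    also have "\<dots> = (\<Sum>i<p. walk_sum p n k (\<lambda>w. walk_sum p n k (\<lambda>w'. expectation (T i w w'))))"
      by (intro sum.cong refl walk_sum_cong conjunct2[OF inner]) auto
    finally show ?thesis .
  qed
  finally have E: "complex_of_real (expectation (\<lambda>\<omega>. gram_power_frobenius p n (\<lambda>e. Z e \<omega>) k))
      = (\<Sum>i<p. walk_sum p n k (\<lambda>w. walk_sum p n k (\<lambda>w'. expectation (T i w w'))))" .
  have "expectation (\<lambda>\<omega>. gram_power_frobenius p n (\<lambda>e. Z e \<omega>) k)
      \<le> cmod (\<Sum>i<p. walk_sum p n k (\<lambda>w. walk_sum p n k (\<lambda>w'. expectation (T i w w'))))"
    unfolding E[symmetric] by simp
  also have "\<dots> \<le> (\<Sum>i<p. walk_sum p n k (\<lambda>w. walk_sum p n k (\<lambda>w'. q ^ card (walk_edges i w \<union> walk_edges i w'))))"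
  proof (rule order_trans[OF norm_sum], rule sum_mono)
    fix i assume "i \<in> {..<p}"
    then have i: "i < p" by simp
    show "cmod (walk_sum p n k (\<lambda>w. walk_sum p n k (\<lambda>w'. expectation (T i w w'))))
        \<le> walk_sum p n k (\<lambda>w. walk_sum p n k (\<lambda>w'. q ^ card (walk_edges i w \<union> walk_edges i w')))"
      by (rule order_trans[OF norm_walk_sum_le], rule walk_sum_mono,
          rule order_trans[OF norm_walk_sum_le], rule walk_sum_mono) (rule T(2)[OF i])
  qed
  also have "\<dots> \<le> (\<Sum>i<p. (real N * q + real (4 * k)) ^ (4 * k))"
    by (intro sum_mono walk_pair_sum_power_card q N)
  finally show ?E by simp
qed

text \<open>If \<open>N q\<close> stays bounded and \<open>t\<close> is a small power of \<open>N\<close>, then a fixed large \<open>j\<close> makes this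
  probability small: up to sub-polynomial factors the norm is bounded. The measurable event \<open>B\<close> covers the
  set where the norm exceeds \<open>t\<close>.\<close>

theorem (in prob_space) random_matrix_norm_tail:
  fixes Z :: "nat \<times> nat \<Rightarrow> 'a \<Rightarrow> complex"
  assumes indep: "indep_vars (\<lambda>_. borel) Z (positions p n)"
    and bnd: "\<And>e \<omega>. e \<in> positions p n \<Longrightarrow> \<omega> \<in> space M \<Longrightarrow> cmod (Z e \<omega>) \<le> 1"
    and q: "0 \<le> q" and N: "p \<le> N" "n \<le> N"
    and mom: "\<And>e a b. e \<in> positions p n \<Longrightarrow> a + b \<ge> 1 \<Longrightarrow> cmod (expectation (\<lambda>\<omega>. Z e \<omega> ^ a * cnj (Z e \<omega>) ^ b)) \<le> q"
    and t: "0 < t"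
  obtains B where "B \<in> events" "prob B \<le> real p * ((real N * q + real (4 * 2 ^ j)) / t) ^ (4 * 2 ^ j)"
    "\<And>\<omega>. \<omega> \<in> space M \<Longrightarrow> \<omega> \<notin> B \<Longrightarrow> op_bound p n (\<lambda>i j. Z (i, j) \<omega>) t"
proof -
  define k :: nat where "k = 2 ^ j"
  define F where "F \<omega> = gram_power_frobenius p n (\<lambda>e. Z e \<omega>) k" for \<omega>
  have F: "integrable M F" "expectation F \<le> real p * (real N * q + real (4 * k)) ^ (4 * k)"
    unfolding F_def by (rule expectation_gram_power_frobenius_le[OF indep bnd q N mom], assumption+)+
  define B where "B = {\<omega> \<in> space M. F \<omega> \<ge> t ^ (4 * k)}"
  show ?thesis
  proof
    show "B \<in> events" unfolding B_def using F(1) by measurable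
    have "prob B \<le> expectation F / t ^ (4 * k)"
    proof -
      have "0 \<le> F \<omega>" for \<omega> by (simp add: F_def gram_power_frobenius_def sum_nonneg)
      then show ?thesis
        unfolding B_def using F(1) t by (intro integral_Markov_inequality_measure[where A = "{}"]) auto
    qed
    also have "\<dots> \<le> real p * (real N * q + real (4 * k)) ^ (4 * k) / t ^ (4 * k)"
      using F(2) t by (intro divide_right_mono) auto
    finally show "prob B \<le> real p * ((real N * q + real (4 * 2 ^ j)) / t) ^ (4 * 2 ^ j)"
      by (simp add: k_def power_divide)
    fix \<omega> assume "\<omega> \<in> space M" "\<omega> \<notin> B"
    then have "gram_power_frobenius p n (\<lambda>e. Z e \<omega>) (2 ^ j) \<le> t ^ (4 * 2 ^ j)"
      by (simp add: B_def F_def k_def)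
    then show "op_bound p n (\<lambda>i j. Z (i, j) \<omega>) t"
      using t by (intro op_bound_gram_power_frobenius[where j = j]) auto
  qed
qed

section \<open>Regularly varying tails\<close>

text \<open>Geometric scales from \<open>\<tau>\<close> onwards: they discretize moduli in the dyadic arguments and in the estimate
  for close pairs.\<close>

lemma geometric_bracket:
  fixes \<tau> r t :: real
  assumes "0 < \<tau>" "1 < r" "\<tau> < t"
  shows "\<exists>k. \<tau> * r ^ k < t \<and> t \<le> \<tau> * r ^ Suc k"
proof -
  obtain K :: nat where "t / \<tau> < r ^ K" using real_arch_pow[OF assms(2)] by auto
  then have K: "t \<le> \<tau> * r ^ K" using assms by (simp add: divide_less_eq mult.commute)
  define j where "j = (LEAST j. t \<le> \<tau> * r ^ j)"
  have j: "t \<le> \<tau> * r ^ j" unfolding j_def by (rule LeastI[of _ K]) (rule K)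
  then have "j \<noteq> 0" using assms by (intro notI) simp
  then obtain k where k: "j = Suc k" using not0_implies_Suc by blast
  have "\<not> t \<le> \<tau> * r ^ k" using not_less_Least[of k "\<lambda>j. t \<le> \<tau> * r ^ j"] k by (simp add: j_def)
  then show ?thesis using j k by (intro exI[of _ k]) auto
qed

text \<open>A tail function \<open>t \<mapsto> P(X > t)\<close> that is regularly varying of index \<open>- \<alpha>\<close>.\<close>

locale regularly_varying_tail =
  fixes T :: "real \<Rightarrow> real" and \<alpha> :: real
  assumes antitone: "\<And>s t. s \<le> t \<Longrightarrow> T t \<le> T s"
    and le_1: "\<And>t. T t \<le> 1"
    and pos: "\<And>t. 0 < T t"
    and \<alpha>_pos: "0 < \<alpha>"
    and ratio: "\<And>s. 0 < s \<Longrightarrow> ((\<lambda>t. T (s * t) / T t) \<longlongrightarrow> s powr - \<alpha>) at_top"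
begin

lemma eventually_le_scaled:
  assumes "0 < s" "s powr - \<alpha> < c"
  shows "eventually (\<lambda>t. T (s * t) \<le> c * T t) at_top"
  using order_tendstoD(2)[OF ratio[OF assms(1)] assms(2)]
  by eventually_elim (use pos in \<open>simp add: divide_less_eq less_imp_le\<close>)

lemma eventually_ge_scaled:
  assumes "0 < s" "c < s powr - \<alpha>"
  shows "eventually (\<lambda>t. c * T t \<le> T (s * t)) at_top"
  using order_tendstoD(1)[OF ratio[OF assms(1)] assms(2)]
  by eventually_elim (use pos in \<open>simp add: less_divide_eq less_imp_le\<close>)

text \<open>One application of the limit ratio at scale two loses only a factor \<open>2^-\<gamma>\<close> with \<open>\<gamma>\<close> between \<open>\<beta>\<close> and
  \<open>\<alpha>\<close>. Iterating along powers of two and using monotonicity in between gives the bound with \<open>\<gamma>\<close> and a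
  constant; passing from \<open>\<gamma>\<close> to \<open>\<beta>\<close> absorbs the constant.\<close>

lemma potter_upper:
  assumes "0 < \<beta>" "\<beta> < \<alpha>"
  shows "eventually (\<lambda>t. T t \<le> t powr - \<beta>) at_top"
proof -
  define \<gamma> where "\<gamma> = (\<alpha> + \<beta>) / 2"
  have \<gamma>: "\<beta> < \<gamma>" "\<gamma> < \<alpha>" "0 < \<gamma>" using assms by (auto simp: \<gamma>_def)
  have "eventually (\<lambda>t. T (2 * t) \<le> 2 powr - \<gamma> * T t) at_top"
    by (rule eventually_le_scaled) (use \<gamma> in auto)
  then obtain t1 where t1: "\<And>t. t1 \<le> t \<Longrightarrow> T (2 * t) \<le> 2 powr - \<gamma> * T t"
    by (auto simp: eventually_at_top_linorder)
  define t0 where "t0 = max 1 t1"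
  have t0: "1 \<le> t0" "t1 \<le> t0" by (auto simp: t0_def)
  have iter: "T (2 ^ k * t0) \<le> (2 ^ k) powr - \<gamma>" for k
  proof (induction k)
    case 0
    then show ?case using le_1 by simp
  next
    case (Suc k)
    have "1 * t0 \<le> 2 ^ k * t0" using t0 by (intro mult_right_mono) auto
    then have "t1 \<le> 2 ^ k * t0" using t0 by linarith
    then have "T (2 * (2 ^ k * t0)) \<le> 2 powr - \<gamma> * T (2 ^ k * t0)" by (rule t1)
    also have "\<dots> \<le> 2 powr - \<gamma> * (2 ^ k) powr - \<gamma>" using Suc by (intro mult_left_mono) auto
    also have "\<dots> = (2 ^ Suc k) powr - \<gamma>" by (simp add: powr_mult)
    finally show ?case by (simp add: mult.assoc)
  qed
  have bound: "T t \<le> (2 * t0) powr \<gamma> * t powr - \<gamma>" if t: "t0 < t" for t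
  proof -
    obtain k where k: "2 ^ k * t0 < t" "t \<le> 2 ^ Suc k * t0"
      using geometric_bracket[of t0 2 t] t t0 by (auto simp: mult.commute)
    have "T t \<le> T (2 ^ k * t0)" using k(1) by (intro antitone) simp
    also have "\<dots> \<le> (2 ^ k) powr - \<gamma>" by (rule iter)
    also have "\<dots> \<le> (t / (2 * t0)) powr - \<gamma>"
    proof -
      have "t / (2 * t0) \<le> 2 ^ k" using k(2) t0 by (simp add: divide_le_eq mult_ac)
      moreover have "0 < t / (2 * t0)" using t t0 by simp
      ultimately show ?thesis using \<gamma> by (intro powr_mono2') auto
    qed
    also have "\<dots> = (2 * t0) powr \<gamma> * t powr - \<gamma>"
      using t t0 by (simp add: powr_divide powr_minus_divide)
    finally show ?thesis .
  qed
  have "((\<lambda>t::real. (2 * t0) powr \<gamma> * t powr - (\<gamma> - \<beta>)) \<longlongrightarrow> (2 * t0) powr \<gamma> * 0) at_top"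
    by (intro tendsto_mult_left tendsto_neg_powr filterlim_ident) (use \<gamma> in auto)
  then have "eventually (\<lambda>t::real. (2 * t0) powr \<gamma> * t powr - (\<gamma> - \<beta>) < 1) at_top"
    by (rule order_tendstoD) simp
  then show ?thesis using eventually_gt_at_top[of t0]
  proof eventually_elim
    case (elim t)
    have "T t \<le> ((2 * t0) powr \<gamma> * t powr - (\<gamma> - \<beta>)) * t powr - \<beta>"
      using bound[OF elim(2)] by (simp add: powr_add[symmetric] mult.assoc)
    also have "\<dots> \<le> 1 * t powr - \<beta>" using elim(1) by (intro mult_right_mono) auto
    finally show ?case by simp
  qed
qed

lemma potter_lower:
  assumes "\<alpha> < \<beta>"
  shows "eventually (\<lambda>t. t powr - \<beta> \<le> T t) at_top"
proof -
  define \<gamma> where "\<gamma> = (\<alpha> + \<beta>) / 2"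
  have \<gamma>: "\<gamma> < \<beta>" "\<alpha> < \<gamma>" "0 < \<gamma>" using assms \<alpha>_pos by (auto simp: \<gamma>_def)
  have "eventually (\<lambda>t. 2 powr - \<gamma> * T t \<le> T (2 * t)) at_top"
    by (rule eventually_ge_scaled) (use \<gamma> in auto)
  then obtain t1 where t1: "\<And>t. t1 \<le> t \<Longrightarrow> 2 powr - \<gamma> * T t \<le> T (2 * t)"
    by (auto simp: eventually_at_top_linorder)
  define t0 where "t0 = max 1 t1"
  have t0: "1 \<le> t0" "t1 \<le> t0" by (auto simp: t0_def)
  have iter: "(2 ^ k) powr - \<gamma> * T t0 \<le> T (2 ^ k * t0)" for k
  proof (induction k)
    case (Suc k)
    have "1 * t0 \<le> 2 ^ k * t0" using t0 by (intro mult_right_mono) auto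
    then have "t1 \<le> 2 ^ k * t0" using t0 by linarith
    then have le: "2 powr - \<gamma> * T (2 ^ k * t0) \<le> T (2 * (2 ^ k * t0))" by (rule t1)
    have "(2 ^ Suc k) powr - \<gamma> * T t0 = 2 powr - \<gamma> * ((2 ^ k) powr - \<gamma> * T t0)" by (simp add: powr_mult)
    also have "\<dots> \<le> 2 powr - \<gamma> * T (2 ^ k * t0)" using Suc by (intro mult_left_mono) auto
    also note le
    finally show ?case by (simp add: mult.assoc)
  qed simp
  have bound: "(t0 / 2) powr \<gamma> * T t0 * t powr - \<gamma> \<le> T t" if t: "t0 < t" for t
  proof -
    obtain k where k: "2 ^ k * t0 < t" "t \<le> 2 ^ Suc k * t0"
      using geometric_bracket[of t0 2 t] t t0 by (auto simp: mult.commute)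
    have "(t0 / 2) powr \<gamma> * T t0 * t powr - \<gamma> = (2 * t / t0) powr - \<gamma> * T t0"
      using t t0 by (simp add: powr_divide powr_minus_divide powr_mult)
    also have "\<dots> \<le> (2 ^ Suc k) powr - \<gamma> * T t0"
    proof (intro mult_right_mono powr_mono2')
      show "2 ^ Suc k \<le> 2 * t / t0" using k(1) t0 by (simp add: le_divide_eq mult_ac)
    qed (use \<gamma> pos[of t0] in auto)
    also have "\<dots> \<le> T (2 ^ Suc k * t0)" by (rule iter)
    also have "\<dots> \<le> T t" by (rule antitone) (use k in simp)
    finally show ?thesis .
  qed
  define c where "c = (t0 / 2) powr \<gamma> * T t0"
  have c: "0 < c" using t0 pos by (simp add: c_def)
  have "((\<lambda>t::real. t powr - (\<beta> - \<gamma>)) \<longlongrightarrow> 0) at_top"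
    by (intro tendsto_neg_powr filterlim_ident) (use \<gamma> in auto)
  then have "eventually (\<lambda>t::real. t powr - (\<beta> - \<gamma>) < c) at_top"
    by (rule order_tendstoD) (rule c)
  then show ?thesis using eventually_gt_at_top[of t0]
  proof eventually_elim
    case (elim t)
    have "t powr - \<beta> = t powr - (\<beta> - \<gamma>) * t powr - \<gamma>" by (simp add: powr_add[symmetric])
    also have "\<dots> \<le> c * t powr - \<gamma>" using elim(1) by (intro mult_right_mono) auto
    also have "\<dots> \<le> T t" using bound[OF elim(2)] by (simp add: c_def)
    finally show ?case .
  qed
qed

lemma tendsto_0: "(T \<longlongrightarrow> 0) at_top"
proof (rule tendsto_sandwich[of "\<lambda>_. 0" T at_top "\<lambda>t. t powr - (\<alpha> / 2)"])
  show "eventually (\<lambda>t. T t \<le> t powr - (\<alpha> / 2)) at_top" by (rule potter_upper) (use \<alpha>_pos in auto)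
  show "((\<lambda>t. t powr - (\<alpha> / 2)) \<longlongrightarrow> 0) at_top"
    by (intro tendsto_neg_powr filterlim_ident) (use \<alpha>_pos in auto)
qed (use pos in \<open>auto simp: less_imp_le\<close>)

text \<open>Approximate quantiles exist among the powers of two because far out the tail drops by at most the factor
  \<open>2^(\<alpha> + 1)\<close> from one to the next. The exact quantile could fail to exist because of atoms.\<close>

lemma quantile:
  obtains u0 where "0 < u0"
    "\<And>u. 0 < u \<Longrightarrow> u < u0 \<Longrightarrow> \<exists>\<tau>\<ge>t0. u * 2 powr - (\<alpha> + 1) \<le> T \<tau> \<and> T \<tau> \<le> u"
proof -
  have "eventually (\<lambda>t. 2 powr - (\<alpha> + 1) * T t \<le> T (2 * t)) at_top"
    by (rule eventually_ge_scaled) auto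
  then obtain t1 where t1: "\<And>t. t1 \<le> t \<Longrightarrow> 2 powr - (\<alpha> + 1) * T t \<le> T (2 * t)"
    by (auto simp: eventually_at_top_linorder)
  obtain m :: nat where m: "max t0 t1 < 2 ^ m" using real_arch_pow[of 2 "max t0 t1"] by auto
  have "\<exists>\<tau>\<ge>t0. u * 2 powr - (\<alpha> + 1) \<le> T \<tau> \<and> T \<tau> \<le> u" if u: "0 < u" "u < T (2 ^ m)" for u
  proof -
    have "eventually (\<lambda>t. T t < u) at_top" by (rule order_tendstoD(2)[OF tendsto_0 u(1)])
    then obtain t2 where t2: "\<And>t. t2 \<le> t \<Longrightarrow> T t < u" by (auto simp: eventually_at_top_linorder)
    obtain j0 :: nat where j0: "t2 < 2 ^ j0" using real_arch_pow[of 2 t2] by auto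
    define j where "j = (LEAST j::nat. T (2 ^ j) \<le> u)"
    have j: "T (2 ^ j) \<le> u" unfolding j_def by (rule LeastI[of _ j0]) (use t2[of "2 ^ j0"] j0 in simp)
    have "m < j"
    proof (rule ccontr)
      assume "\<not> m < j"
      then have "T (2 ^ m) \<le> T (2 ^ j)" by (intro antitone power_increasing) auto
      then show False using j u by simp
    qed
    then obtain k where k: "j = Suc k" "m \<le> k" by (cases j) auto
    have "\<not> T (2 ^ k) \<le> u" using not_less_Least[of k "\<lambda>j. T (2 ^ j) \<le> u"] k by (simp add: j_def)
    have "(2::real) ^ m \<le> 2 ^ k" "(2::real) ^ m \<le> 2 ^ j"
      by (intro power_increasing; use k in simp)+
    then have "t1 \<le> 2 ^ k" "t0 \<le> 2 ^ j" using m by linarith+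
    have "u * 2 powr - (\<alpha> + 1) \<le> T (2 ^ k) * 2 powr - (\<alpha> + 1)"
      using \<open>\<not> T (2 ^ k) \<le> u\<close> by (intro mult_right_mono) auto
    also have "\<dots> \<le> T (2 ^ j)" using t1[OF \<open>t1 \<le> 2 ^ k\<close>] k by (simp add: mult.commute)
    finally show ?thesis using j \<open>t0 \<le> 2 ^ j\<close> by blast
  qed
  then show ?thesis using that[of "T (2 ^ m)"] pos by blast
qed

text \<open>Regular variation excludes atoms in the limit: a short multiplicative interval carries only a small
  fraction of the tail beyond it.\<close>

lemma close_scales:
  assumes "0 < \<kappa>"
  obtains r where "1 < r" "eventually (\<lambda>t. T (t / r\<^sup>2) - T t \<le> \<kappa> * T t) at_top"
proof
  define r where "r = (1 + \<kappa> / 2) powr (1 / (2 * \<alpha>))"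
  show r: "1 < r" unfolding r_def using assms \<alpha>_pos by (simp add: gr_one_powr)
  have "(1 / r\<^sup>2) powr - \<alpha> = r powr (2 * \<alpha>)"
    using r by (simp add: powr_divide powr_minus_divide powr_powr flip: powr_numeral)
  also have "\<dots> = 1 + \<kappa> / 2" unfolding r_def powr_powr using assms \<alpha>_pos by simp
  finally have lim: "(1 / r\<^sup>2) powr - \<alpha> < 1 + \<kappa>" using assms by simp
  have "eventually (\<lambda>t. T (1 / r\<^sup>2 * t) \<le> (1 + \<kappa>) * T t) at_top"
    by (rule eventually_le_scaled[OF _ lim]) (use r in auto)
  then show "eventually (\<lambda>t. T (t / r\<^sup>2) - T t \<le> \<kappa> * T t) at_top"
    by eventually_elim (simp add: algebra_simps)
qed

end

text \<open>The limit condition at \<open>s = 1\<close> already forces \<open>L t \<noteq> 0\<close> for large \<open>t\<close>, because the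
  quotient by zero is zero; so the tail never vanishes.\<close>

lemma regularly_varying_tailI:
  fixes x :: "'b \<Rightarrow> complex"
  assumes "prob_space N" and x: "x \<in> borel_measurable N"
    and \<alpha>: "0 < \<alpha>" and L: "slowly_varying L"
    and tail: "\<And>t. t > 0 \<Longrightarrow> \<P>(\<omega> in N. cmod (x \<omega>) > t) = L t * t powr (- \<alpha>)"
  shows "regularly_varying_tail (\<lambda>t. \<P>(\<omega> in N. cmod (x \<omega>) > t)) \<alpha>"
proof -
  interpret N: prob_space N by fact
  define T where "T t = \<P>(\<omega> in N. cmod (x \<omega>) > t)" for t
  have anti: "T t \<le> T s" if "s \<le> t" for s t
    unfolding T_def using x that by (intro N.finite_measure_mono) auto
  have T: "T t = L t * t powr - \<alpha>" if "t > 0" for t using tail that by (simp add: T_def)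
  have "((\<lambda>t. L (1 * t) / L t) \<longlongrightarrow> 1) at_top" using L unfolding slowly_varying_def by (elim allE[of _ 1]) simp
  then have "eventually (\<lambda>t. L (1 * t) / L t > 0) at_top" by (rule order_tendstoD) simp
  then have "eventually (\<lambda>t. L t \<noteq> 0) at_top" by eventually_elim auto
  then obtain t0 where t0: "\<And>t. t0 \<le> t \<Longrightarrow> L t \<noteq> 0" by (auto simp: eventually_at_top_linorder)
  have pos: "0 < T t" for t
  proof -
    define s where "s = max 1 (max t0 t)"
    have "T s \<noteq> 0" using T[of s] t0[of s] by (simp add: s_def)
    moreover have "0 \<le> T s" by (simp add: T_def)
    moreover have "T s \<le> T t" by (rule anti) (simp add: s_def)
    ultimately show ?thesis by simp
  qed
  have ratio: "((\<lambda>t. T (s * t) / T t) \<longlongrightarrow> s powr - \<alpha>) at_top" if s: "0 < s" for s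
  proof -
    have "((\<lambda>t. s powr - \<alpha> * (L (s * t) / L t)) \<longlongrightarrow> s powr - \<alpha> * 1) at_top"
      using L s unfolding slowly_varying_def by (intro tendsto_mult_left) auto
    moreover have "eventually (\<lambda>t. s powr - \<alpha> * (L (s * t) / L t) = T (s * t) / T t) at_top"
      using eventually_gt_at_top[of 0] by eventually_elim (use s in \<open>simp add: T powr_mult\<close>)
    ultimately show ?thesis by (simp add: tendsto_cong)
  qed
  show ?thesis
    by unfold_locales (fold T_def, use anti pos \<alpha> ratio in \<open>auto simp: T_def N.prob_le_1\<close>)
qed

text \<open>Dyadic layers: beyond one, \<open>X powr s\<close> is at most \<open>2^((k+1) s)\<close> for the \<open>k\<close> with
  \<open>2^k < X \<le> 2^(k+1)\<close>, and the tail bound makes the resulting series geometric.\<close>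

lemma (in prob_space) integrable_powr_of_tail:
  fixes X :: "'a \<Rightarrow> real"
  assumes X: "X \<in> borel_measurable M" "\<And>\<omega>. 0 \<le> X \<omega>" and s: "0 < s" "s < \<beta>"
    and tail: "eventually (\<lambda>t. \<P>(\<omega> in M. X \<omega> > t) \<le> t powr - \<beta>) at_top"
  shows "integrable M (\<lambda>\<omega>. X \<omega> powr s)"
proof -
  define T where "T t = \<P>(\<omega> in M. X \<omega> > t)" for t
  define c where "c k = (2 ^ Suc k) powr s" for k :: nat
  define A where "A k = {\<omega> \<in> space M. X \<omega> > 2 ^ k}" for k :: nat
  have A: "A k \<in> events" for k unfolding A_def using X(1) by measurable
  have summ: "summable (\<lambda>k. c k * T (2 ^ k))"
  proof (rule summable_comparison_test_ev)
    have "filterlim (\<lambda>k. 2 ^ k :: real) at_top sequentially"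
      by (rule filterlim_at_top_mono[OF filterlim_real_sequentially])
         (simp add: of_nat_less_two_power less_imp_le)
    from filterlim_iff[THEN iffD1, OF this, rule_format, OF tail]
    show "eventually (\<lambda>k. norm (c k * T (2 ^ k)) \<le> 2 powr s * (2 powr (s - \<beta>)) ^ k) sequentially"
    proof eventually_elim
      case (elim k)
      have "c k * T (2 ^ k) \<le> (2 ^ Suc k) powr s * (2 ^ k) powr - \<beta>"
        unfolding c_def using elim by (intro mult_left_mono) (auto simp: T_def)
      also have "\<dots> = 2 powr s * (2 powr (s - \<beta>)) ^ k"
      proof -
        have e: "a ^ i = a powr real i" if "0 < a" for a :: real and i using that by (simp add: powr_realpow)
        have "(2 ^ Suc k) powr s * (2 ^ k) powr - \<beta> = (2::real) powr (real (Suc k) * s + real k * - \<beta>)"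
          by (simp only: e[of 2] powr_powr powr_add zero_less_numeral)
        also have "real (Suc k) * s + real k * - \<beta> = s + (s - \<beta>) * real k" by (simp add: algebra_simps)
        also have "(2::real) powr (s + (s - \<beta>) * real k) = 2 powr s * (2 powr (s - \<beta>)) ^ k"
          by (simp add: powr_add powr_powr e[of "2 powr (s - \<beta>)"])
        finally show ?thesis .
      qed
      finally show ?case by (simp add: c_def T_def)
    qed
    show "summable (\<lambda>k. 2 powr s * (2 powr (s - \<beta>)) ^ k)"
      using s by (intro summable_mult summable_geometric) (simp add: powr_less_one)
  qed
  have pt: "ennreal (X \<omega> powr s) \<le> 1 + (\<Sum>k. ennreal (c k) * indicator (A k) \<omega>)" if \<omega>: "\<omega> \<in> space M" for \<omega>
  proof (cases "X \<omega> \<le> 1")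
    case True
    then have "X \<omega> powr s \<le> 1" using X(2) s by (simp add: powr_le1)
    then have "ennreal (X \<omega> powr s) \<le> 1" using ennreal_leI[of "X \<omega> powr s" 1] by simp
    also have "1 \<le> 1 + (\<Sum>k. ennreal (c k) * indicator (A k) \<omega>)" by simp
    finally show ?thesis .
  next
    case False
    then obtain k where k: "2 ^ k < X \<omega>" "X \<omega> \<le> 2 ^ Suc k"
      using geometric_bracket[of 1 2 "X \<omega>"] by auto
    then have "\<omega> \<in> A k" using \<omega> by (simp add: A_def)
    have "X \<omega> powr s \<le> c k" unfolding c_def using k X(2) s by (intro powr_mono2) auto
    then have "ennreal (X \<omega> powr s) \<le> ennreal (c k) * indicator (A k) \<omega>"
      using \<open>\<omega> \<in> A k\<close> by (simp add: ennreal_leI)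
    also have "\<dots> \<le> (\<Sum>k. ennreal (c k) * indicator (A k) \<omega>)"
    proof -
      have "f k \<le> suminf f" for f :: "nat \<Rightarrow> ennreal" using sum_le_suminf[of f "{k}"] by simp
      then show ?thesis .
    qed
    finally show ?thesis by (simp add: add_increasing)
  qed
  have m: "(\<lambda>\<omega>. ennreal (c k) * indicator (A k) \<omega>) \<in> borel_measurable M" for k
    using A by measurable
  have "(\<integral>\<^sup>+\<omega>. ennreal (X \<omega> powr s) \<partial>M) \<le> (\<integral>\<^sup>+\<omega>. 1 + (\<Sum>k. ennreal (c k) * indicator (A k) \<omega>) \<partial>M)"
    by (rule nn_integral_mono) (rule pt)
  also have "\<dots> = (\<integral>\<^sup>+\<omega>. 1 \<partial>M) + (\<integral>\<^sup>+\<omega>. (\<Sum>k. ennreal (c k) * indicator (A k) \<omega>) \<partial>M)"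
    by (rule nn_integral_add) (use m in measurable)
  also have "(\<integral>\<^sup>+\<omega>. (\<Sum>k. ennreal (c k) * indicator (A k) \<omega>) \<partial>M) = (\<Sum>k. \<integral>\<^sup>+\<omega>. ennreal (c k) * indicator (A k) \<omega> \<partial>M)"
    by (rule nn_integral_suminf) (rule m)
  also have "\<dots> = (\<Sum>k. ennreal (c k * T (2 ^ k)))"
  proof (intro suminf_cong)
    fix k
    have "(\<integral>\<^sup>+\<omega>. ennreal (c k) * indicator (A k) \<omega> \<partial>M) = ennreal (c k) * ennreal (prob (A k))"
      unfolding nn_integral_cmult_indicator[OF A] emeasure_eq_measure ..
    also have "prob (A k) = T (2 ^ k)" by (simp add: A_def T_def)
    also have "ennreal (c k) * ennreal (T (2 ^ k)) = ennreal (c k * T (2 ^ k))"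
      by (rule ennreal_mult[symmetric]) (simp_all add: c_def T_def)
    finally show "(\<integral>\<^sup>+\<omega>. ennreal (c k) * indicator (A k) \<omega> \<partial>M) = ennreal (c k * T (2 ^ k))" .
  qed
  also have "(\<integral>\<^sup>+\<omega>. 1 \<partial>M) + (\<Sum>k. ennreal (c k * T (2 ^ k))) < \<infinity>"
  proof -
    have "0 \<le> c k * T (2 ^ k)" for k by (simp add: c_def T_def)
    then have "(\<Sum>k. ennreal (c k * T (2 ^ k))) = ennreal (\<Sum>k. c k * T (2 ^ k))"
      by (rule suminf_ennreal2[OF _ summ])
    then show ?thesis by (simp add: emeasure_space_1)
  qed
  finally have "(\<integral>\<^sup>+\<omega>. ennreal (X \<omega> powr s) \<partial>M) < \<infinity>" .
  then show ?thesis using X(1) by (intro integrableI_bounded) auto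
qed

section \<open>Independent masked entries\<close>

text \<open>Independence within each family and between the two families makes all the variables
  jointly independent; the disjoint sum of the index sets holds them together.\<close>

lemma (in prob_space) indep_vars_disjoint_sum:
  fixes a b :: "'i \<Rightarrow> 'a \<Rightarrow> complex"
  assumes I: "finite I" "I \<noteq> {}"
    and a: "indep_vars (\<lambda>_. borel) a I" and b: "indep_vars (\<lambda>_. borel) b I"
    and ab: "indep_families M I a I b"
  shows "indep_vars (\<lambda>_. borel) (case_sum a b) (I <+> I)"
proof -
  have rva: "random_variable borel (a i)" and rvb: "random_variable borel (b i)" if "i \<in> I" for i
    using a b that by (auto simp: indep_vars_def)
  have fin: "finite (I <+> I)" "I <+> I \<noteq> {}" using I by auto
  have cond: "prob (\<Inter>j\<in>I <+> I. case_sum a b j -` A j \<inter> space M)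
      = (\<Prod>j\<in>I <+> I. prob (case_sum a b j -` A j \<inter> space M))"
    if A: "A \<in> (\<Pi> j\<in>I <+> I. sets borel)" for A
  proof -
    have A': "A (Inl i) \<in> sets borel" "A (Inr i) \<in> sets borel" if "i \<in> I" for i using A that by auto
    define Xa where "Xa = (\<Pi>\<^sub>E i\<in>I. A (Inl i))"
    define Xb where "Xb = (\<Pi>\<^sub>E i\<in>I. A (Inr i))"
    have X: "Xa \<in> sets (Pi\<^sub>M I (\<lambda>_. borel))" "Xb \<in> sets (Pi\<^sub>M I (\<lambda>_. borel))"
      unfolding Xa_def Xb_def using A' I by (auto intro!: sets_PiM_I_finite)
    have ea: "(\<lambda>\<omega>. \<lambda>i\<in>I. a i \<omega>) -` Xa \<inter> space M = (\<Inter>i\<in>I. a i -` A (Inl i) \<inter> space M)"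
      using I by (auto simp: Xa_def PiE_iff)
    have eb: "(\<lambda>\<omega>. \<lambda>i\<in>I. b i \<omega>) -` Xb \<inter> space M = (\<Inter>i\<in>I. b i -` A (Inr i) \<inter> space M)"
      using I by (auto simp: Xb_def PiE_iff)
    have "(\<Inter>j\<in>I <+> I. case_sum a b j -` A j \<inter> space M)
        = (\<Inter>i\<in>I. a i -` A (Inl i) \<inter> space M) \<inter> (\<Inter>i\<in>I. b i -` A (Inr i) \<inter> space M)"
      using I by (auto simp: Plus_def ball_Un)
    also have "\<dots> = (\<lambda>\<omega>. (\<lambda>i\<in>I. a i \<omega>, \<lambda>i\<in>I. b i \<omega>)) -` (Xa \<times> Xb) \<inter> space M"
      unfolding ea[symmetric] eb[symmetric] by auto
    finally have "prob (\<Inter>j\<in>I <+> I. case_sum a b j -` A j \<inter> space M)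
        = prob ((\<lambda>\<omega>. \<lambda>i\<in>I. a i \<omega>) -` Xa \<inter> space M) * prob ((\<lambda>\<omega>. \<lambda>i\<in>I. b i \<omega>) -` Xb \<inter> space M)"
      using indep_varD[OF ab[unfolded indep_families_def] X] by simp
    also have "prob ((\<lambda>\<omega>. \<lambda>i\<in>I. a i \<omega>) -` Xa \<inter> space M) = (\<Prod>i\<in>I. prob (a i -` A (Inl i) \<inter> space M))"
      unfolding ea by (rule indep_varsD_finite[OF a I(2,1)]) (rule A')
    also have "prob ((\<lambda>\<omega>. \<lambda>i\<in>I. b i \<omega>) -` Xb \<inter> space M) = (\<Prod>i\<in>I. prob (b i -` A (Inr i) \<inter> space M))"
      unfolding eb by (rule indep_varsD_finite[OF b I(2,1)]) (rule A')
    finally show ?thesis using I by (simp add: prod.Plus)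
  qed
  show ?thesis
  proof (subst indep_vars_finite[OF fin(2,1), of _ "\<lambda>_. sets borel"])
    show "sets borel = sigma_sets (space (borel :: complex measure)) (sets borel)"
      by (simp only: sets.sigma_sets_eq)
    show "random_variable borel (case_sum a b j)" if "j \<in> I <+> I" for j
      using that rva rvb by auto
    show "Int_stable (sets (borel :: complex measure))" by (rule sets.Int_stable)
    show "sets (borel :: complex measure) \<subseteq> Pow (space borel)" by (rule sets.space_closed)
    show "\<forall>A\<in>(\<Pi> j\<in>I <+> I. sets borel). prob (\<Inter>j\<in>I <+> I. case_sum a b j -` A j \<inter> space M)
      = (\<Prod>j\<in>I <+> I. prob (case_sum a b j -` A j \<inter> space M))" using cond by blast
  qed auto
qed

lemma (in prob_space) indep_vars_mult_families:
  fixes a b :: "'i \<Rightarrow> 'a \<Rightarrow> complex"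
  assumes I: "finite I" "I \<noteq> {}"
    and a: "indep_vars (\<lambda>_. borel) a I" and b: "indep_vars (\<lambda>_. borel) b I"
    and ab: "indep_families M I a I b"
  shows "indep_vars (\<lambda>_. borel) (\<lambda>i \<omega>. a i \<omega> * b i \<omega>) I"
proof -
  (* the two variables that belong to one position *)
  define K where "K i = {Inl i, Inr i :: 'i + 'i}" for i :: 'i
  have "indep_vars (\<lambda>j. Pi\<^sub>M (K j) (\<lambda>_. borel)) (\<lambda>j \<omega>. restrict (\<lambda>i. case_sum a b i \<omega>) (K j)) I"
    by (rule indep_vars_restrict[OF indep_vars_disjoint_sum[OF I a b ab]])
       (auto simp: K_def disjoint_family_on_def)
  then have "indep_vars (\<lambda>_. borel) (\<lambda>j \<omega>. (\<lambda>f. f (Inl j) * f (Inr j)) (restrict (\<lambda>i. case_sum a b i \<omega>) (K j))) I"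
    by (rule indep_vars_compose2) (unfold K_def, measurable)
  then show ?thesis by (simp add: K_def)
qed

text \<open>The mask is almost surely 0 or 1, so \<open>f (a b) = f a\<close> if \<open>b = 1\<close> and \<open>f (a b) = 0\<close>
  otherwise; independence then splits the expectation.\<close>

lemma (in prob_space) expectation_masked:
  fixes f :: "complex \<Rightarrow> complex" and x y :: "'b \<Rightarrow> complex"
  assumes "prob_space N" and x: "x \<in> borel_measurable N" and y: "y \<in> borel_measurable N"
    and w: "\<P>(\<omega> in N. y \<omega> = 1) = w" "\<P>(\<omega> in N. y \<omega> = 0) = 1 - w"
    and a: "distr M borel a = distr N borel x" and b: "distr M borel b = distr N borel y"
    and ab: "indep_var borel a borel b"
    and f: "f \<in> borel_measurable borel" "f 0 = 0" "integrable N (\<lambda>\<omega>. f (x \<omega>))"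
  shows "expectation (\<lambda>\<omega>. f (a \<omega> * b \<omega>)) = complex_of_real w * (\<integral>\<omega>. f (x \<omega>) \<partial>N)"
    and "integrable M (\<lambda>\<omega>. f (a \<omega> * b \<omega>))"
proof -
  interpret N: prob_space N by fact
  have [measurable]: "random_variable borel a" "random_variable borel b"
    using indep_var_rv1[OF ab] indep_var_rv2[OF ab] by auto
  note [measurable] = x y f(1)
  have pb: "prob {\<omega> \<in> space M. b \<omega> \<in> A} = N.prob {\<omega> \<in> space N. y \<omega> \<in> A}" if [measurable]: "A \<in> sets borel" for A
  proof -
    have "prob {\<omega> \<in> space M. b \<omega> \<in> A} = measure (distr M borel b) A"
      by (subst measure_distr) (auto intro!: arg_cong[where f = prob])
    also have "\<dots> = N.prob {\<omega> \<in> space N. y \<omega> \<in> A}"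
      unfolding b by (subst measure_distr) (auto intro!: arg_cong[where f = N.prob])
    finally show ?thesis .
  qed
  have "N.prob {\<omega> \<in> space N. y \<omega> \<in> {0, 1}} = N.prob {\<omega> \<in> space N. y \<omega> = 1} + N.prob {\<omega> \<in> space N. y \<omega> = 0}"
    by (subst N.finite_measure_Union[symmetric]) (auto intro!: arg_cong[where f = N.prob])
  then have "prob {\<omega> \<in> space M. b \<omega> \<in> {0, 1}} = 1" using pb[of "{0, 1}"] w by simp
  then have "AE \<omega> in M. \<omega> \<in> {\<omega> \<in> space M. b \<omega> \<in> {0, 1}}" by (rule AE_prob_1)
  then have ae: "AE \<omega> in M. f (a \<omega> * b \<omega>) = f (a \<omega>) * of_bool (b \<omega> = 1)"
    by eventually_elim (use f(2) in auto)
  have ind: "indep_var borel (\<lambda>\<omega>. f (a \<omega>)) borel (\<lambda>\<omega>. of_bool (b \<omega> = 1) :: complex)"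
    using indep_var_compose[OF ab, of f borel "\<lambda>z. of_bool (z = 1) :: complex" borel] by (simp add: o_def)
  have i1: "integrable M (\<lambda>\<omega>. f (a \<omega>))"
  proof -
    have "integrable (distr N borel x) f" using f(3) by (subst integrable_distr_eq) auto
    then have "integrable (distr M borel a) f" by (simp only: a)
    then show ?thesis by (subst (asm) integrable_distr_eq) auto
  qed
  have i2: "integrable M (\<lambda>\<omega>. of_bool (b \<omega> = 1) :: complex)"
    by (rule integrable_const_bound[of _ 1]) auto
  have i: "integrable M (\<lambda>\<omega>. f (a \<omega>) * of_bool (b \<omega> = 1))" by (rule indep_var_integrable[OF ind i1 i2])
  then show "integrable M (\<lambda>\<omega>. f (a \<omega> * b \<omega>))"
    by (rule integrable_cong_AE_imp) (use ae in auto)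
  have "expectation (\<lambda>\<omega>. f (a \<omega> * b \<omega>)) = expectation (\<lambda>\<omega>. f (a \<omega>) * of_bool (b \<omega> = 1))"
    by (rule integral_cong_AE) (use ae in auto)
  also have "\<dots> = expectation (\<lambda>\<omega>. f (a \<omega>)) * expectation (\<lambda>\<omega>. of_bool (b \<omega> = 1))"
    by (rule indep_var_lebesgue_integral[OF ind i1 i2])
  also have "expectation (\<lambda>\<omega>. f (a \<omega>)) = (\<integral>\<omega>. f (x \<omega>) \<partial>N)"
  proof -
    have "expectation (\<lambda>\<omega>. f (a \<omega>)) = integral\<^sup>L (distr M borel a) f" by (rule integral_distr[symmetric]) auto
    also have "\<dots> = (\<integral>\<omega>. f (x \<omega>) \<partial>N)" unfolding a by (rule integral_distr) auto
    finally show ?thesis .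
  qed
  also have "expectation (\<lambda>\<omega>. of_bool (b \<omega> = 1) :: complex) = complex_of_real w"
  proof -
    have "expectation (\<lambda>\<omega>. of_bool (b \<omega> = 1) :: complex)
        = expectation (\<lambda>\<omega>. complex_of_real (indicator {\<omega> \<in> space M. b \<omega> = 1} \<omega>))"
      by (intro Bochner_Integration.integral_cong) (auto simp: indicator_def)
    also have "\<dots> = complex_of_real (prob {\<omega> \<in> space M. b \<omega> = 1})"
      unfolding integral_complex_of_real by (simp add: Int_absorb2 Collect_conj_eq)
    also have "prob {\<omega> \<in> space M. b \<omega> = 1} = w" using pb[of "{1}"] w by simp
    finally show ?thesis .
  qed
  finally show "expectation (\<lambda>\<omega>. f (a \<omega> * b \<omega>)) = complex_of_real w * (\<integral>\<omega>. f (x \<omega>) \<partial>N)" by simp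
qed

text \<open>A finite family of independent variables, each of which has the law of \<open>x\<close> with probability \<open>w\<close> and
  vanishes otherwise. The law enters only through expectations of test functions that vanish at 0.\<close>

locale masked_entries = prob_space M for M :: "'a measure" +
  fixes N :: "'b measure" and x :: "'b \<Rightarrow> complex" and w :: real
    and I :: "'i set" and m :: "'i \<Rightarrow> 'a \<Rightarrow> complex"
  assumes prob_N: "prob_space N" and x_measurable: "x \<in> borel_measurable N" and finite_I: "finite I"
    and w: "0 \<le> w" "w \<le> 1"
    and indep: "indep_vars (\<lambda>_. borel) m I"
    and integrable_entry: "\<And>i f :: complex \<Rightarrow> complex. i \<in> I \<Longrightarrow> f \<in> borel_measurable borel \<Longrightarrow> f 0 = 0
        \<Longrightarrow> integrable N (\<lambda>\<omega>. f (x \<omega>)) \<Longrightarrow> integrable M (\<lambda>\<omega>. f (m i \<omega>))"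
    and expectation_entry: "\<And>i f :: complex \<Rightarrow> complex. i \<in> I \<Longrightarrow> f \<in> borel_measurable borel \<Longrightarrow> f 0 = 0
        \<Longrightarrow> integrable N (\<lambda>\<omega>. f (x \<omega>)) \<Longrightarrow> expectation (\<lambda>\<omega>. f (m i \<omega>)) = complex_of_real w * (\<integral>\<omega>. f (x \<omega>) \<partial>N)"
begin

sublocale N: prob_space N by (rule prob_N)

definition T :: "real \<Rightarrow> real" where "T t = \<P>(\<omega> in N. cmod (x \<omega>) > t)"

lemma entry_measurable: "i \<in> I \<Longrightarrow> random_variable borel (m i)"
  using indep by (auto simp: indep_vars_def)

lemma expectation_entry_real:
  fixes f :: "complex \<Rightarrow> real"
  assumes "i \<in> I" and [measurable]: "f \<in> borel_measurable borel" and "f 0 = 0" "integrable N (\<lambda>\<omega>. f (x \<omega>))"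
  shows "expectation (\<lambda>\<omega>. f (m i \<omega>)) = w * (\<integral>\<omega>. f (x \<omega>) \<partial>N)" "integrable M (\<lambda>\<omega>. f (m i \<omega>))"
proof -
  have *: "(\<lambda>z. complex_of_real (f z)) \<in> borel_measurable borel" "complex_of_real (f 0) = 0"
    "integrable N (\<lambda>\<omega>. complex_of_real (f (x \<omega>)))" using assms by auto
  have "complex_of_real (expectation (\<lambda>\<omega>. f (m i \<omega>))) = complex_of_real (w * (\<integral>\<omega>. f (x \<omega>) \<partial>N))"
    using expectation_entry[OF assms(1) *] by simp
  then show "expectation (\<lambda>\<omega>. f (m i \<omega>)) = w * (\<integral>\<omega>. f (x \<omega>) \<partial>N)" by (simp only: of_real_eq_iff)
  have "integrable M (\<lambda>\<omega>. Re (complex_of_real (f (m i \<omega>))))"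
    using integrable_entry[OF assms(1) *] by (rule integrable_Re)
  then show "integrable M (\<lambda>\<omega>. f (m i \<omega>))" by simp
qed

lemma prob_entry:
  assumes i: "i \<in> I" and [measurable]: "A \<in> sets borel" and A: "0 \<notin> A"
  shows "prob {\<omega> \<in> space M. m i \<omega> \<in> A} = w * N.prob {\<omega> \<in> space N. x \<omega> \<in> A}"
proof -
  note [measurable] = entry_measurable[OF i] x_measurable
  have int: "integrable N (\<lambda>\<omega>. indicat_real A (x \<omega>))"
    by (rule N.integrable_const_bound[of _ 1]) (auto simp: indicator_def)
  have "prob {\<omega> \<in> space M. m i \<omega> \<in> A} = expectation (indicat_real {\<omega> \<in> space M. m i \<omega> \<in> A})"
    by (simp add: Int_absorb2 Collect_conj_eq)
  also have "\<dots> = expectation (\<lambda>\<omega>. indicat_real A (m i \<omega>))"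
    by (intro Bochner_Integration.integral_cong) (auto simp: indicator_def)
  also have "\<dots> = w * (\<integral>\<omega>. indicat_real A (x \<omega>) \<partial>N)"
    by (rule expectation_entry_real(1)[OF i _ _ int]) (use A in \<open>auto simp: indicator_def\<close>)
  also have "(\<integral>\<omega>. indicat_real A (x \<omega>) \<partial>N) = N.expectation (indicat_real {\<omega> \<in> space N. x \<omega> \<in> A})"
    by (intro Bochner_Integration.integral_cong) (auto simp: indicator_def)
  also have "\<dots> = N.prob {\<omega> \<in> space N. x \<omega> \<in> A}"
    by (simp add: Int_absorb2 Collect_conj_eq)
  finally show ?thesis .
qed

lemma prob_entry_gt: "i \<in> I \<Longrightarrow> 0 \<le> t \<Longrightarrow> prob {\<omega> \<in> space M. t < cmod (m i \<omega>)} = w * T t"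
  using prob_entry[of i "{z. t < cmod z}"] by (simp add: T_def)

lemma prob_entry_interval:
  assumes i: "i \<in> I" and st: "0 \<le> s" "s \<le> t"
  shows "prob {\<omega> \<in> space M. s < cmod (m i \<omega>) \<and> cmod (m i \<omega>) \<le> t} = w * (T s - T t)"
proof -
  note [measurable] = x_measurable
  have "prob {\<omega> \<in> space M. m i \<omega> \<in> {z. s < cmod z \<and> cmod z \<le> t}}
      = w * N.prob {\<omega> \<in> space N. x \<omega> \<in> {z. s < cmod z \<and> cmod z \<le> t}}"
    by (rule prob_entry[OF i]) (use st in auto)
  moreover have "N.prob {\<omega> \<in> space N. s < cmod (x \<omega>) \<and> cmod (x \<omega>) \<le> t} = T s - T t"
    unfolding T_def using st
    by (subst N.finite_measure_Diff[symmetric]) (auto intro!: arg_cong[where f = N.prob])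
  ultimately show ?thesis by simp
qed

lemma prob_two_entries:
  assumes ij: "i \<in> I" "j \<in> I" "i \<noteq> j" and A: "A \<in> sets borel" "B \<in> sets borel"
  shows "prob {\<omega> \<in> space M. m i \<omega> \<in> A \<and> m j \<omega> \<in> B}
    = prob {\<omega> \<in> space M. m i \<omega> \<in> A} * prob {\<omega> \<in> space M. m j \<omega> \<in> B}"
proof -
  have "prob (\<Inter>k\<in>{i, j}. m k -` (if k = i then A else B) \<inter> space M)
      = (\<Prod>k\<in>{i, j}. prob (m k -` (if k = i then A else B) \<inter> space M))"
    by (rule indep_varsD[OF indep]) (use ij A in auto)
  moreover have "(\<Inter>k\<in>{i, j}. m k -` (if k = i then A else B) \<inter> space M) = {\<omega> \<in> space M. m i \<omega> \<in> A \<and> m j \<omega> \<in> B}"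
    using ij by auto
  moreover have "m k -` C \<inter> space M = {\<omega> \<in> space M. m k \<omega> \<in> C}" for k C by auto
  ultimately show ?thesis using ij by simp
qed

lemma prob_exists_large:
  assumes "0 \<le> t"
  shows "{\<omega> \<in> space M. \<exists>i\<in>I. t < cmod (m i \<omega>)} \<in> events"
    and "prob {\<omega> \<in> space M. \<exists>i\<in>I. t < cmod (m i \<omega>)} \<le> real (card I) * (w * T t)"
proof -
  have ev: "{\<omega> \<in> space M. t < cmod (m i \<omega>)} \<in> events" if "i \<in> I" for i
    using entry_measurable[OF that] by measurable
  have eq: "{\<omega> \<in> space M. \<exists>i\<in>I. t < cmod (m i \<omega>)} = (\<Union>i\<in>I. {\<omega> \<in> space M. t < cmod (m i \<omega>)})" by auto
  show "{\<omega> \<in> space M. \<exists>i\<in>I. t < cmod (m i \<omega>)} \<in> events"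
    unfolding eq using ev finite_I by auto
  have "prob {\<omega> \<in> space M. \<exists>i\<in>I. t < cmod (m i \<omega>)} \<le> (\<Sum>i\<in>I. prob {\<omega> \<in> space M. t < cmod (m i \<omega>)})"
    unfolding eq using ev finite_I by (intro finite_measure_subadditive_finite) auto
  also have "\<dots> = real (card I) * (w * T t)" using assms by (simp add: prob_entry_gt)
  finally show "prob {\<omega> \<in> space M. \<exists>i\<in>I. t < cmod (m i \<omega>)} \<le> real (card I) * (w * T t)" .
qed

text \<open>The relation \<open>R\<close> will be the pairs of positions on a common row or column.\<close>

lemma prob_two_large:
  assumes "0 \<le> t" and R: "finite R" "R \<subseteq> {(i, j). i \<in> I \<and> j \<in> I \<and> i \<noteq> j}"
  shows "{\<omega> \<in> space M. \<exists>(i, j)\<in>R. t < cmod (m i \<omega>) \<and> t < cmod (m j \<omega>)} \<in> events"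
    and "prob {\<omega> \<in> space M. \<exists>(i, j)\<in>R. t < cmod (m i \<omega>) \<and> t < cmod (m j \<omega>)} \<le> real (card R) * (w * T t)\<^sup>2"
proof -
  define E where "E e = {\<omega> \<in> space M. t < cmod (m (fst e) \<omega>) \<and> t < cmod (m (snd e) \<omega>)}" for e
  have ev: "E e \<in> events" and pr: "prob (E e) = (w * T t)\<^sup>2" if e: "e \<in> R" for e
  proof -
    obtain i j where ij: "e = (i, j)" "i \<in> I" "j \<in> I" "i \<noteq> j" using R e by auto
    note [measurable] = entry_measurable[OF ij(2)] entry_measurable[OF ij(3)]
    show "E e \<in> events" unfolding E_def ij fst_conv snd_conv by measurable
    have "prob {\<omega> \<in> space M. m i \<omega> \<in> {z. t < cmod z} \<and> m j \<omega> \<in> {z. t < cmod z}}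
      = prob {\<omega> \<in> space M. m i \<omega> \<in> {z. t < cmod z}} * prob {\<omega> \<in> space M. m j \<omega> \<in> {z. t < cmod z}}"
      by (rule prob_two_entries[OF ij(2-4)]) auto
    then show "prob (E e) = (w * T t)\<^sup>2"
      using assms(1) ij by (simp add: E_def prob_entry_gt power2_eq_square)
  qed
  have eq: "{\<omega> \<in> space M. \<exists>(i, j)\<in>R. t < cmod (m i \<omega>) \<and> t < cmod (m j \<omega>)} = (\<Union>e\<in>R. E e)"
    by (auto simp: E_def split_beta)
  show "{\<omega> \<in> space M. \<exists>(i, j)\<in>R. t < cmod (m i \<omega>) \<and> t < cmod (m j \<omega>)} \<in> events"
    unfolding eq using ev R by auto
  have "prob (\<Union>e\<in>R. E e) \<le> (\<Sum>e\<in>R. prob (E e))"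
    using ev R by (intro finite_measure_subadditive_finite) auto
  also have "\<dots> = real (card R) * (w * T t)\<^sup>2" using pr by simp
  finally show "prob {\<omega> \<in> space M. \<exists>(i, j)\<in>R. t < cmod (m i \<omega>) \<and> t < cmod (m j \<omega>)} \<le> real (card R) * (w * T t)\<^sup>2"
    unfolding eq .
qed

text \<open>Markov's inequality for the product of independent factors 1/2 (entry above \<open>t\<close>) and 1 (otherwise).\<close>

lemma prob_few_large:
  assumes t: "0 \<le> t"
  shows "{\<omega> \<in> space M. card {i \<in> I. t < cmod (m i \<omega>)} < l} \<in> events"
    and "prob {\<omega> \<in> space M. card {i \<in> I. t < cmod (m i \<omega>)} < l} \<le> 2 ^ l * exp (- (real (card I) * (w * T t) / 2))"
proof -
  define X where "X i \<omega> = (if t < cmod (m i \<omega>) then 1 / 2 else 1 :: real)" for i \<omega>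
  define S where "S \<omega> = (\<Prod>i\<in>I. X i \<omega>)" for \<omega>
  have S: "S \<omega> = (1 / 2) ^ card {i \<in> I. t < cmod (m i \<omega>)}" for \<omega>
    using finite_I by (simp add: S_def X_def prod.If_cases Int_def)
  have S_meas: "S \<in> borel_measurable M"
    unfolding S_def X_def using entry_measurable by measurable
  have set_eq: "{\<omega> \<in> space M. card {i \<in> I. t < cmod (m i \<omega>)} < l} = {\<omega> \<in> space M. (1 / 2) ^ l < S \<omega>}"
    unfolding S by (auto simp: power_strict_decreasing_iff)
  show "{\<omega> \<in> space M. card {i \<in> I. t < cmod (m i \<omega>)} < l} \<in> events"
    unfolding set_eq using S_meas by measurable
  have indX: "indep_vars (\<lambda>_. borel) X I"
    unfolding X_def by (rule indep_vars_compose2[OF indep]) measurable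
  have Xb: "0 \<le> X i \<omega>" "X i \<omega> \<le> 1" for i \<omega> by (auto simp: X_def)
  have Xm: "X i \<in> borel_measurable M" if "i \<in> I" for i
    unfolding X_def using entry_measurable[OF that] by measurable
  have intX: "integrable M (X i)" if "i \<in> I" for i
    by (rule integrable_const_bound[of _ 1]) (use Xb Xm that in auto)
  have EX: "expectation (X i) = 1 - w * T t / 2" if i: "i \<in> I" for i
  proof -
    note [measurable] = entry_measurable[OF i]
    have "expectation (X i) = expectation (\<lambda>\<omega>. 1 - indicat_real {\<omega> \<in> space M. t < cmod (m i \<omega>)} \<omega> / 2)"
      by (intro Bochner_Integration.integral_cong) (auto simp: X_def indicator_def)
    also have "\<dots> = 1 - prob {\<omega> \<in> space M. t < cmod (m i \<omega>)} / 2"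
      by (subst Bochner_Integration.integral_diff) (auto simp: prob_space Int_absorb2 Collect_conj_eq less_top[symmetric])
    finally show ?thesis using prob_entry_gt[OF i t] by simp
  qed
  have intS: "integrable M S" unfolding S_def by (rule indep_vars_integrable[OF finite_I indX intX])
  have ES: "expectation S = (1 - w * T t / 2) ^ card I"
    unfolding S_def by (simp add: indep_vars_lebesgue_integral[OF finite_I indX intX] EX)
  have wT: "0 \<le> w * T t" "w * T t \<le> 1" using w by (auto simp: T_def intro!: mult_le_one)
  have "prob {\<omega> \<in> space M. card {i \<in> I. t < cmod (m i \<omega>)} < l} \<le> prob {\<omega> \<in> space M. S \<omega> \<ge> (1 / 2) ^ l}"
    unfolding set_eq using S_meas by (intro finite_measure_mono) auto
  also have "\<dots> \<le> expectation S / (1 / 2) ^ l"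
  proof -
    have "0 \<le> S \<omega>" for \<omega> by (simp add: S)
    then show ?thesis using intS by (intro integral_Markov_inequality_measure[where A = "{}"]) auto
  qed
  also have "\<dots> = 2 ^ l * (1 - w * T t / 2) ^ card I" by (simp add: ES power_one_over mult.commute)
  also have "\<dots> \<le> 2 ^ l * (exp (- (w * T t / 2))) ^ card I"
    using wT exp_ge_add_one_self[of "- (w * T t / 2)"] by (intro mult_left_mono power_mono) auto
  also have "(exp (- (w * T t / 2))) ^ card I = exp (- (real (card I) * (w * T t) / 2))"
    by (simp flip: exp_of_nat_mult)
  finally show "prob {\<omega> \<in> space M. card {i \<in> I. t < cmod (m i \<omega>)} < l}
      \<le> 2 ^ l * exp (- (real (card I) * (w * T t) / 2))" .
qed

lemma T_antitone: "s \<le> t \<Longrightarrow> T t \<le> T s"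
  unfolding T_def using x_measurable by (intro N.finite_measure_mono) auto

text \<open>The first modulus lies in one of the disjoint intervals \<open>(\<tau> r^k, \<tau> r^(k+1)]\<close>; the second one then lies in
  this or the preceding interval, which has conditional probability at most \<open>\<kappa> w T \<tau>\<close>.\<close>

lemma prob_close_pair:
  assumes ij: "i \<in> I" "j \<in> I" "i \<noteq> j" and \<tau>: "0 < \<tau>" and r: "1 < r" and \<kappa>: "0 \<le> \<kappa>"
    and close: "\<And>t. \<tau> \<le> t \<Longrightarrow> T (t / r\<^sup>2) - T t \<le> \<kappa> * T t"
  shows "{\<omega> \<in> space M. \<tau> < cmod (m i \<omega>) \<and> cmod (m i \<omega>) < r * cmod (m j \<omega>) \<and> cmod (m j \<omega>) \<le> cmod (m i \<omega>)} \<in> events" (is "?E \<in> _")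
    and "prob {\<omega> \<in> space M. \<tau> < cmod (m i \<omega>) \<and> cmod (m i \<omega>) < r * cmod (m j \<omega>) \<and> cmod (m j \<omega>) \<le> cmod (m i \<omega>)} \<le> \<kappa> * (w * T \<tau>)\<^sup>2"
proof -
  note [measurable] = entry_measurable[OF ij(1)] entry_measurable[OF ij(2)]
  show ev: "?E \<in> events" by measurable
  define A where "A k = {\<omega> \<in> space M. \<tau> * r ^ k < cmod (m i \<omega>) \<and> cmod (m i \<omega>) \<le> \<tau> * r ^ Suc k}" for k
  define B where "B k = {\<omega> \<in> space M. \<tau> * r ^ Suc k / r\<^sup>2 < cmod (m j \<omega>) \<and> cmod (m j \<omega>) \<le> \<tau> * r ^ Suc k}" for k
  have [measurable]: "A k \<in> events" "B k \<in> events" for k unfolding A_def B_def by measurable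
  have pw: "1 \<le> r ^ k" for k using r by (simp add: one_le_power)
  have disj: "disjoint_family A"
    unfolding disjoint_family_on_def
  proof (intro ballI impI)
    fix k k' :: nat assume "k \<noteq> k'"
    have *: "A k \<inter> A k' = {}" if "k < k'" for k k'
    proof -
      have "r ^ Suc k \<le> r ^ k'" using that r by (intro power_increasing) auto
      then have "\<tau> * r ^ Suc k \<le> \<tau> * r ^ k'" using \<tau> by simp
      then show ?thesis by (auto simp: A_def)
    qed
    show "A k \<inter> A k' = {}" using *[of k k'] *[of k' k] \<open>k \<noteq> k'\<close> by (cases "k < k'") auto
  qed
  have sub: "?E \<subseteq> (\<Union>k. A k \<inter> B k)"
  proof
    fix \<omega> assume \<omega>: "\<omega> \<in> ?E"
    then obtain k where k: "\<tau> * r ^ k < cmod (m i \<omega>)" "cmod (m i \<omega>) \<le> \<tau> * r ^ Suc k"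
      using geometric_bracket[OF \<tau> r, of "cmod (m i \<omega>)"] by auto
    have "\<tau> * r ^ k < r * cmod (m j \<omega>)" using k \<omega> by auto
    then have "\<tau> * r ^ Suc k / r\<^sup>2 < cmod (m j \<omega>)"
      using r by (simp add: divide_less_eq power2_eq_square mult_ac)
    then show "\<omega> \<in> (\<Union>k. A k \<inter> B k)" using k \<omega> by (intro UN_I[of k]) (auto simp: A_def B_def)
  qed
  have pB: "prob (B k) \<le> \<kappa> * (w * T \<tau>)" for k
  proof -
    define u where "u = \<tau> * r ^ Suc k"
    have u: "\<tau> \<le> u" using pw[of "Suc k"] \<tau> by (simp add: u_def)
    have le: "u / r\<^sup>2 \<le> u"
      using u \<tau> one_le_power[of r 2] r by (simp add: divide_le_eq)
    have "prob (B k) = w * (T (u / r\<^sup>2) - T u)"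
      unfolding B_def u_def[symmetric] by (rule prob_entry_interval[OF ij(2)]) (use u \<tau> le in auto)
    also have "\<dots> \<le> w * (\<kappa> * T \<tau>)"
      using close[OF u] T_antitone[OF u] \<kappa> w by (intro mult_left_mono) (auto intro: order_trans mult_left_mono)
    finally show ?thesis by (simp add: mult_ac)
  qed
  have pAB: "prob (A k \<inter> B k) \<le> prob (A k) * (\<kappa> * (w * T \<tau>))" for k
  proof -
    have "A k \<inter> B k = {\<omega> \<in> space M. m i \<omega> \<in> {z. \<tau> * r ^ k < cmod z \<and> cmod z \<le> \<tau> * r ^ Suc k}
        \<and> m j \<omega> \<in> {z. \<tau> * r ^ Suc k / r\<^sup>2 < cmod z \<and> cmod z \<le> \<tau> * r ^ Suc k}}"
      by (auto simp: A_def B_def)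
    then have "prob (A k \<inter> B k) = prob (A k) * prob (B k)"
      by (simp only:, subst prob_two_entries[OF ij]) (auto simp: A_def B_def)
    then show ?thesis using pB[of k] by (simp add: mult_left_mono)
  qed
  have s1: "(\<lambda>k. prob (A k \<inter> B k)) sums prob (\<Union>k. A k \<inter> B k)"
    by (rule finite_measure_UNION) (use disj in \<open>auto simp: disjoint_family_on_def\<close>)
  have "(\<lambda>k. prob (A k)) sums prob (\<Union>k. A k)"
    by (rule finite_measure_UNION) (use disj in auto)
  then have s2: "(\<lambda>k. prob (A k) * (\<kappa> * (w * T \<tau>))) sums (prob (\<Union>k. A k) * (\<kappa> * (w * T \<tau>)))"
    by (rule sums_mult2)
  have "prob ?E \<le> prob (\<Union>k. A k \<inter> B k)" by (rule finite_measure_mono[OF sub]) auto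
  also have "\<dots> \<le> prob (\<Union>k. A k) * (\<kappa> * (w * T \<tau>))" by (rule sums_le[OF pAB s1 s2])
  also have "\<dots> \<le> prob {\<omega> \<in> space M. \<tau> < cmod (m i \<omega>)} * (\<kappa> * (w * T \<tau>))"
  proof (intro mult_right_mono finite_measure_mono)
    show "(\<Union>k. A k) \<subseteq> {\<omega> \<in> space M. \<tau> < cmod (m i \<omega>)}"
    proof
      fix \<omega> assume "\<omega> \<in> (\<Union>k. A k)"
      then obtain k where k: "\<omega> \<in> A k" by blast
      have "\<tau> * 1 \<le> \<tau> * r ^ k" using pw[of k] \<tau> by (intro mult_left_mono) auto
      then show "\<omega> \<in> {\<omega> \<in> space M. \<tau> < cmod (m i \<omega>)}" using k by (auto simp: A_def)
    qed
  qed (use \<kappa> w in \<open>auto simp: T_def\<close>)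
  also have "\<dots> = \<kappa> * (w * T \<tau>)\<^sup>2" using prob_entry_gt[OF ij(1)] \<tau> by (simp add: power2_eq_square mult_ac)
  finally show "prob ?E \<le> \<kappa> * (w * T \<tau>)\<^sup>2" .
qed

lemma prob_exists_close_pair:
  assumes \<tau>: "0 < \<tau>" and r: "1 < r" and \<kappa>: "0 \<le> \<kappa>"
    and close: "\<And>t. \<tau> \<le> t \<Longrightarrow> T (t / r\<^sup>2) - T t \<le> \<kappa> * T t"
  defines "E \<equiv> {\<omega> \<in> space M. \<exists>i\<in>I. \<exists>j\<in>I. i \<noteq> j \<and> \<tau> < cmod (m i \<omega>) \<and> cmod (m i \<omega>) < r * cmod (m j \<omega>) \<and> cmod (m j \<omega>) \<le> cmod (m i \<omega>)}"
  shows "E \<in> events" and "prob E \<le> \<kappa> * (real (card I) * (w * T \<tau>))\<^sup>2"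
proof -
  define F where "F e = {\<omega> \<in> space M. \<tau> < cmod (m (fst e) \<omega>) \<and> cmod (m (fst e) \<omega>) < r * cmod (m (snd e) \<omega>) \<and> cmod (m (snd e) \<omega>) \<le> cmod (m (fst e) \<omega>)}" for e
  define R where "R = {e \<in> I \<times> I. fst e \<noteq> snd e}"
  have R: "finite R" "card R \<le> card I * card I"
    unfolding R_def using finite_I card_mono[of "I \<times> I" "{e \<in> I \<times> I. fst e \<noteq> snd e}"] by (auto simp: card_cartesian_product)
  have F: "F e \<in> events" "prob (F e) \<le> \<kappa> * (w * T \<tau>)\<^sup>2" if "e \<in> R" for e
    using prob_close_pair[OF _ _ _ \<tau> r \<kappa> close, of "fst e" "snd e"] that by (auto simp: R_def F_def)
  have eq: "E = (\<Union>e\<in>R. F e)" by (auto simp: E_def R_def F_def; blast)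
  show "E \<in> events" unfolding eq using F R by auto
  have "prob E \<le> (\<Sum>e\<in>R. prob (F e))"
    unfolding eq using F R by (intro finite_measure_subadditive_finite) auto
  also have "\<dots> \<le> (\<Sum>e\<in>R. \<kappa> * (w * T \<tau>)\<^sup>2)" by (intro sum_mono F)
  also have "\<dots> = real (card R) * (\<kappa> * (w * T \<tau>)\<^sup>2)" by simp
  also have "\<dots> \<le> real (card I * card I) * (\<kappa> * (w * T \<tau>)\<^sup>2)"
    using R \<kappa> by (intro mult_right_mono of_nat_mono) auto
  finally show "prob E \<le> \<kappa> * (real (card I) * (w * T \<tau>))\<^sup>2" by (simp add: power2_eq_square mult_ac)
qed

end

section \<open>Norm of the truncated matrix\<close>

lemma op_bound_scale:
  assumes "op_bound p n F s"
  shows "op_bound p n (\<lambda>i j. c * F i j) (cmod c * s)"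
  unfolding op_bound_def
proof (intro conjI allI)
  fix x
  have "l2norm p (\<lambda>i. \<Sum>j<n. c * F i j * x j) = cmod c * l2norm p (\<lambda>i. \<Sum>j<n. F i j * x j)"
    by (simp add: l2norm_def L2_set_right_distrib norm_mult sum_distrib_left[symmetric] mult.assoc)
  then show "l2norm p (\<lambda>i. \<Sum>j<n. c * F i j * x j) \<le> cmod c * s * l2norm n x"
    using op_boundD[OF assms, of x] by (simp add: mult.assoc mult_left_mono)
qed (use op_bound_nonneg[OF assms] in simp)

lemma op_bound_const:
  assumes "p \<le> B" "n \<le> B"
  shows "op_bound p n (\<lambda>_ _. c) (cmod c * real B)"
  unfolding op_bound_def
proof (intro conjI allI)
  fix x
  have "cmod (\<Sum>j<n. cnj 1 * x j) \<le> l2norm n (\<lambda>_. 1) * l2norm n x" by (rule l2norm_cauchy_schwarz)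
  then have s: "cmod (\<Sum>j<n. x j) \<le> sqrt (real n) * l2norm n x" by (simp add: l2norm_def L2_set_constant)
  have "l2norm p (\<lambda>i. \<Sum>j<n. c * x j) = sqrt (real p) * (cmod c * cmod (\<Sum>j<n. x j))"
    by (simp add: l2norm_def L2_set_constant norm_mult sum_distrib_left[symmetric])
  also have "\<dots> \<le> sqrt (real B) * (cmod c * (sqrt (real B) * l2norm n x))"
    using s assms by (intro mult_mono mult_left_mono order_trans[OF s] mult_right_mono) auto
  also have "\<dots> = (sqrt (real B) * sqrt (real B)) * cmod c * l2norm n x" by (simp only: mult_ac)
  finally show "l2norm p (\<lambda>i. \<Sum>j<n. c * x j) \<le> cmod c * real B * l2norm n x"
    by (simp add: mult_ac)
qed simp

text \<open>With \<open>|z| \<le> K\<close> and \<open>s \<le> k\<close> one has \<open>(|z| / K)^k \<le> (|z| / K)^s\<close>, so after division by \<open>K\<close> the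
  truncated entries have all moments of order at least \<open>max 1 s\<close> bounded by \<open>q\<close>. If \<open>s \<le> 1\<close> this covers every order.
  If \<open>1 \<le> s \<le> 2\<close> the first moment has to be removed: the truncated entries are recentered, and since
  \<open>x\<close> is centered their mean \<open>c\<close> is minus the mean of the cut-off part, whence \<open>|c| \<le> K q\<close>. The matrix
  with constant entry \<open>c\<close> has norm at most \<open>K B q\<close>, the second summand in the bound.\<close>

lemma truncated_matrix_norm_tail:
  fixes m :: "nat \<times> nat \<Rightarrow> 'a \<Rightarrow> complex" and x :: "'b \<Rightarrow> complex"
  assumes me: "masked_entries M N x w (positions p n) m" and K: "0 < K" and s: "0 < s"
    and int: "integrable N (\<lambda>\<omega>. cmod (x \<omega>) powr s)"
    and cases: "s \<le> 1 \<or> (1 \<le> s \<and> s \<le> 2 \<and> prob_space.expectation N x = 0)"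
    and B: "p \<le> B" "n \<le> B" and t: "0 < t"
  defines "q \<equiv> w * K powr - s * (\<integral>\<omega>. cmod (x \<omega>) powr s \<partial>N)"
  obtains E where "E \<in> sets M" "measure M E \<le> real p * ((real B * q + real (4 * 2 ^ j)) / t) ^ (4 * 2 ^ j)"
    "\<And>\<omega>. \<omega> \<in> space M \<Longrightarrow> \<omega> \<notin> E \<Longrightarrow>
       op_bound p n (\<lambda>i j. if cmod (m (i, j) \<omega>) \<le> K then m (i, j) \<omega> else 0) (K * (2 * t + real B * q))"
proof -
  note found = that
  interpret masked_entries M N x w "positions p n" m by fact
  note [measurable] = x_measurable
  define g where "g z = (if cmod z \<le> K then z else 0)" for z
  have g0: "g 0 = 0" by (simp add: g_def)
  have g_meas[measurable]: "g \<in> borel_measurable borel" unfolding g_def by measurable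
  have gK: "cmod (g z) \<le> K" for z using K by (simp add: g_def)
  define \<phi> where "\<phi> z = (cmod z / K) powr s" for z :: complex
  have \<phi>0: "\<phi> 0 = 0" by (simp add: \<phi>_def)
  have \<phi>_meas[measurable]: "\<phi> \<in> borel_measurable borel" unfolding \<phi>_def by measurable
  have \<phi>_eq: "\<phi> z = K powr - s * cmod z powr s" for z using K by (simp add: \<phi>_def powr_divide powr_minus_divide)
  have \<phi>_int: "integrable N (\<lambda>\<omega>. \<phi> (x \<omega>))" unfolding \<phi>_eq using int by simp
  have E\<phi>N: "w * (\<integral>\<omega>. \<phi> (x \<omega>) \<partial>N) = q" unfolding \<phi>_eq q_def by simp
  have E\<phi>: "expectation (\<lambda>\<omega>. \<phi> (m e \<omega>)) = q" "integrable M (\<lambda>\<omega>. \<phi> (m e \<omega>))" if "e \<in> positions p n" for e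
    using expectation_entry_real[OF that \<phi>_meas \<phi>0 \<phi>_int] E\<phi>N by auto
  have q0: "0 \<le> q" unfolding q_def using w by (intro mult_nonneg_nonneg integral_nonneg) auto
  have rv: "random_variable borel (m e)" if "e \<in> positions p n" for e by (rule entry_measurable[OF that])
  \<comment> \<open>a bounded transform of the entries whose mixed moments are at most q has small norm\<close>
  have main: thesis
    if h: "h \<in> borel_measurable borel" "\<And>z. cmod (h z) \<le> 1"
      and mom: "\<And>e a b. e \<in> positions p n \<Longrightarrow> a + b \<ge> 1 \<Longrightarrow> cmod (expectation (\<lambda>\<omega>. h (m e \<omega>) ^ a * cnj (h (m e \<omega>)) ^ b)) \<le> q"
      and dec: "\<And>F. op_bound p n (\<lambda>i j. h (F i j)) t \<Longrightarrow> op_bound p n (\<lambda>i j. g (F i j)) (K * (2 * t + real B * q))"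
    for h :: "complex \<Rightarrow> complex"
  proof -
    have ind: "indep_vars (\<lambda>_. borel) (\<lambda>e \<omega>. h (m e \<omega>)) (positions p n)"
      by (rule indep_vars_compose2[OF indep]) (rule h(1))
    obtain E where E: "E \<in> events" "prob E \<le> real p * ((real B * q + real (4 * 2 ^ j)) / t) ^ (4 * 2 ^ j)"
      "\<And>\<omega>. \<omega> \<in> space M \<Longrightarrow> \<omega> \<notin> E \<Longrightarrow> op_bound p n (\<lambda>i j. h (m (i, j) \<omega>)) t"
      by (rule random_matrix_norm_tail[OF ind h(2) q0 B mom t, of j]) blast+
    show thesis
    proof (rule found[OF E(1,2)])
      fix \<omega> assume "\<omega> \<in> space M" "\<omega> \<notin> E"
      from dec[OF E(3)[OF this]]
      show "op_bound p n (\<lambda>i j. if cmod (m (i, j) \<omega>) \<le> K then m (i, j) \<omega> else 0) (K * (2 * t + real B * q))"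
        by (simp add: g_def)
    qed
  qed
  have low: "(cmod (g z) / K) ^ k \<le> \<phi> z" if "1 \<le> k" "s \<le> real k" for z k
  proof (cases "cmod z \<le> K")
    case True
    define u where "u = cmod z / K"
    have u: "0 \<le> u" "u \<le> 1" using True K by (auto simp: u_def)
    have "u ^ k \<le> u powr s"
    proof (cases "u = 0")
      case False
      then have "u ^ k = u powr real k" using u by (simp add: powr_realpow)
      also have "\<dots> \<le> u powr s" using that u by (intro powr_mono') auto
      finally show ?thesis .
    qed (use that s in \<open>auto simp: power_0_left\<close>)
    then show ?thesis using True by (simp add: g_def \<phi>_def u_def)
  next
    case False
    then show ?thesis using that by (simp add: g_def \<phi>_def power_0_left)
  qed
  from cases show thesis
  proof
    assume s1: "s \<le> 1"
    define h where "h z = g z / complex_of_real K" for z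
    have hm: "cmod (h z) = cmod (g z) / K" for z using K by (simp add: h_def norm_divide)
    show thesis
    proof (rule main)
      show h_meas: "h \<in> borel_measurable borel" unfolding h_def by measurable
      show h1: "cmod (h z) \<le> 1" for z using gK[of z] K by (simp add: hm)
      fix e :: "nat \<times> nat" and a b :: nat assume e: "e \<in> positions p n" and ab: "a + b \<ge> 1"
      note [measurable] = rv[OF e] h_meas
      have "cmod (expectation (\<lambda>\<omega>. h (m e \<omega>) ^ a * cnj (h (m e \<omega>)) ^ b))
          \<le> expectation (\<lambda>\<omega>. \<phi> (m e \<omega>))"
      proof (rule order_trans[OF integral_norm_bound], rule integral_mono)
        show "integrable M (\<lambda>\<omega>. cmod (h (m e \<omega>) ^ a * cnj (h (m e \<omega>)) ^ b))"
          by (rule integrable_const_bound[of _ 1])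
             (auto simp: norm_mult norm_power h1 power_le_one mult_le_one)
        fix \<omega>
        have "cmod (h (m e \<omega>) ^ a * cnj (h (m e \<omega>)) ^ b) = (cmod (g (m e \<omega>)) / K) ^ (a + b)"
          by (simp add: norm_mult norm_power hm power_add)
        also have "\<dots> \<le> \<phi> (m e \<omega>)" by (rule low) (use ab s1 in auto)
        finally show "cmod (h (m e \<omega>) ^ a * cnj (h (m e \<omega>)) ^ b) \<le> \<phi> (m e \<omega>)" .
      qed (rule E\<phi>(2)[OF e])
      then show "cmod (expectation (\<lambda>\<omega>. h (m e \<omega>) ^ a * cnj (h (m e \<omega>)) ^ b)) \<le> q"
        using E\<phi>(1)[OF e] by simp
    next
      fix F assume "op_bound p n (\<lambda>i j. h (F i j)) t"
      from op_bound_scale[OF this, of "complex_of_real K"]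
      have "op_bound p n (\<lambda>i j. g (F i j)) (K * t)" using K by (simp add: h_def)
      then show "op_bound p n (\<lambda>i j. g (F i j)) (K * (2 * t + real B * q))"
        by (rule op_bound_mono) (use K t q0 in \<open>auto intro!: mult_left_mono add_increasing2\<close>)
    qed
  next
    assume "1 \<le> s \<and> s \<le> 2 \<and> N.expectation x = 0"
    then have s1: "1 \<le> s" and s2: "s \<le> 2" and Ex: "N.expectation x = 0" by auto
    define c where "c = complex_of_real w * N.expectation (\<lambda>\<omega>. g (x \<omega>))"
    have gint: "integrable N (\<lambda>\<omega>. g (x \<omega>))"
      by (rule N.integrable_const_bound[of _ K]) (auto simp: gK)
    have Egm: "expectation (\<lambda>\<omega>. g (m e \<omega>)) = c" "integrable M (\<lambda>\<omega>. g (m e \<omega>))" if "e \<in> positions p n" for e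
      using expectation_entry[OF that g_meas g0 gint] integrable_entry[OF that g_meas g0 gint] by (auto simp: c_def)
    have cq: "cmod c \<le> K * q"
    proof -
      have tail: "cmod (z - g z) \<le> K * \<phi> z" for z
      proof (cases "cmod z \<le> K")
        case True
        then show ?thesis using K by (simp add: g_def \<phi>_def)
      next
        case False
        have "1 \<le> cmod z / K" using False K by simp
        then have "(cmod z / K) powr 1 \<le> (cmod z / K) powr s" using s1 by (intro powr_mono) auto
        then show ?thesis using False K by (simp add: g_def \<phi>_def divide_le_eq mult.commute)
      qed
      have xg: "integrable N (\<lambda>\<omega>. x \<omega> - g (x \<omega>))"
      proof (rule Bochner_Integration.integrable_bound)
        show "integrable N (\<lambda>\<omega>. K * \<phi> (x \<omega>))" using \<phi>_int by simp
        show "AE \<omega> in N. norm (x \<omega> - g (x \<omega>)) \<le> norm (K * \<phi> (x \<omega>))"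
          by (rule AE_I2) (use tail in \<open>auto intro: order_trans[OF _ abs_ge_self]\<close>)
      qed measurable
      have "N.expectation (\<lambda>\<omega>. (x \<omega> - g (x \<omega>)) + g (x \<omega>)) = N.expectation (\<lambda>\<omega>. x \<omega> - g (x \<omega>)) + N.expectation (\<lambda>\<omega>. g (x \<omega>))"
        by (rule Bochner_Integration.integral_add[OF xg gint])
      then have "N.expectation (\<lambda>\<omega>. g (x \<omega>)) = - N.expectation (\<lambda>\<omega>. x \<omega> - g (x \<omega>))"
        using Ex by (simp add: eq_neg_iff_add_eq_0 add.commute)
      then have "cmod (N.expectation (\<lambda>\<omega>. g (x \<omega>))) \<le> N.expectation (\<lambda>\<omega>. cmod (x \<omega> - g (x \<omega>)))"
        using integral_norm_bound[of N "\<lambda>\<omega>. x \<omega> - g (x \<omega>)"] by simp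
      also have "\<dots> \<le> N.expectation (\<lambda>\<omega>. K * \<phi> (x \<omega>))"
        by (rule integral_mono) (use xg \<phi>_int tail in auto)
      also have "\<dots> = K * N.expectation (\<lambda>\<omega>. \<phi> (x \<omega>))" by simp
      finally have "w * cmod (N.expectation (\<lambda>\<omega>. g (x \<omega>))) \<le> w * (K * N.expectation (\<lambda>\<omega>. \<phi> (x \<omega>)))"
        using w by (intro mult_left_mono) auto
      also have "\<dots> = K * q" unfolding E\<phi>N[symmetric] by (simp add: mult_ac)
      finally show ?thesis using w by (simp add: c_def norm_mult)
    qed
    have cK: "cmod c \<le> K"
    proof -
      have "cmod (N.expectation (\<lambda>\<omega>. g (x \<omega>))) \<le> N.expectation (\<lambda>\<omega>. cmod (g (x \<omega>)))" by (rule integral_norm_bound)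
      also have "\<dots> \<le> N.expectation (\<lambda>\<omega>. K)" by (rule integral_mono) (use gint gK in auto)
      also have "\<dots> = K" by (simp add: N.prob_space)
      finally have "w * cmod (N.expectation (\<lambda>\<omega>. g (x \<omega>))) \<le> 1 * K" using w by (intro mult_mono) auto
      then show ?thesis using w by (simp add: c_def norm_mult)
    qed
    define h where "h z = (g z - c) / complex_of_real (2 * K)" for z
    have hm: "cmod (h z) = cmod (g z - c) / (2 * K)" for z using K by (simp add: h_def norm_divide norm_mult)
    show thesis
    proof (rule main)
      show h_meas: "h \<in> borel_measurable borel" unfolding h_def by measurable
      show h1: "cmod (h z) \<le> 1" for z
        using gK[of z] cK K norm_triangle_ineq4[of "g z" c] by (simp add: hm)
      fix e :: "nat \<times> nat" and a b :: nat assume e: "e \<in> positions p n" and ab: "a + b \<ge> 1"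
      note [measurable] = rv[OF e] h_meas
      have Eh: "expectation (\<lambda>\<omega>. h (m e \<omega>)) = 0"
        unfolding h_def using Egm[OF e] by (simp add: prob_space)
      consider "a = 1" "b = 0" | "a = 0" "b = 1" | "2 \<le> a + b" using ab by linarith
      then show "cmod (expectation (\<lambda>\<omega>. h (m e \<omega>) ^ a * cnj (h (m e \<omega>)) ^ b)) \<le> q"
      proof cases
        case 3
        have "cmod (expectation (\<lambda>\<omega>. h (m e \<omega>) ^ a * cnj (h (m e \<omega>)) ^ b))
            \<le> expectation (\<lambda>\<omega>. (\<phi> (m e \<omega>) + q) / 2)"
        proof (rule order_trans[OF integral_norm_bound], rule integral_mono)
          show "integrable M (\<lambda>\<omega>. cmod (h (m e \<omega>) ^ a * cnj (h (m e \<omega>)) ^ b))"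
            by (rule integrable_const_bound[of _ 1])
               (auto simp: norm_mult norm_power h1 power_le_one mult_le_one)
          show "integrable M (\<lambda>\<omega>. (\<phi> (m e \<omega>) + q) / 2)" using E\<phi>(2)[OF e] by simp
          fix \<omega>
          define z where "z = m e \<omega>"
          have "cmod (h z ^ a * cnj (h z) ^ b) = cmod (h z) ^ (a + b)"
            by (simp add: norm_mult norm_power power_add)
          also have "\<dots> \<le> (cmod (h z))\<^sup>2" by (rule power_decreasing[OF 3]) (auto simp: h1)
          also have "\<dots> = (cmod (g z - c))\<^sup>2 / (4 * K\<^sup>2)" by (simp add: hm power_divide power_mult_distrib)
          also have "\<dots> \<le> (2 * (cmod (g z))\<^sup>2 + 2 * (cmod c)\<^sup>2) / (4 * K\<^sup>2)"
          proof (rule divide_right_mono)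
            have "(cmod (g z - c))\<^sup>2 \<le> (cmod (g z) + cmod c)\<^sup>2"
              by (intro power_mono norm_triangle_ineq4) auto
            also have "\<dots> \<le> 2 * (cmod (g z))\<^sup>2 + 2 * (cmod c)\<^sup>2"
              using sum_squares_bound[of "cmod (g z)" "cmod c"] by (simp add: power2_sum)
            finally show "(cmod (g z - c))\<^sup>2 \<le> 2 * (cmod (g z))\<^sup>2 + 2 * (cmod c)\<^sup>2" .
          qed simp
          also have "\<dots> = ((cmod (g z) / K)\<^sup>2 + (cmod c / K)\<^sup>2) / 2"
            using K by (simp add: power_divide field_simps)
          also have "\<dots> \<le> (\<phi> z + q) / 2"
          proof -
            have "(cmod (g z) / K)\<^sup>2 \<le> \<phi> z" by (rule low) (use s2 in auto)
            moreover have "(cmod c / K)\<^sup>2 \<le> q"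
            proof -
              have "cmod c / K * (cmod c / K) \<le> 1 * q"
                using cq cK K by (intro mult_mono) (auto simp: divide_le_eq mult.commute)
              then show ?thesis by (simp add: power2_eq_square)
            qed
            ultimately show ?thesis by simp
          qed
          finally show "cmod (h (m e \<omega>) ^ a * cnj (h (m e \<omega>)) ^ b) \<le> (\<phi> (m e \<omega>) + q) / 2" by (simp add: z_def)
        qed
        also have "\<dots> = q" using E\<phi>[OF e] by (simp add: prob_space)
        finally show ?thesis .
      qed (use Eh q0 in auto)
    next
      fix F assume "op_bound p n (\<lambda>i j. h (F i j)) t"
      from op_bound_add[OF op_bound_scale[OF this, of "complex_of_real (2 * K)"] op_bound_const[OF B, of c]]
      have "op_bound p n (\<lambda>i j. complex_of_real (2 * K) * h (F i j) + c) (cmod (complex_of_real (2 * K)) * t + cmod c * real B)" .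
      moreover have "complex_of_real (2 * K) * h z + c = g z" for z using K by (simp add: h_def)
      ultimately have "op_bound p n (\<lambda>i j. g (F i j)) (cmod (complex_of_real (2 * K)) * t + cmod c * real B)" by simp
      then show "op_bound p n (\<lambda>i j. g (F i j)) (K * (2 * t + real B * q))"
      proof (rule op_bound_mono)
        have "cmod c * real B \<le> K * q * real B" using cq by (intro mult_right_mono) auto
        then show "cmod (complex_of_real (2 * K)) * t + cmod c * real B \<le> K * (2 * t + real B * q)"
          using K by (simp add: norm_mult algebra_simps)
      qed
    qed
  qed
qed

section \<open>Rare events and the choice of exponents\<close>

text \<open>The events have outer measure tending to 0. The covering events may depend on \<open>\<eta>\<close>, which leaves room
  to choose levels and gaps in terms of \<open>\<eta>\<close>.\<close>

definition rare :: "(nat \<Rightarrow> 'a measure) \<Rightarrow> (nat \<Rightarrow> 'a \<Rightarrow> bool) \<Rightarrow> bool" where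
  "rare M P \<longleftrightarrow> (\<forall>\<eta>>0. eventually (\<lambda>n. \<exists>E\<in>sets (M n). measure (M n) E \<le> \<eta> \<and>
      (\<forall>\<omega>\<in>space (M n) - E. \<not> P n \<omega>)) sequentially)"

lemma rare_disj:
  assumes fm: "\<And>n. n \<ge> 1 \<Longrightarrow> prob_space (M n)" and P: "rare M P" and Q: "rare M Q"
  shows "rare M (\<lambda>n \<omega>. P n \<omega> \<or> Q n \<omega>)"
  unfolding rare_def
proof (intro allI impI)
  fix \<eta> :: real assume "0 < \<eta>"
  then have h: "0 < \<eta> / 2" by simp
  from P[unfolded rare_def, rule_format, OF h] Q[unfolded rare_def, rule_format, OF h] eventually_ge_at_top[of 1]
  show "eventually (\<lambda>n. \<exists>E\<in>sets (M n). measure (M n) E \<le> \<eta> \<and>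
      (\<forall>\<omega>\<in>space (M n) - E. \<not> (P n \<omega> \<or> Q n \<omega>))) sequentially"
  proof eventually_elim
    case (elim n)
    interpret prob_space "M n" by (rule fm[OF elim(3)])
    obtain E where E: "E \<in> events" "prob E \<le> \<eta> / 2" "\<forall>\<omega>\<in>space (M n) - E. \<not> P n \<omega>" using elim(1) by blast
    obtain F where F: "F \<in> events" "prob F \<le> \<eta> / 2" "\<forall>\<omega>\<in>space (M n) - F. \<not> Q n \<omega>" using elim(2) by blast
    have "prob (E \<union> F) \<le> prob E + prob F" by (rule measure_Un_le[OF E(1) F(1)])
    then show ?case using E F by (intro bexI[of _ "E \<union> F"]) auto
  qed
qed

lemma rare_mono:
  assumes "rare M P" and "eventually (\<lambda>n. \<forall>\<omega>\<in>space (M n). Q n \<omega> \<longrightarrow> P n \<omega>) sequentially"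
  shows "rare M Q"
  unfolding rare_def
proof (intro allI impI)
  fix \<eta> :: real assume "0 < \<eta>"
  from assms(1)[unfolded rare_def, rule_format, OF this] assms(2)
  show "eventually (\<lambda>n. \<exists>E\<in>sets (M n). measure (M n) E \<le> \<eta> \<and>
      (\<forall>\<omega>\<in>space (M n) - E. \<not> Q n \<omega>)) sequentially"
    by eventually_elim blast
qed

lemma rareI:
  assumes "eventually (\<lambda>n. \<exists>E\<in>sets (M n). measure (M n) E \<le> f n \<and> (\<forall>\<omega>\<in>space (M n) - E. \<not> P n \<omega>)) sequentially"
    and "f \<longlonglongrightarrow> 0"
  shows "rare M P"
  unfolding rare_def
proof (intro allI impI)
  fix \<eta> :: real assume "0 < \<eta>"
  then have "eventually (\<lambda>n. f n < \<eta>) sequentially" using assms(2) by (auto dest: order_tendstoD)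
  with assms(1) show "eventually (\<lambda>n. \<exists>E\<in>sets (M n). measure (M n) E \<le> \<eta> \<and>
      (\<forall>\<omega>\<in>space (M n) - E. \<not> P n \<omega>)) sequentially"
    by eventually_elim (meson less_imp_le order_trans)
qed

lemma tendsto_in_probI:
  assumes fm: "\<And>n. n \<ge> 1 \<Longrightarrow> prob_space (M n)"
    and "\<And>\<epsilon>. 0 < \<epsilon> \<Longrightarrow> rare M (\<lambda>n \<omega>. \<bar>X n \<omega> - c\<bar> > \<epsilon>)"
  shows "tendsto_in_prob M X c"
  unfolding tendsto_in_prob_def
proof (intro allI impI)
  fix \<epsilon> :: real assume "0 < \<epsilon>"
  note r = assms(2)[OF this]
  show "(\<lambda>n. outer_measure_of (M n) {\<omega> \<in> space (M n). \<bar>X n \<omega> - c\<bar> > \<epsilon>}) \<longlonglongrightarrow> 0"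
  proof (rule order_tendstoI)
    fix a :: ennreal assume "0 < a"
    obtain \<eta> :: real where \<eta>: "0 < \<eta>" "ennreal \<eta> < a"
    proof (cases a)
      case (real r)
      then have "0 < r" using \<open>0 < a\<close> by (simp add: less_le)
      then show ?thesis using real that[of "r / 2"] by (simp add: ennreal_less_iff)
    next
      case top
      then show ?thesis using that[of 1] by simp
    qed
    from r[unfolded rare_def, rule_format, OF \<eta>(1)] eventually_ge_at_top[of 1]
    show "eventually (\<lambda>n. outer_measure_of (M n) {\<omega> \<in> space (M n). \<bar>X n \<omega> - c\<bar> > \<epsilon>} < a) sequentially"
    proof eventually_elim
      case (elim n)
      interpret prob_space "M n" by (rule fm[OF elim(2)])
      obtain E where E: "E \<in> events" "prob E \<le> \<eta>" "\<forall>\<omega>\<in>space (M n) - E. \<not> \<bar>X n \<omega> - c\<bar> > \<epsilon>"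
        using elim(1) by blast
      have "{\<omega> \<in> space (M n). \<bar>X n \<omega> - c\<bar> > \<epsilon>} \<subseteq> E" using E(3) by blast
      then have "outer_measure_of (M n) {\<omega> \<in> space (M n). \<bar>X n \<omega> - c\<bar> > \<epsilon>} \<le> outer_measure_of (M n) E"
        by (rule outer_measure_of_mono)
      also have "\<dots> = ennreal (prob E)" using E(1) by (simp add: emeasure_eq_measure)
      also have "\<dots> \<le> ennreal \<eta>" using E(2) by (rule ennreal_leI)
      finally show ?case using \<eta>(2) by simp
    qed
  qed simp
qed

lemma tendsto_powr_neg_nat: "0 < c \<Longrightarrow> (\<lambda>n. real n powr - c) \<longlonglongrightarrow> 0"
  by (rule tendsto_neg_powr[OF _ filterlim_real_sequentially]) simp

lemma filterlim_powr_nat: "0 < c \<Longrightarrow> filterlim (\<lambda>n. real n powr c) at_top sequentially"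
proof -
  assume c: "0 < c"
  have "filterlim (\<lambda>n. inverse (real n powr - c)) at_top sequentially"
    by (rule filterlim_inverse_at_top[OF tendsto_powr_neg_nat[OF c]])
       (use eventually_gt_at_top[of 0] in \<open>auto elim: eventually_mono\<close>)
  then show ?thesis by (simp add: powr_minus)
qed

lemma ranks_entries_large:
  assumes r: "ranks_entries p n m r" and card: "l \<le> card {q \<in> positions p n. v < cmod (m q)}" and l: "1 \<le> l"
  shows "l \<le> p * n" "v < cmod (m (r l))"
proof -
  have fin: "finite (positions p n)" by (simp add: positions_def)
  have "card {q \<in> positions p n. v < cmod (m q)} \<le> card (positions p n)" using fin by (intro card_mono) auto
  then show ln: "l \<le> p * n" using card by (simp add: positions_def card_cartesian_product)
  show "v < cmod (m (r l))"
  proof (rule ccontr)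
    assume small: "\<not> v < cmod (m (r l))"
    have "{q \<in> positions p n. v < cmod (m q)} \<subseteq> r ` {1..<l}"
    proof
      fix q assume q: "q \<in> {q \<in> positions p n. v < cmod (m q)}"
      then have "q \<in> r ` {1..p * n}" using r by (auto simp: ranks_entries_def bij_betw_def)
      then obtain k where k: "1 \<le> k" "k \<le> p * n" "q = r k" by auto
      have "k < l"
      proof (rule ccontr)
        assume "\<not> k < l"
        then have "cmod (m (r k)) \<le> cmod (m (r l))" using r k l by (auto simp: ranks_entries_def)
        then show False using q k small by auto
      qed
      then show "q \<in> r ` {1..<l}" using k by auto
    qed
    then have "card {q \<in> positions p n. v < cmod (m q)} \<le> card (r ` {1..<l})" by (rule card_mono[rotated]) simp
    also have "\<dots> \<le> card {1..<l}" by (rule card_image_le) simp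
    finally have "card {q \<in> positions p n. v < cmod (m q)} \<le> card {1..<l}" .
    then show False using card l by simp
  qed
qed

lemma card_same_line_pairs:
  "card {(q, q'). q \<in> positions p n \<and> q' \<in> positions p n \<and> q \<noteq> q' \<and> (fst q = fst q' \<or> snd q = snd q')} \<le> p * n * (n + p)"
  "finite {(q, q'). q \<in> positions p n \<and> q' \<in> positions p n \<and> q \<noteq> q' \<and> (fst q = fst q' \<or> snd q = snd q')}"
proof -
  let ?R = "{(q, q'). q \<in> positions p n \<and> q' \<in> positions p n \<and> q \<noteq> q' \<and> (fst q = fst q' \<or> snd q = snd q')}"
  let ?P = "positions p n"
  let ?A = "(\<lambda>(q, j). (q, (fst q, j))) ` (?P \<times> {..<n})" and ?B = "(\<lambda>(q, i). (q, (i, snd q))) ` (?P \<times> {..<p})"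
  have fin: "finite ?A" "finite ?B" by (auto simp: positions_def)
  have sub: "?R \<subseteq> ?A \<union> ?B"
  proof
    fix e assume "e \<in> ?R"
    then obtain q q' where e: "e = (q, q')" "q \<in> ?P" "q' \<in> ?P" "fst q = fst q' \<or> snd q = snd q'" by auto
    then have "snd q' < n" "fst q' < p" by (auto simp: positions_def)
    from e(4) show "e \<in> ?A \<union> ?B"
    proof
      assume "fst q = fst q'"
      then have "e = (\<lambda>(q, j). (q, (fst q, j))) (q, snd q')" using e(1) by (simp add: prod_eq_iff)
      then show ?thesis using e(2) \<open>snd q' < n\<close> by blast
    next
      assume "snd q = snd q'"
      then have "e = (\<lambda>(q, i). (q, (i, snd q))) (q, fst q')" using e(1) by (simp add: prod_eq_iff)
      then show ?thesis using e(2) \<open>fst q' < p\<close> by blast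
    qed
  qed
  show "finite ?R" using sub fin by (meson finite_UnI finite_subset)
  have "card ?R \<le> card (?A \<union> ?B)" using sub fin by (intro card_mono) auto
  also have "\<dots> \<le> card ?A + card ?B" by (rule card_Un_le)
  also have "\<dots> \<le> card (?P \<times> {..<n}) + card (?P \<times> {..<p})"
    by (intro add_mono card_image_le) (auto simp: positions_def)
  also have "\<dots> = p * n * (n + p)" by (simp add: positions_def card_cartesian_product algebra_simps)
  finally show "card ?R \<le> p * n * (n + p)" .
qed

text \<open>The largest entries have size about \<open>n^\<beta>\<close>. The truncation level is \<open>n^(\<beta> - 8 \<epsilon>)\<close>, and \<open>\<theta>\<close> is the slack in
  the Potter bounds. In order, the inequalities say that truncated norms stay near the truncation
  level, that entries above this level do not share a row or column, and that the \<open>l\<close> largest moduli lie between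
  \<open>n^(\<beta> - \<epsilon>)\<close> and \<open>n^(\<beta> + \<epsilon>)\<close>.\<close>

lemma choose_exponents:
  fixes \<alpha> \<mu> s :: real
  assumes \<alpha>: "0 < \<alpha>" and \<mu>: "0 \<le> \<mu>" and s: "0 < s" "\<mu> * \<alpha> < s * (1 + \<mu>)"
  defines "\<beta> \<equiv> (1 + \<mu>) / \<alpha>"
  obtains \<epsilon> \<theta> where "0 < \<epsilon>" "0 < \<theta>" "\<theta> < \<alpha>" "8 * \<epsilon> < \<beta>" "\<mu> \<le> s * (\<beta> - 8 * \<epsilon>)"
    "\<mu> + 1 / 2 < (\<beta> - 8 * \<epsilon>) * (\<alpha> - \<theta>)" "1 + \<mu> < (\<beta> + \<epsilon>) * (\<alpha> - \<theta>)" "(\<beta> - \<epsilon>) * (\<alpha> + \<theta>) < 1 + \<mu>"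
proof -
  have \<beta>: "0 < \<beta>" "\<beta> * \<alpha> = 1 + \<mu>" using \<alpha> \<mu> by (auto simp: \<beta>_def)
  have sb: "\<mu> < s * \<beta>" using s \<alpha> by (simp add: \<beta>_def less_divide_eq)
  (* the three bounds serve the positivity of the truncation exponent, the moment condition, and 8 \<epsilon> \<alpha> \<le> 1/4,
     half of the room that remains for the pairs on a common line *)
  define \<epsilon> where "\<epsilon> = min (\<beta> / 16) (min ((s * \<beta> - \<mu>) / (8 * s)) (1 / (32 * \<alpha>)))"
  have \<epsilon>: "0 < \<epsilon>" "\<epsilon> \<le> \<beta> / 16" "\<epsilon> \<le> (s * \<beta> - \<mu>) / (8 * s)" "\<epsilon> \<le> 1 / (32 * \<alpha>)"
    using \<alpha> \<beta> s sb by (auto simp: \<epsilon>_def)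
  define \<theta> where "\<theta> = min (\<alpha> / 2) (min (\<epsilon> * \<alpha> / (2 * (\<beta> + \<epsilon>))) (1 / (8 * \<beta>)))"
  have \<theta>: "0 < \<theta>" "\<theta> \<le> \<alpha> / 2" "\<theta> \<le> \<epsilon> * \<alpha> / (2 * (\<beta> + \<epsilon>))" "\<theta> \<le> 1 / (8 * \<beta>)"
  proof -
    show "0 < \<theta>" using \<alpha> \<beta> \<epsilon> by (simp add: \<theta>_def)
    show "\<theta> \<le> \<alpha> / 2" "\<theta> \<le> \<epsilon> * \<alpha> / (2 * (\<beta> + \<epsilon>))" "\<theta> \<le> 1 / (8 * \<beta>)"
      unfolding \<theta>_def by (simp_all only: min_le_iff_disj order_refl simp_thms)
  qed
  have e1: "\<epsilon> * (8 * s) \<le> s * \<beta> - \<mu>" using \<epsilon>(3) s by (simp add: le_divide_eq)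
  have e2: "\<epsilon> * (32 * \<alpha>) \<le> 1" using \<epsilon>(4) \<alpha> by (simp add: le_divide_eq)
  have t1: "\<theta> * (2 * (\<beta> + \<epsilon>)) \<le> \<epsilon> * \<alpha>" using \<theta>(3) \<beta> \<epsilon> by (simp add: le_divide_eq)
  have t2: "\<theta> * (8 * \<beta>) \<le> 1" using \<theta>(4) \<beta> by (simp add: le_divide_eq)
  have pos: "0 < \<epsilon> * \<alpha>" "0 < \<theta> * \<epsilon>" "0 < \<theta> * \<beta>" using \<epsilon> \<alpha> \<theta> \<beta> by auto
  show ?thesis
  proof
    show "0 < \<epsilon>" "0 < \<theta>" "\<theta> < \<alpha>" "8 * \<epsilon> < \<beta>" using \<epsilon> \<theta> \<alpha> \<beta> by linarith+
    show "\<mu> \<le> s * (\<beta> - 8 * \<epsilon>)" using e1 by (simp add: algebra_simps)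
    show "\<mu> + 1 / 2 < (\<beta> - 8 * \<epsilon>) * (\<alpha> - \<theta>)" using \<beta> e2 t2 pos by (simp add: algebra_simps)
    show "1 + \<mu> < (\<beta> + \<epsilon>) * (\<alpha> - \<theta>)" using \<beta> t1 pos by (simp add: algebra_simps)
    show "(\<beta> - \<epsilon>) * (\<alpha> + \<theta>) < 1 + \<mu>" using \<beta> t1 pos by (simp add: algebra_simps)
  qed
qed

text \<open>This is where the assumption on \<open>\<alpha>\<close> and \<open>\<mu>\<close> acts. A finite moment of order \<open>s\<close> controls the truncated norm if
  \<open>\<mu> \<alpha> < s (1 + \<mu>)\<close>. Orders \<open>s \<le> 1\<close> suffice if \<open>\<alpha> < 1 + 1 / \<mu>\<close>; orders up to 2, which require
  centering, suffice if \<open>\<alpha> < 2 (1 + 1 / \<mu>)\<close>. In the second case \<open>\<alpha> \<ge> 2\<close> because \<open>\<mu> \<le> 1\<close>, so such moments are finite.\<close>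

lemma choose_moment:
  fixes \<alpha> \<mu> :: real
  assumes \<alpha>: "0 < \<alpha>" and \<mu>: "0 \<le> \<mu>" "\<mu> \<le> 1" and lt: "ereal \<alpha> < 2 * (1 + inverse (ereal \<mu>))"
    and C: "1 + inverse (ereal \<mu>) \<le> ereal \<alpha> \<Longrightarrow> C"
  obtains s where "0 < s" "s < \<alpha>" "\<mu> * \<alpha> < s * (1 + \<mu>)" "s \<le> 1 \<or> (1 \<le> s \<and> s \<le> 2 \<and> C)"
proof (cases "\<mu> = 0 \<or> \<alpha> < 1 + 1 / \<mu>")
  case True
  have "\<mu> * \<alpha> < 1 + \<mu>"
    using True \<mu> by (cases "\<mu> = 0") (auto simp: field_simps)
  then have "\<mu> * \<alpha> / (1 + \<mu>) < min 1 \<alpha>" using \<mu> \<alpha> by (simp add: divide_less_eq algebra_simps)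
  then obtain s where s: "\<mu> * \<alpha> / (1 + \<mu>) < s" "s < min 1 \<alpha>" using dense by blast
  have "0 \<le> \<mu> * \<alpha> / (1 + \<mu>)" using \<mu> \<alpha> by simp
  then have "0 < s" using s by linarith
  moreover have "\<mu> * \<alpha> < s * (1 + \<mu>)" using s \<mu> by (simp add: divide_less_eq)
  ultimately show ?thesis using that[of s] s by simp
next
  case False
  then have \<mu>0: "0 < \<mu>" and ge: "1 + 1 / \<mu> \<le> \<alpha>" using \<mu> by auto
  have inv: "1 + inverse (ereal \<mu>) = ereal (1 + 1 / \<mu>)" using \<mu>0 by (simp add: inverse_eq_divide one_ereal_def)
  have C by (rule C) (use inv ge in simp)
  have "ereal \<alpha> < ereal (2 * (1 + 1 / \<mu>))" using lt unfolding inv by (metis numeral_eq_ereal times_ereal.simps(1))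
  then have "\<alpha> < 2 * (1 + 1 / \<mu>)" by simp
  then have up: "\<mu> * \<alpha> / (1 + \<mu>) < 2" using \<mu>0 by (simp add: divide_less_eq field_simps)
  have lo: "1 \<le> \<mu> * \<alpha> / (1 + \<mu>)" using ge \<mu>0 by (simp add: le_divide_eq field_simps)
  obtain s where s: "\<mu> * \<alpha> / (1 + \<mu>) < s" "s < 2" using dense[OF up] by blast
  have "1 \<le> s" using s(1) lo by linarith
  have "1 \<le> 1 / \<mu>" using \<mu>0 \<mu> by simp
  then have "s < \<alpha>" using s ge by linarith
  moreover have "\<mu> * \<alpha> < s * (1 + \<mu>)" using s \<mu>0 by (simp add: divide_less_eq)
  ultimately show ?thesis using that[of s] s \<open>C\<close> \<open>1 \<le> s\<close> by simp
qed

section \<open>Large entries and truncated norm as n grows\<close>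

text \<open>The hypotheses of the theorem in the form in which they are used: the two random factors of an entry
  are merged into one masked variable, and slow variation of \<open>L\<close> is replaced by regular variation of the tail.\<close>

locale heavy_tailed_ensemble =
  fixes N :: "'b measure" and x :: "'b \<Rightarrow> complex" and \<alpha> \<mu> \<rho> :: real and p :: "nat \<Rightarrow> nat"
    and M :: "nat \<Rightarrow> 'a measure" and m :: "nat \<Rightarrow> nat \<times> nat \<Rightarrow> 'a \<Rightarrow> complex"
  assumes entries: "\<And>n. n \<ge> 1 \<Longrightarrow> masked_entries (M n) N x (real n powr (\<mu> - 1)) (positions (p n) n) (m n)"
    and tail: "regularly_varying_tail (\<lambda>t. \<P>(\<omega> in N. cmod (x \<omega>) > t)) \<alpha>"
    and \<mu>: "0 \<le> \<mu>" "\<mu> \<le> 1"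
    and ratio: "(\<lambda>n. real (p n) / real n) \<longlonglongrightarrow> \<rho>" and \<rho>: "0 < \<rho>" "\<rho> \<le> 1"
begin

definition T :: "real \<Rightarrow> real" where "T t = \<P>(\<omega> in N. cmod (x \<omega>) > t)"

sublocale rv: regularly_varying_tail T \<alpha>
  using tail by (simp add: T_def[abs_def])

lemma prob_space_M: "n \<ge> 1 \<Longrightarrow> prob_space (M n)"
  using entries by (simp add: masked_entries_def)

lemma eventually_size:
  "eventually (\<lambda>n. 1 \<le> n \<and> real (p n) \<le> 2 * real n \<and> \<rho> / 2 * real n \<le> real (p n)) sequentially"
proof -
  have "eventually (\<lambda>n. real (p n) / real n < 2) sequentially" "eventually (\<lambda>n. \<rho> / 2 < real (p n) / real n) sequentially"
    using \<rho> by (intro order_tendstoD[OF ratio]; simp)+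
  then show ?thesis using eventually_ge_at_top[of 1]
    by eventually_elim (auto simp: divide_less_eq less_divide_eq)
qed

lemma eventually_potter_upper:
  assumes "0 < \<kappa>" "0 < \<theta>" "\<theta> < \<alpha>"
  shows "eventually (\<lambda>n. T (real n powr \<kappa>) \<le> real n powr (- (\<kappa> * (\<alpha> - \<theta>)))) sequentially"
proof -
  have "eventually (\<lambda>t. T t \<le> t powr - (\<alpha> - \<theta>)) at_top" by (rule rv.potter_upper) (use assms in auto)
  from eventually_compose_filterlim[OF this filterlim_powr_nat[OF assms(1)]]
  show ?thesis by (simp add: powr_powr algebra_simps)
qed

lemma eventually_potter_lower:
  assumes "0 < \<kappa>" "0 < \<theta>"
  shows "eventually (\<lambda>n. real n powr (- (\<kappa> * (\<alpha> + \<theta>))) \<le> T (real n powr \<kappa>)) sequentially"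
proof -
  have "eventually (\<lambda>t. t powr - (\<alpha> + \<theta>) \<le> T t) at_top" by (rule rv.potter_lower) (use assms in auto)
  from eventually_compose_filterlim[OF this filterlim_powr_nat[OF assms(1)]]
  show ?thesis by (simp add: powr_powr algebra_simps)
qed

lemma card_positions: "card (positions p' n) = p' * n"
  by (simp add: positions_def card_cartesian_product)

text \<open>For large \<open>n\<close> there are at most \<open>6 n^3\<close> pairs of positions on a common line, and each pair is large with probability
  at most \<open>(n^(\<mu> - 1 - \<kappa> (\<alpha> - \<theta>)))^2\<close>.\<close>

lemma rare_same_line:
  assumes "0 < \<kappa>" "0 < \<theta>" "\<theta> < \<alpha>" and gap: "\<mu> + 1 / 2 < \<kappa> * (\<alpha> - \<theta>)"
  shows "rare M (\<lambda>n \<omega>. \<exists>q\<in>positions (p n) n. \<exists>q'\<in>positions (p n) n. q \<noteq> q' \<and> (fst q = fst q' \<or> snd q = snd q')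
      \<and> real n powr \<kappa> < cmod (m n q \<omega>) \<and> real n powr \<kappa> < cmod (m n q' \<omega>))"
proof (rule rareI)
  define c where "c = \<kappa> * (\<alpha> - \<theta>)"
  show "(\<lambda>n. 6 * real n powr - (2 * c - 2 * \<mu> - 1)) \<longlonglongrightarrow> 0"
  proof -
    have "0 < 2 * c - 2 * \<mu> - 1" using gap unfolding c_def by linarith
    then show ?thesis by (intro tendsto_mult_right_zero tendsto_powr_neg_nat)
  qed
  show "eventually (\<lambda>n. \<exists>E\<in>sets (M n). measure (M n) E \<le> 6 * real n powr - (2 * c - 2 * \<mu> - 1) \<and>
      (\<forall>\<omega>\<in>space (M n) - E. \<not> (\<exists>q\<in>positions (p n) n. \<exists>q'\<in>positions (p n) n. q \<noteq> q' \<and> (fst q = fst q' \<or> snd q = snd q')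
      \<and> real n powr \<kappa> < cmod (m n q \<omega>) \<and> real n powr \<kappa> < cmod (m n q' \<omega>)))) sequentially"
    using eventually_size eventually_potter_upper[OF assms(1-3)]
  proof eventually_elim
    case (elim n)
    then have n: "1 \<le> n" and pn: "real (p n) \<le> 2 * real n" by auto
    interpret me: masked_entries "M n" N x "real n powr (\<mu> - 1)" "positions (p n) n" "m n" by (rule entries[OF n])
    have Teq: "me.T t = T t" for t by (simp add: me.T_def T_def)
    define R where "R = {(q, q'). q \<in> positions (p n) n \<and> q' \<in> positions (p n) n \<and> q \<noteq> q' \<and> (fst q = fst q' \<or> snd q = snd q')}"
    have R: "finite R" "R \<subseteq> {(i, j). i \<in> positions (p n) n \<and> j \<in> positions (p n) n \<and> i \<noteq> j}"
      unfolding R_def by (rule card_same_line_pairs, blast)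
    define E where "E = {\<omega> \<in> space (M n). \<exists>(i, j)\<in>R. real n powr \<kappa> < cmod (m n i \<omega>) \<and> real n powr \<kappa> < cmod (m n j \<omega>)}"
    have E: "E \<in> me.events" "me.prob E \<le> real (card R) * (real n powr (\<mu> - 1) * T (real n powr \<kappa>))\<^sup>2"
      unfolding E_def Teq[symmetric] by (rule me.prob_two_large[OF _ R], simp)+
    have cR: "real (card R) \<le> 6 * real n powr 3"
    proof -
      have "real (card R) \<le> real (p n * n * (n + p n))" unfolding R_def by (intro of_nat_mono card_same_line_pairs)
      also have "\<dots> = real (p n) * real n * (real n + real (p n))" by simp
      also have "\<dots> \<le> (2 * real n) * real n * (real n + 2 * real n)" using pn by (intro mult_mono add_mono) auto
      also have "\<dots> = 6 * real n powr 3" using n by (simp add: power3_eq_cube)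
      finally show ?thesis .
    qed
    have "me.prob E \<le> real (card R) * (real n powr (\<mu> - 1) * T (real n powr \<kappa>))\<^sup>2" by (rule E)
    also have "\<dots> \<le> (6 * real n powr 3) * (real n powr (\<mu> - 1) * real n powr (- c))\<^sup>2"
    proof (rule mult_mono[OF cR])
      have "real n powr (\<mu> - 1) * T (real n powr \<kappa>) \<le> real n powr (\<mu> - 1) * real n powr (- c)"
        using elim(2) unfolding c_def by (rule mult_left_mono) simp
      then show "(real n powr (\<mu> - 1) * T (real n powr \<kappa>))\<^sup>2 \<le> (real n powr (\<mu> - 1) * real n powr (- c))\<^sup>2"
        by (rule power_mono) (simp add: less_imp_le[OF rv.pos])
    qed simp_all
    also have "\<dots> = 6 * real n powr - (2 * c - 2 * \<mu> - 1)"
      unfolding power2_eq_square mult.assoc powr_add[symmetric]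
      by (rule arg_cong[where f = "\<lambda>e. 6 * real n powr e"]) simp
    finally have pE: "me.prob E \<le> 6 * real n powr - (2 * c - 2 * \<mu> - 1)" .
    have "\<omega> \<in> E" if "\<omega> \<in> space (M n)" "q \<in> positions (p n) n" "q' \<in> positions (p n) n" "q \<noteq> q'"
      "fst q = fst q' \<or> snd q = snd q'" "real n powr \<kappa> < cmod (m n q \<omega>)" "real n powr \<kappa> < cmod (m n q' \<omega>)" for \<omega> q q'
    proof -
      have "(q, q') \<in> R" unfolding R_def using that(2-5) by blast
      then show ?thesis unfolding E_def using that(1,6,7) by blast
    qed
    then show ?case using E(1) pE by (intro bexI[of _ E] conjI ballI notI) blast+
  qed
qed

lemma rare_huge:
  assumes "0 < \<kappa>" "0 < \<theta>" "\<theta> < \<alpha>" and gap: "1 + \<mu> < \<kappa> * (\<alpha> - \<theta>)"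
  shows "rare M (\<lambda>n \<omega>. \<exists>q\<in>positions (p n) n. real n powr \<kappa> < cmod (m n q \<omega>))"
proof (rule rareI)
  define c where "c = \<kappa> * (\<alpha> - \<theta>)"
  show "(\<lambda>n. 2 * real n powr - (c - \<mu> - 1)) \<longlonglongrightarrow> 0"
  proof -
    have "0 < c - \<mu> - 1" using gap unfolding c_def by linarith
    then show ?thesis by (intro tendsto_mult_right_zero tendsto_powr_neg_nat)
  qed
  show "eventually (\<lambda>n. \<exists>E\<in>sets (M n). measure (M n) E \<le> 2 * real n powr - (c - \<mu> - 1) \<and>
      (\<forall>\<omega>\<in>space (M n) - E. \<not> (\<exists>q\<in>positions (p n) n. real n powr \<kappa> < cmod (m n q \<omega>)))) sequentially"
    using eventually_size eventually_potter_upper[OF assms(1-3)]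
  proof eventually_elim
    case (elim n)
    then have n: "1 \<le> n" and pn: "real (p n) \<le> 2 * real n" by auto
    interpret me: masked_entries "M n" N x "real n powr (\<mu> - 1)" "positions (p n) n" "m n" by (rule entries[OF n])
    have Teq: "me.T t = T t" for t by (simp add: me.T_def T_def)
    define E where "E = {\<omega> \<in> space (M n). \<exists>q\<in>positions (p n) n. real n powr \<kappa> < cmod (m n q \<omega>)}"
    have E: "E \<in> me.events" "me.prob E \<le> real (card (positions (p n) n)) * (real n powr (\<mu> - 1) * T (real n powr \<kappa>))"
      unfolding E_def Teq[symmetric] by (rule me.prob_exists_large, simp)+
    have cI: "real (card (positions (p n) n)) \<le> 2 * real n powr 2"
      using mult_right_mono[OF pn, of "real n"] n by (simp add: card_positions power2_eq_square mult.assoc)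
    have "me.prob E \<le> real (card (positions (p n) n)) * (real n powr (\<mu> - 1) * T (real n powr \<kappa>))" by (rule E)
    also have "\<dots> \<le> (2 * real n powr 2) * (real n powr (\<mu> - 1) * real n powr (- c))"
    proof (rule mult_mono[OF cI])
      show "real n powr (\<mu> - 1) * T (real n powr \<kappa>) \<le> real n powr (\<mu> - 1) * real n powr (- c)"
        using elim(2) unfolding c_def by (rule mult_left_mono) simp
    qed (simp_all add: less_imp_le[OF rv.pos])
    also have "\<dots> = 2 * real n powr - (c - \<mu> - 1)"
      unfolding mult.assoc powr_add[symmetric] by (rule arg_cong[where f = "\<lambda>e. 2 * real n powr e"]) simp
    finally have pE: "me.prob E \<le> 2 * real n powr - (c - \<mu> - 1)" .
    have "\<not> (\<exists>q\<in>positions (p n) n. real n powr \<kappa> < cmod (m n q \<omega>))" if "\<omega> \<in> space (M n) - E" for \<omega>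
      using that unfolding E_def by blast
    then show ?case using E(1) pE by (intro bexI[of _ E] conjI ballI)
  qed
qed

text \<open>The expected number of entries above the level grows like a positive power of \<open>n\<close>.\<close>

lemma rare_few:
  assumes "0 < \<kappa>" "0 < \<theta>" and gap: "\<kappa> * (\<alpha> + \<theta>) < 1 + \<mu>"
  shows "rare M (\<lambda>n \<omega>. card {q \<in> positions (p n) n. real n powr \<kappa> < cmod (m n q \<omega>)} < l)"
proof (rule rareI)
  define c where "c = 1 + \<mu> - \<kappa> * (\<alpha> + \<theta>)"
  have c: "0 < c" using gap by (simp add: c_def)
  have "filterlim (\<lambda>n. \<rho> / 4 * real n powr c) at_top sequentially"
    by (rule filterlim_tendsto_pos_mult_at_top[OF tendsto_const _ filterlim_powr_nat[OF c]]) (use \<rho> in simp)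
  then have "(\<lambda>n. exp (- (\<rho> / 4 * real n powr c))) \<longlonglongrightarrow> 0"
    by (intro filterlim_compose[OF exp_at_bot]) (simp add: filterlim_uminus_at_top)
  then show "(\<lambda>n. 2 ^ l * exp (- (\<rho> / 4 * real n powr c))) \<longlonglongrightarrow> 0" by (rule tendsto_mult_right_zero)
  show "eventually (\<lambda>n. \<exists>E\<in>sets (M n). measure (M n) E \<le> 2 ^ l * exp (- (\<rho> / 4 * real n powr c)) \<and>
      (\<forall>\<omega>\<in>space (M n) - E. \<not> card {q \<in> positions (p n) n. real n powr \<kappa> < cmod (m n q \<omega>)} < l)) sequentially"
    using eventually_size eventually_potter_lower[OF assms(1,2)]
  proof eventually_elim
    case (elim n)
    then have n: "1 \<le> n" and pn: "\<rho> / 2 * real n \<le> real (p n)" by auto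
    interpret me: masked_entries "M n" N x "real n powr (\<mu> - 1)" "positions (p n) n" "m n" by (rule entries[OF n])
    have Teq: "me.T t = T t" for t by (simp add: me.T_def T_def)
    define E where "E = {\<omega> \<in> space (M n). card {q \<in> positions (p n) n. real n powr \<kappa> < cmod (m n q \<omega>)} < l}"
    have E: "E \<in> me.events" "me.prob E \<le> 2 ^ l * exp (- (real (card (positions (p n) n)) * (real n powr (\<mu> - 1) * T (real n powr \<kappa>)) / 2))"
      unfolding E_def Teq[symmetric] by (rule me.prob_few_large, simp)+
    have cI: "\<rho> / 2 * real n powr 2 \<le> real (card (positions (p n) n))"
      using mult_right_mono[OF pn, of "real n"] n by (simp add: card_positions power2_eq_square mult.assoc)
    have "\<rho> / 2 * real n powr c = (\<rho> / 2 * real n powr 2) * (real n powr (\<mu> - 1) * real n powr (- (\<kappa> * (\<alpha> + \<theta>))))"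
      unfolding mult.assoc powr_add[symmetric]
      by (rule arg_cong[where f = "\<lambda>e. \<rho> / 2 * real n powr e"]) (simp add: c_def)
    also have "\<dots> \<le> real (card (positions (p n) n)) * (real n powr (\<mu> - 1) * T (real n powr \<kappa>))"
    proof (rule mult_mono[OF cI])
      show "real n powr (\<mu> - 1) * real n powr (- (\<kappa> * (\<alpha> + \<theta>))) \<le> real n powr (\<mu> - 1) * T (real n powr \<kappa>)"
        using elim(2) by (rule mult_left_mono) simp
    qed simp_all
    finally have "2 ^ l * exp (- (real (card (positions (p n) n)) * (real n powr (\<mu> - 1) * T (real n powr \<kappa>)) / 2))
        \<le> 2 ^ l * exp (- (\<rho> / 4 * real n powr c))" by simp
    then have pE: "me.prob E \<le> 2 ^ l * exp (- (\<rho> / 4 * real n powr c))" using E(2) by linarith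
    have "\<not> card {q \<in> positions (p n) n. real n powr \<kappa> < cmod (m n q \<omega>)} < l" if "\<omega> \<in> space (M n) - E" for \<omega>
      using that unfolding E_def by blast
    then show ?case using E(1) pE by (intro bexI[of _ E] conjI ballI)
  qed
qed

text \<open>At the level \<open>K = n^\<kappa>\<close> the parameter \<open>q\<close> is of order \<open>n^(\<mu> - 1 - s \<kappa>)\<close>, hence at most of
  order \<open>1 / n\<close>. The failure probability is of order \<open>n^(1 - k \<epsilon>)\<close>, where the walk length \<open>k = 4 \<cdot> 2^j\<close> is at our disposal.\<close>

lemma rare_norm:
  assumes s: "0 < s" "integrable N (\<lambda>\<omega>. cmod (x \<omega>) powr s)" "s \<le> 1 \<or> (1 \<le> s \<and> s \<le> 2 \<and> prob_space.expectation N x = 0)"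
    and \<kappa>: "0 < \<kappa>" "\<mu> \<le> s * \<kappa>" and \<epsilon>: "0 < \<epsilon>"
  shows "rare M (\<lambda>n \<omega>. \<not> op_bound (p n) n (\<lambda>i j. if cmod (m n (i, j) \<omega>) \<le> real n powr \<kappa> then m n (i, j) \<omega> else 0)
      (real n powr (\<kappa> + 2 * \<epsilon>)))"
proof -
  obtain j :: nat where j: "1 / \<epsilon> < 2 ^ j" using real_arch_pow[of 2 "1 / \<epsilon>"] by auto
  define k :: nat where "k = 4 * 2 ^ j"
  have k: "1 < real k * \<epsilon>"
  proof -
    have "1 < 2 ^ j * \<epsilon>" using j \<epsilon> by (simp add: divide_less_eq)
    also have "\<dots> \<le> real k * \<epsilon>" using \<epsilon> by (simp add: k_def)
    finally show ?thesis .
  qed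
  define S where "S = (\<integral>\<omega>. cmod (x \<omega>) powr s \<partial>N)"
  have S: "0 \<le> S" unfolding S_def by (rule Bochner_Integration.integral_nonneg) simp
  define C where "C = 2 * S + real k"
  have C: "0 \<le> C" using S by (simp add: C_def)
  have ev2: "eventually (\<lambda>n. 2 * real n powr \<epsilon> + 2 * S \<le> real n powr (2 * \<epsilon>)) sequentially"
  proof -
    have "eventually (\<lambda>n. 2 + 2 * S \<le> real n powr \<epsilon>) sequentially"
      using filterlim_powr_nat[OF \<epsilon>] by (simp add: filterlim_at_top)
    then show ?thesis using eventually_ge_at_top[of 1]
    proof eventually_elim
      case (elim n)
      have "1 \<le> real n powr \<epsilon>" using elim(2) \<epsilon> by (simp add: ge_one_powr_ge_zero)
      then have "2 * S * 1 \<le> 2 * S * real n powr \<epsilon>" using S by (intro mult_left_mono) auto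
      then have "2 * real n powr \<epsilon> + 2 * S \<le> (2 + 2 * S) * real n powr \<epsilon>" by (simp add: distrib_right)
      also have "\<dots> \<le> real n powr \<epsilon> * real n powr \<epsilon>" using elim(1) by (intro mult_right_mono) auto
      also have "\<dots> = real n powr (2 * \<epsilon>)" by (simp add: powr_add[symmetric])
      finally show ?case .
    qed
  qed
  show ?thesis
  proof (rule rareI)
    show "(\<lambda>n. 2 * C ^ k * real n powr - (real k * \<epsilon> - 1)) \<longlonglongrightarrow> 0"
    proof -
      have "0 < real k * \<epsilon> - 1" using k by linarith
      then show ?thesis by (intro tendsto_mult_right_zero tendsto_powr_neg_nat)
    qed
    show "eventually (\<lambda>n. \<exists>E\<in>sets (M n). measure (M n) E \<le> 2 * C ^ k * real n powr - (real k * \<epsilon> - 1) \<and>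
      (\<forall>\<omega>\<in>space (M n) - E. \<not> \<not> op_bound (p n) n (\<lambda>i j. if cmod (m n (i, j) \<omega>) \<le> real n powr \<kappa> then m n (i, j) \<omega> else 0)
      (real n powr (\<kappa> + 2 * \<epsilon>)))) sequentially"
      using eventually_size ev2
    proof eventually_elim
      case (elim n)
      then have n: "1 \<le> n" and pn: "real (p n) \<le> 2 * real n" by auto
      define B where "B = 2 * n"
      have B: "p n \<le> B" "n \<le> B" using pn by (auto simp: B_def)
      define K where "K = real n powr \<kappa>"
      define t where "t = real n powr \<epsilon>"
      have Kt: "0 < K" "0 < t" using n by (auto simp: K_def t_def)
      define q where "q = real n powr (\<mu> - 1) * K powr - s * S"
      obtain E where E: "E \<in> sets (M n)" "measure (M n) E \<le> real (p n) * ((real B * q + real (4 * 2 ^ j)) / t) ^ (4 * 2 ^ j)"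
        "\<And>\<omega>. \<omega> \<in> space (M n) \<Longrightarrow> \<omega> \<notin> E \<Longrightarrow>
          op_bound (p n) n (\<lambda>i j. if cmod (m n (i, j) \<omega>) \<le> K then m n (i, j) \<omega> else 0) (K * (2 * t + real B * q))"
        using truncated_matrix_norm_tail[OF entries[OF n] Kt(1) s B Kt(2), of j] unfolding q_def S_def by blast
      have Bq: "real B * q \<le> 2 * S"
      proof -
        have "real B * q = 2 * (real n powr 1 * real n powr (\<mu> - 1) * real n powr (- (s * \<kappa>))) * S"
          using n by (simp add: B_def q_def K_def powr_powr mult_ac)
        also have "real n powr 1 * real n powr (\<mu> - 1) * real n powr (- (s * \<kappa>)) = real n powr (\<mu> - s * \<kappa>)"
          unfolding powr_add[symmetric] by simp
        also have "2 * real n powr (\<mu> - s * \<kappa>) * S \<le> 2 * 1 * S"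
        proof (intro mult_right_mono mult_left_mono S)
          have "real n powr (\<mu> - s * \<kappa>) \<le> real n powr 0" using n \<kappa>(2) by (intro powr_mono) auto
          then show "real n powr (\<mu> - s * \<kappa>) \<le> 1" using n by simp
        qed simp
        finally show ?thesis by simp
      qed
      have q0: "0 \<le> q" using S by (simp add: q_def)
      have "measure (M n) E \<le> real (p n) * ((real B * q + real k) / t) ^ k" using E(2) by (simp add: k_def)
      also have "\<dots> \<le> (2 * real n) * (C / t) ^ k"
        using pn Bq q0 Kt by (intro mult_mono power_mono divide_right_mono) (auto simp: C_def)
      also have "\<dots> = 2 * C ^ k * (real n powr 1 * real n powr (- (real k * \<epsilon>)))"
        using n by (simp add: power_divide t_def powr_minus_divide powr_powr mult.commute[of "real k"] flip: powr_realpow)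
      also have "\<dots> = 2 * C ^ k * real n powr - (real k * \<epsilon> - 1)"
        unfolding powr_add[symmetric] by simp
      finally have mE: "measure (M n) E \<le> 2 * C ^ k * real n powr - (real k * \<epsilon> - 1)" .
      have "K * (2 * t + real B * q) \<le> K * (2 * t + 2 * S)" using Bq Kt by simp
      also have "\<dots> \<le> K * real n powr (2 * \<epsilon>)" using elim(2) Kt by (simp add: t_def)
      also have "\<dots> = real n powr (\<kappa> + 2 * \<epsilon>)" by (simp add: K_def powr_add)
      finally have "K * (2 * t + real B * q) \<le> real n powr (\<kappa> + 2 * \<epsilon>)" .
      from op_bound_mono[OF E(3) this] show ?case using E(1) mE
        by (intro bexI[of _ E]) (auto simp: K_def)
    qed
  qed
qed

text \<open>Fix a large number \<open>A\<close> and a level \<open>\<tau>\<close> above which about \<open>A\<close> entries are expected. With high probability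
  the \<open>l\<close>-th largest modulus exceeds \<open>\<tau>\<close>, and the expected number of pairs above \<open>\<tau>\<close> with ratio below \<open>c\<close> is at most
  \<open>\<kappa> A^2\<close>, which is small when \<open>\<kappa>\<close>, and with it \<open>c - 1\<close>, is chosen small in terms of \<open>A\<close>.\<close>

lemma eventually_separated:
  assumes l: "1 \<le> l" and \<eta>: "0 < \<eta>"
    and r: "\<And>n \<omega>. n \<ge> 1 \<Longrightarrow> \<omega> \<in> space (M n) \<Longrightarrow> ranks_entries (p n) n (\<lambda>q. m n q \<omega>) (r n \<omega>)"
  obtains c where "1 < c"
    "eventually (\<lambda>n. \<exists>E\<in>sets (M n). measure (M n) E \<le> \<eta> \<and> (\<forall>\<omega>\<in>space (M n) - E. \<forall>q\<in>positions (p n) n. q \<noteq> r n \<omega> l \<longrightarrow>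
        c * cmod (m n q \<omega>) \<le> cmod (m n (r n \<omega> l) \<omega>) \<or> c * cmod (m n (r n \<omega> l) \<omega>) \<le> cmod (m n q \<omega>))) sequentially"
proof -
  define d where "d = 2 powr - (\<alpha> + 1)"
  have d: "0 < d" by (simp add: d_def)
  have "filterlim (\<lambda>A::real. d / 2 * A) at_top at_top"
    by (rule filterlim_tendsto_pos_mult_at_top[OF tendsto_const _ filterlim_ident]) (use d in simp)
  then have "((\<lambda>A. exp (- (d / 2 * A))) \<longlongrightarrow> 0) at_top"
    by (intro filterlim_compose[OF exp_at_bot]) (simp add: filterlim_uminus_at_top)
  then have "((\<lambda>A. 2 ^ l * exp (- (d / 2 * A))) \<longlongrightarrow> 0) at_top" by (rule tendsto_mult_right_zero)
  then have "eventually (\<lambda>A. 2 ^ l * exp (- (d / 2 * A)) < \<eta> / 2) at_top"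
    by (rule order_tendstoD(2)) (use \<eta> in simp)
  then obtain A0 where A0: "\<And>A. A0 \<le> A \<Longrightarrow> 2 ^ l * exp (- (d / 2 * A)) < \<eta> / 2" by (auto simp: eventually_at_top_linorder)
  define A where "A = max 1 A0"
  have A: "1 \<le> A" "2 ^ l * exp (- (d / 2 * A)) \<le> \<eta> / 2" using A0[of A] by (auto simp: A_def)
  (* both error terms are at most half of \<eta>; the factor d is the loss in the approximate quantile *)
  define \<kappa> where "\<kappa> = \<eta> / (2 * A\<^sup>2)"
  have \<kappa>: "0 < \<kappa>" "\<kappa> * A\<^sup>2 = \<eta> / 2" using \<eta> A by (auto simp: \<kappa>_def)
  obtain c where c: "1 < c" "eventually (\<lambda>t. T (t / c\<^sup>2) - T t \<le> \<kappa> * T t) at_top"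
    using rv.close_scales[OF \<kappa>(1)] .
  then obtain t0 where t0: "\<And>t. t0 \<le> t \<Longrightarrow> T (t / c\<^sup>2) - T t \<le> \<kappa> * T t" by (auto simp: eventually_at_top_linorder)
  obtain u0 where u0: "0 < u0" "\<And>u. 0 < u \<Longrightarrow> u < u0 \<Longrightarrow> \<exists>\<tau>\<ge>max 1 t0. u * d \<le> T \<tau> \<and> T \<tau> \<le> u"
    using rv.quantile[of "max 1 t0"] unfolding d_def by blast
  have evu: "eventually (\<lambda>n. A < u0 * (\<rho> / 2 * real n powr (1 + \<mu>))) sequentially"
  proof -
    have "filterlim (\<lambda>n. (u0 * (\<rho> / 2)) * real n powr (1 + \<mu>)) at_top sequentially"
      by (rule filterlim_tendsto_pos_mult_at_top[OF tendsto_const _ filterlim_powr_nat]) (use u0 \<rho> \<mu> in auto)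
    then have "eventually (\<lambda>n. A < (u0 * (\<rho> / 2)) * real n powr (1 + \<mu>)) sequentially"
      by (simp add: filterlim_at_top_dense)
    then show ?thesis by (simp add: mult.assoc)
  qed
  show ?thesis
  proof (rule that[OF c(1)])
    show "eventually (\<lambda>n. \<exists>E\<in>sets (M n). measure (M n) E \<le> \<eta> \<and> (\<forall>\<omega>\<in>space (M n) - E. \<forall>q\<in>positions (p n) n. q \<noteq> r n \<omega> l \<longrightarrow>
        c * cmod (m n q \<omega>) \<le> cmod (m n (r n \<omega> l) \<omega>) \<or> c * cmod (m n (r n \<omega> l) \<omega>) \<le> cmod (m n q \<omega>))) sequentially"
      using eventually_size evu
    proof eventually_elim
      case (elim n)
      then have n: "1 \<le> n" and pn: "\<rho> / 2 * real n \<le> real (p n)" by auto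
      interpret me: masked_entries "M n" N x "real n powr (\<mu> - 1)" "positions (p n) n" "m n" by (rule entries[OF n])
      have Teq: "me.T t = T t" for t by (simp add: me.T_def T_def)
      define w where "w = real n powr (\<mu> - 1)"
      define W where "W = real (card (positions (p n) n)) * w"
      have "\<rho> / 2 * real n powr 2 \<le> real (card (positions (p n) n))"
        using mult_right_mono[OF pn, of "real n"] n by (simp add: card_positions power2_eq_square mult.assoc)
      then have "\<rho> / 2 * real n powr 2 * w \<le> W" unfolding W_def by (intro mult_right_mono) (auto simp: w_def)
      moreover have "\<rho> / 2 * real n powr 2 * w = \<rho> / 2 * real n powr (1 + \<mu>)"
        unfolding w_def mult.assoc powr_add[symmetric] by (rule arg_cong[where f = "\<lambda>e. \<rho> / 2 * real n powr e"]) simp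
      ultimately have Wge: "\<rho> / 2 * real n powr (1 + \<mu>) \<le> W" by linarith
      have W: "0 < W" using Wge \<rho> n by (intro less_le_trans[OF _ Wge]) auto
      have "A < u0 * W" using elim(2) mult_left_mono[OF Wge, of u0] u0(1) by linarith
      then have "A / W < u0" using W by (simp add: divide_less_eq)
      then obtain \<tau> where \<tau>: "max 1 t0 \<le> \<tau>" "A / W * d \<le> T \<tau>" "T \<tau> \<le> A / W"
        using u0(2)[of "A / W"] A W by auto
      have WT: "A * d \<le> W * T \<tau>" "W * T \<tau> \<le> A" using \<tau>(2,3) W by (auto simp: field_simps)
      have \<tau>0: "0 < \<tau>" "t0 \<le> \<tau>" using \<tau>(1) by auto
      define E where "E = {\<omega> \<in> space (M n). card {q \<in> positions (p n) n. \<tau> < cmod (m n q \<omega>)} < l}"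
      define F where "F = {\<omega> \<in> space (M n). \<exists>i\<in>positions (p n) n. \<exists>j\<in>positions (p n) n. i \<noteq> j \<and> \<tau> < cmod (m n i \<omega>)
         \<and> cmod (m n i \<omega>) < c * cmod (m n j \<omega>) \<and> cmod (m n j \<omega>) \<le> cmod (m n i \<omega>)}"
      have E: "E \<in> me.events" "me.prob E \<le> 2 ^ l * exp (- (real (card (positions (p n) n)) * (w * T \<tau>) / 2))"
        unfolding E_def w_def Teq[symmetric] by (rule me.prob_few_large, use \<tau>0 in simp)+
      have F: "F \<in> me.events" "me.prob F \<le> \<kappa> * (real (card (positions (p n) n)) * (w * T \<tau>))\<^sup>2"
      proof -
        have k0: "0 \<le> \<kappa>" using \<kappa>(1) by simp
        have cl: "me.T (t / c\<^sup>2) - me.T t \<le> \<kappa> * me.T t" if "\<tau> \<le> t" for t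
          unfolding Teq using t0[of t] \<tau>0 that by simp
        show "F \<in> me.events" "me.prob F \<le> \<kappa> * (real (card (positions (p n) n)) * (w * T \<tau>))\<^sup>2"
          unfolding F_def w_def Teq[symmetric]
          by (rule me.prob_exists_close_pair[OF \<tau>0(1) c(1) k0 cl], assumption)+
      qed
      have "me.prob E \<le> \<eta> / 2"
      proof -
        have "2 ^ l * exp (- (W * T \<tau> / 2)) \<le> 2 ^ l * exp (- (d / 2 * A))" using WT by (simp add: mult.commute)
        moreover have "me.prob E \<le> 2 ^ l * exp (- (W * T \<tau> / 2))" using E(2) by (simp add: W_def mult.assoc)
        ultimately show ?thesis using A(2) by linarith
      qed
      moreover have "me.prob F \<le> \<eta> / 2"
      proof -
        have "\<kappa> * (W * T \<tau>)\<^sup>2 \<le> \<kappa> * A\<^sup>2"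
          using WT \<kappa> W rv.pos[of \<tau>] by (intro mult_left_mono power_mono) auto
        then show ?thesis using F(2) \<kappa>(2) by (simp add: W_def mult.assoc)
      qed
      moreover have "me.prob (E \<union> F) \<le> me.prob E + me.prob F" by (rule measure_Un_le[OF E(1) F(1)])
      ultimately have pEF: "me.prob (E \<union> F) \<le> \<eta>" by simp
      show ?case
      proof (intro bexI[of _ "E \<union> F"] conjI pEF ballI impI)
        show "E \<union> F \<in> me.events" using E F by auto
        fix \<omega> q assume \<omega>: "\<omega> \<in> space (M n) - (E \<union> F)" and q: "q \<in> positions (p n) n" "q \<noteq> r n \<omega> l"
        have rk: "ranks_entries (p n) n (\<lambda>q. m n q \<omega>) (r n \<omega>)" using r n \<omega> by simp
        have "l \<le> card {q \<in> positions (p n) n. \<tau> < cmod (m n q \<omega>)}" using \<omega> by (auto simp: E_def not_less)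
        from ranks_entries_large[OF rk this l] have big: "\<tau> < cmod (m n (r n \<omega> l) \<omega>)" and ln: "l \<le> p n * n" by auto
        have rl: "r n \<omega> l \<in> positions (p n) n" using rk l ln by (auto simp: ranks_entries_def bij_betw_def)
        have nF: "\<not> (\<tau> < cmod (m n i \<omega>) \<and> cmod (m n i \<omega>) < c * cmod (m n j \<omega>) \<and> cmod (m n j \<omega>) \<le> cmod (m n i \<omega>))"
          if "i \<in> positions (p n) n" "j \<in> positions (p n) n" "i \<noteq> j" for i j
          using \<omega> that by (auto simp: F_def)
        show "c * cmod (m n q \<omega>) \<le> cmod (m n (r n \<omega> l) \<omega>) \<or> c * cmod (m n (r n \<omega> l) \<omega>) \<le> cmod (m n q \<omega>)"
        proof (cases "cmod (m n q \<omega>) \<le> cmod (m n (r n \<omega> l) \<omega>)")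
          case True
          then show ?thesis using nF[OF rl q(1)] q(2) big by auto
        next
          case False
          then show ?thesis using nF[OF q(1) rl q(2)] big by auto
        qed
      qed
    qed
  qed
qed

end

section \<open>Localization of eigenvalues and eigenvectors\<close>

text \<open>The deterministic conclusion at relative precision \<open>\<delta>\<close>. The eigenvector part is conditional on a
  multiplicative gap \<open>c\<close> around the \<open>l\<close>-th largest modulus, because such a gap holds only with probability
  close to one and \<open>c\<close> depends on that probability.\<close>

definition localized :: "nat \<Rightarrow> nat \<Rightarrow> (nat \<times> nat \<Rightarrow> complex) \<Rightarrow> (nat \<Rightarrow> nat \<times> nat) \<Rightarrow> nat \<Rightarrow> real \<Rightarrow> bool" where
  "localized p n m r l \<delta> \<longleftrightarrow> 0 < cmod (m (r l)) \<and>
     \<bar>eigval_desc (sample_covariance p n m) l - (cmod (m (r l)))\<^sup>2\<bar> \<le> \<delta> * (cmod (m (r l)))\<^sup>2 \<and> l \<le> p \<and>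
     (\<forall>c v. 1 < c \<longrightarrow>
        (\<forall>q\<in>positions p n. q \<noteq> r l \<longrightarrow> c * cmod (m q) \<le> cmod (m (r l)) \<or> c * cmod (m (r l)) \<le> cmod (m q)) \<longrightarrow>
        \<delta> < 1 - 1 / c\<^sup>2 \<longrightarrow> unit_eigenvector (sample_covariance p n m) l v \<longrightarrow>
        norm2 (phase_to_real (v $ fst (r l)) \<cdot>\<^sub>v v - unit_vec p (fst (r l))) \<le> 2 * (\<delta> / (1 - 1 / c\<^sup>2 - \<delta>)))"

lemma localizedI:
  fixes m :: "nat \<times> nat \<Rightarrow> complex"
  assumes r: "ranks_entries p n m r" and l: "1 \<le> l" "l \<le> p * n" and K: "0 \<le> K"
    and iso: "\<And>q q'. q \<in> positions p n \<Longrightarrow> q' \<in> positions p n \<Longrightarrow> q \<noteq> q' \<Longrightarrow>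
       cmod (m q) > K \<Longrightarrow> cmod (m q') > K \<Longrightarrow> fst q \<noteq> fst q' \<and> snd q \<noteq> snd q'"
    and big: "K < cmod (m (r l))" and b: "\<And>q. q \<in> positions p n \<Longrightarrow> cmod (m q) \<le> b"
    and S: "op_bound p n (\<lambda>i j. if cmod (m (i, j)) \<le> K then m (i, j) else 0) s"
    and \<delta>: "2 * b * s + s\<^sup>2 \<le> \<delta> * (cmod (m (r l)))\<^sup>2"
  shows "localized p n m r l \<delta>"
proof -
  define ml where "ml = cmod (m (r l))"
  define e where "e = 2 * b * s + s\<^sup>2"
  have ml: "0 < ml" using K big unfolding ml_def by linarith
  have e: "e \<le> \<delta> * ml\<^sup>2" using \<delta> by (simp add: e_def ml_def)
  have lp: "l \<le> p" by (rule isolated_large_entries(1)[OF r l K iso big b S])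
  have ev: "\<bar>eigval_desc (sample_covariance p n m) l - ml\<^sup>2\<bar> \<le> e"
    unfolding e_def ml_def by (rule isolated_large_entries(2)[OF r l K iso big b S])
  have "norm2 (phase_to_real (v $ fst (r l)) \<cdot>\<^sub>v v - unit_vec p (fst (r l))) \<le> 2 * (\<delta> / (1 - 1 / c\<^sup>2 - \<delta>))"
    if c: "1 < c" and sep: "\<And>q. q \<in> positions p n \<Longrightarrow> q \<noteq> r l \<Longrightarrow> c * cmod (m q) \<le> ml \<or> c * ml \<le> cmod (m q)"
      and g: "\<delta> < 1 - 1 / c\<^sup>2" and v: "unit_eigenvector (sample_covariance p n m) l v" for c v
  proof -
    define h where "h = 1 - 1 / c\<^sup>2"
    have "\<delta> * ml\<^sup>2 < h * ml\<^sup>2" using g ml by (simp add: h_def)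
    then have lt: "e < h * ml\<^sup>2" using e by linarith
    have "norm2 (phase_to_real (v $ fst (r l)) \<cdot>\<^sub>v v - unit_vec p (fst (r l))) \<le> 2 * (e / (h * ml\<^sup>2 - e))"
      unfolding h_def e_def ml_def
      by (rule isolated_large_entries(3)[OF r l K iso big b S c sep[unfolded ml_def] lt[unfolded h_def e_def ml_def] v])
    also have "\<dots> \<le> 2 * (\<delta> * ml\<^sup>2 / ((h - \<delta>) * ml\<^sup>2))"
    proof (intro mult_left_mono frac_le)
      show "0 \<le> \<delta> * ml\<^sup>2" using e ev by linarith
      show "0 < (h - \<delta>) * ml\<^sup>2" using g ml by (simp add: h_def)
      show "(h - \<delta>) * ml\<^sup>2 \<le> h * ml\<^sup>2 - e" using e by (simp add: left_diff_distrib)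
    qed (use e in auto)
    also have "\<dots> = 2 * (\<delta> / (1 - 1 / c\<^sup>2 - \<delta>))" using ml by (simp add: h_def)
    finally show ?thesis .
  qed
  then show ?thesis unfolding localized_def ml_def[symmetric] using ml lp ev e by auto
qed

context heavy_tailed_ensemble
begin

text \<open>Outside four rare events the large part has norm at most \<open>n^(\<beta> + \<epsilon>)\<close>, the truncated part at most \<open>n^(\<beta> - 6 \<epsilon>)\<close>,
  and the \<open>l\<close>-th largest modulus is at least \<open>n^(\<beta> - \<epsilon>)\<close>. The perturbation relative to the square of this
  modulus is therefore at most of order \<open>n^(-3 \<epsilon>)\<close>.\<close>

lemma rare_not_localized:
  assumes s: "0 < s" "integrable N (\<lambda>\<omega>. cmod (x \<omega>) powr s)" "s \<le> 1 \<or> (1 \<le> s \<and> s \<le> 2 \<and> prob_space.expectation N x = 0)"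
    and s\<mu>: "\<mu> * \<alpha> < s * (1 + \<mu>)" and l: "1 \<le> l"
    and r: "\<And>n \<omega>. n \<ge> 1 \<Longrightarrow> \<omega> \<in> space (M n) \<Longrightarrow> ranks_entries (p n) n (\<lambda>q. m n q \<omega>) (r n \<omega>)"
  obtains \<delta> where "\<delta> \<longlonglongrightarrow> 0" "rare M (\<lambda>n \<omega>. \<not> localized (p n) n (\<lambda>q. m n q \<omega>) (r n \<omega>) l (\<delta> n))"
proof -
  define \<beta> where "\<beta> = (1 + \<mu>) / \<alpha>"
  obtain \<epsilon> \<theta> where \<epsilon>: "0 < \<epsilon>" and \<theta>: "0 < \<theta>" "\<theta> < \<alpha>" and "8 * \<epsilon> < \<beta>" and ms: "\<mu> \<le> s * (\<beta> - 8 * \<epsilon>)"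
    and e1: "\<mu> + 1 / 2 < (\<beta> - 8 * \<epsilon>) * (\<alpha> - \<theta>)" and e2: "1 + \<mu> < (\<beta> + \<epsilon>) * (\<alpha> - \<theta>)" and e3: "(\<beta> - \<epsilon>) * (\<alpha> + \<theta>) < 1 + \<mu>"
    using choose_exponents[OF rv.\<alpha>_pos \<mu>(1) s(1) s\<mu>] unfolding \<beta>_def .
  have \<kappa>: "0 < \<beta> - 8 * \<epsilon>" "0 < \<beta> + \<epsilon>" "0 < \<beta> - \<epsilon>" using \<open>8 * \<epsilon> < \<beta>\<close> \<epsilon> by auto
  define \<delta> where "\<delta> n = 3 * real n powr - (3 * \<epsilon>)" for n
  have "\<delta> \<longlonglongrightarrow> 0" unfolding \<delta>_def[abs_def] using \<epsilon> by (intro tendsto_mult_right_zero tendsto_powr_neg_nat) simp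
  define bad1 where "bad1 n \<omega> \<longleftrightarrow> (\<exists>q\<in>positions (p n) n. \<exists>q'\<in>positions (p n) n. q \<noteq> q' \<and> (fst q = fst q' \<or> snd q = snd q')
      \<and> real n powr (\<beta> - 8 * \<epsilon>) < cmod (m n q \<omega>) \<and> real n powr (\<beta> - 8 * \<epsilon>) < cmod (m n q' \<omega>))" for n \<omega>
  define bad2 where "bad2 n \<omega> \<longleftrightarrow> (\<exists>q\<in>positions (p n) n. real n powr (\<beta> + \<epsilon>) < cmod (m n q \<omega>))" for n \<omega>
  define bad3 where "bad3 n \<omega> \<longleftrightarrow> card {q \<in> positions (p n) n. real n powr (\<beta> - \<epsilon>) < cmod (m n q \<omega>)} < l" for n \<omega>
  define bad4 where "bad4 n \<omega> \<longleftrightarrow> \<not> op_bound (p n) n (\<lambda>i j. if cmod (m n (i, j) \<omega>) \<le> real n powr (\<beta> - 8 * \<epsilon>) then m n (i, j) \<omega> else 0)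
      (real n powr (\<beta> - 8 * \<epsilon> + 2 * \<epsilon>))" for n \<omega>
  have "rare M bad1" unfolding bad1_def[abs_def] by (rule rare_same_line[OF \<kappa>(1) \<theta> e1])
  moreover have "rare M bad2" unfolding bad2_def[abs_def] by (rule rare_huge[OF \<kappa>(2) \<theta> e2])
  moreover have "rare M bad3" unfolding bad3_def[abs_def] by (rule rare_few[OF \<kappa>(3) \<theta>(1) e3])
  moreover have "rare M bad4" unfolding bad4_def[abs_def] by (rule rare_norm[OF s \<kappa>(1) ms \<epsilon>])
  ultimately have bad: "rare M (\<lambda>n \<omega>. (bad1 n \<omega> \<or> bad2 n \<omega>) \<or> (bad3 n \<omega> \<or> bad4 n \<omega>))"
    by (intro rare_disj[OF prob_space_M])
  have "rare M (\<lambda>n \<omega>. \<not> localized (p n) n (\<lambda>q. m n q \<omega>) (r n \<omega>) l (\<delta> n))"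
  proof (rule rare_mono[OF bad])
    show "eventually (\<lambda>n. \<forall>\<omega>\<in>space (M n). \<not> localized (p n) n (\<lambda>q. m n q \<omega>) (r n \<omega>) l (\<delta> n) \<longrightarrow>
        (bad1 n \<omega> \<or> bad2 n \<omega>) \<or> (bad3 n \<omega> \<or> bad4 n \<omega>)) sequentially"
      using eventually_ge_at_top[of 1]
    proof eventually_elim
      case (elim n)
      show ?case
      proof (intro ballI impI, rule ccontr)
        fix \<omega> assume \<omega>: "\<omega> \<in> space (M n)" and nl: "\<not> localized (p n) n (\<lambda>q. m n q \<omega>) (r n \<omega>) l (\<delta> n)"
          and good: "\<not> ((bad1 n \<omega> \<or> bad2 n \<omega>) \<or> (bad3 n \<omega> \<or> bad4 n \<omega>))"
        note rk = r[OF elim \<omega>]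
        define v where "v = real n powr (\<beta> - \<epsilon>)"
        define K where "K = real n powr (\<beta> - 8 * \<epsilon>)"
        define b where "b = real n powr (\<beta> + \<epsilon>)"
        define u where "u = real n powr (\<beta> - 8 * \<epsilon> + 2 * \<epsilon>)"
        have "l \<le> card {q \<in> positions (p n) n. v < cmod (m n q \<omega>)}" using good by (simp add: bad3_def v_def not_less)
        note large = ranks_entries_large[OF rk this l]
        have n1: "1 \<le> real n" using elim by simp
        have "K \<le> v" unfolding K_def v_def using \<epsilon> n1 by (intro powr_mono) auto
        have v0: "0 \<le> v" by (simp add: v_def)
        have "localized (p n) n (\<lambda>q. m n q \<omega>) (r n \<omega>) l (\<delta> n)"
        proof (rule localizedI[OF rk l large(1), of K b u])
          show "0 \<le> K" by (simp add: K_def)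
          show "K < cmod (m n (r n \<omega> l) \<omega>)" using large(2) \<open>K \<le> v\<close> by simp
          show "cmod (m n q \<omega>) \<le> b" if "q \<in> positions (p n) n" for q
            using good that by (auto simp: bad2_def b_def not_less)
          show "op_bound (p n) n (\<lambda>i j. if cmod (m n (i, j) \<omega>) \<le> K then m n (i, j) \<omega> else 0) u"
            using good by (simp add: bad4_def K_def u_def)
          show "fst q \<noteq> fst q' \<and> snd q \<noteq> snd q'"
            if "q \<in> positions (p n) n" "q' \<in> positions (p n) n" "q \<noteq> q'" "K < cmod (m n q \<omega>)" "K < cmod (m n q' \<omega>)" for q q'
            using good that unfolding bad1_def K_def by blast
          (* (\<beta> + \<epsilon>) + (\<beta> - 6 \<epsilon>) = 2 (\<beta> - \<epsilon>) - 3 \<epsilon> *)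
          have bu: "b * u = real n powr - (3 * \<epsilon>) * v\<^sup>2"
            unfolding b_def u_def v_def power2_eq_square powr_add[symmetric]
            by (rule arg_cong[where f = "\<lambda>e. real n powr e"]) simp
          have "u\<^sup>2 \<le> b * u"
            unfolding power2_eq_square
            by (intro mult_right_mono) (use n1 \<epsilon> in \<open>auto simp: b_def u_def intro!: powr_mono\<close>)
          then have "2 * b * u + u\<^sup>2 \<le> \<delta> n * v\<^sup>2" using bu by (simp add: \<delta>_def)
          also have "\<dots> \<le> \<delta> n * (cmod (m n (r n \<omega> l) \<omega>))\<^sup>2"
            using large(2) v0 by (intro mult_left_mono power_mono) (auto simp: \<delta>_def)
          finally show "2 * b * u + u\<^sup>2 \<le> \<delta> n * (cmod (m n (r n \<omega> l) \<omega>))\<^sup>2" .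
        qed
        then show False using nl by contradiction
      qed
    qed
  qed
  then show ?thesis using that[OF \<open>\<delta> \<longlonglongrightarrow> 0\<close>] by blast
qed

end

lemma masked_entriesI:
  fixes a b :: "'i \<Rightarrow> 'a \<Rightarrow> complex" and x y :: "'b \<Rightarrow> complex"
  assumes M: "prob_space M" and N: "prob_space N" and x: "x \<in> borel_measurable N" and y: "y \<in> borel_measurable N"
    and w: "0 \<le> w" "w \<le> 1" "\<P>(\<omega> in N. y \<omega> = 1) = w" "\<P>(\<omega> in N. y \<omega> = 0) = 1 - w"
    and I: "finite I" "I \<noteq> {}"
    and a: "iid_copies M I a N x" and b: "iid_copies M I b N y" and ab: "indep_families M I a I b"
  shows "masked_entries M N x w I (\<lambda>i \<omega>. a i \<omega> * b i \<omega>)"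
proof -
  interpret prob_space M by fact
  have ia: "indep_vars (\<lambda>_. borel) a I" and ib: "indep_vars (\<lambda>_. borel) b I"
    using a b by (auto simp: iid_copies_def)
  have iab: "indep_var borel (a i) borel (b i)" if i: "i \<in> I" for i
  proof -
    have "indep_var borel ((\<lambda>f. f i) \<circ> (\<lambda>\<omega>. \<lambda>i\<in>I. a i \<omega>)) borel ((\<lambda>f. f i) \<circ> (\<lambda>\<omega>. \<lambda>i\<in>I. b i \<omega>))"
      by (rule indep_var_compose[OF ab[unfolded indep_families_def]]) (use i in \<open>auto intro: measurable_component_singleton\<close>)
    then show ?thesis using i by (simp add: o_def)
  qed
  have da: "distr M borel (a i) = distr N borel x" and db: "distr M borel (b i) = distr N borel y" if "i \<in> I" for i
    using a b that by (auto simp: iid_copies_def)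
  show ?thesis
  proof (intro masked_entries.intro masked_entries_axioms.intro)
    show "prob_space M" "prob_space N" "x \<in> borel_measurable N" "finite I" "0 \<le> w" "w \<le> 1" by fact+
    show "indep_vars (\<lambda>_. borel) (\<lambda>i \<omega>. a i \<omega> * b i \<omega>) I" by (rule indep_vars_mult_families[OF I ia ib ab])
    fix i f assume "i \<in> I" "(f :: complex \<Rightarrow> complex) \<in> borel_measurable borel" "f 0 = 0" "integrable N (\<lambda>\<omega>. f (x \<omega>))"
    then show "integrable M (\<lambda>\<omega>. f (a i \<omega> * b i \<omega>))"
      "expectation (\<lambda>\<omega>. f (a i \<omega> * b i \<omega>)) = complex_of_real w * (\<integral>\<omega>. f (x \<omega>) \<partial>N)"
      using expectation_masked[OF N x y w(3,4) da db iab] by auto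
  qed
qed

theorem theorem2p1:
  fixes N :: "'b measure" and x :: "'b \<Rightarrow> complex" and y :: "nat \<Rightarrow> 'b \<Rightarrow> complex"
    and L :: "real \<Rightarrow> real" and \<alpha> \<mu> \<rho> :: real and p :: "nat \<Rightarrow> nat"
    and M :: "nat \<Rightarrow> 'a measure"
    and a b :: "nat \<Rightarrow> nat \<times> nat \<Rightarrow> 'a \<Rightarrow> complex"
    and m :: "nat \<Rightarrow> 'a \<Rightarrow> nat \<times> nat \<Rightarrow> complex"
    and \<Sigma> :: "nat \<Rightarrow> 'a \<Rightarrow> complex Matrix.mat"
    and r :: "nat \<Rightarrow> 'a \<Rightarrow> nat \<Rightarrow> nat \<times> nat"
    and l :: nat
  assumes "prob_space N"
    and "x \<in> borel_measurable N"
    and "\<alpha> > 0" and "slowly_varying L"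
    and "\<And>t. t > 0 \<Longrightarrow> \<P>(\<omega> in N. cmod (x \<omega>) > t) = L t * t powr (- \<alpha>)"
    and "0 \<le> \<mu>" and "\<mu> \<le> 1"
    and "\<And>n. n \<ge> 1 \<Longrightarrow> y n \<in> borel_measurable N"
    and "\<And>n. n \<ge> 1 \<Longrightarrow> \<P>(\<omega> in N. y n \<omega> = 1) = real n powr (\<mu> - 1)"
    and "\<And>n. n \<ge> 1 \<Longrightarrow> \<P>(\<omega> in N. y n \<omega> = 0) = 1 - real n powr (\<mu> - 1)"
    and "\<And>n. n \<ge> 1 \<Longrightarrow> prob_space.indep_var N borel x borel (y n)"
    and "\<And>n. n \<ge> 1 \<Longrightarrow> p n > 0"
    and "(\<lambda>n. real (p n) / real n) \<longlonglongrightarrow> \<rho>" and "0 < \<rho>" and "\<rho> \<le> 1"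
    and "\<And>n. n \<ge> 1 \<Longrightarrow> prob_space (M n)"
    and "\<And>n. n \<ge> 1 \<Longrightarrow> iid_copies (M n) (positions (p n) n) (a n) N x"
    and "\<And>n. n \<ge> 1 \<Longrightarrow> iid_copies (M n) (positions (p n) n) (b n) N (y n)"
    and "\<And>n. n \<ge> 1 \<Longrightarrow>
           indep_families (M n) (positions (p n) n) (a n) (positions (p n) n) (b n)"
    and "\<And>n \<omega> ij. m n \<omega> ij = a n ij \<omega> * b n ij \<omega>"
    and "\<And>n \<omega>. \<Sigma> n \<omega> = sample_covariance (p n) n (m n \<omega>)"
    and "\<And>n \<omega>. n \<ge> 1 \<Longrightarrow> \<omega> \<in> space (M n) \<Longrightarrow> ranks_entries (p n) n (m n \<omega>) (r n \<omega>)"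
    \<comment> \<open>in \<^typ>\<open>ereal\<close>, the inverse of 0 is infinity\<close>
    and "ereal \<alpha> < 2 * (1 + inverse (ereal \<mu>))"
    and "1 + inverse (ereal \<mu>) \<le> ereal \<alpha> \<Longrightarrow> prob_space.expectation N x = 0"
    and "l \<ge> 1"
  shows
    "tendsto_in_prob M
       (\<lambda>n \<omega>. eigval_desc (\<Sigma> n \<omega>) l / (cmod (m n \<omega> (r n \<omega> l)))\<^sup>2) 1
     \<and>
     (\<forall>v. (\<forall>n\<ge>1. \<forall>\<omega>\<in>space (M n). l \<le> p n \<longrightarrow> unit_eigenvector (\<Sigma> n \<omega>) l (v n \<omega>)) \<longrightarrow>
        (\<exists>\<theta>. (\<forall>n \<omega>. cmod (\<theta> n \<omega>) = 1) \<and>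
          tendsto_in_prob M
            (\<lambda>n \<omega>. norm2 (\<theta> n \<omega> \<cdot>\<^sub>v v n \<omega> - unit_vec (p n) (fst (r n \<omega> l)))) 0))"
proof -
  note pN = assms(1) and x = assms(2) and \<alpha> = assms(3) and L = assms(4) and tail = assms(5) and \<mu> = assms(6,7)
    and y = assms(8) and y1 = assms(9) and y0 = assms(10) and p0 = assms(12) and pn = assms(13) and \<rho> = assms(14,15)
    and pM = assms(16) and a = assms(17) and b = assms(18) and ab = assms(19) and m = assms(20) and \<Sigma> = assms(21)
    and r = assms(22) and lt = assms(23) and cent = assms(24) and l = assms(25)
  interpret N: prob_space N by (rule pN)
  have rvt: "regularly_varying_tail (\<lambda>t. \<P>(\<omega> in N. cmod (x \<omega>) > t)) \<alpha>"
    by (rule regularly_varying_tailI[OF pN x \<alpha> L tail])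
  interpret E: heavy_tailed_ensemble N x \<alpha> \<mu> \<rho> p M "\<lambda>n ij \<omega>. m n \<omega> ij"
  proof (rule heavy_tailed_ensemble.intro)
    fix n :: nat assume n: "n \<ge> 1"
    have pos: "finite (positions (p n) n)" "positions (p n) n \<noteq> {}"
      using p0[OF n] n by (auto simp: positions_def lessThan_empty_iff)
    have w: "real n powr (\<mu> - 1) \<le> 1"
    proof -
      have "real n powr (\<mu> - 1) \<le> real n powr 0" using n \<mu> by (intro powr_mono) auto
      then show ?thesis using n by simp
    qed
    show "masked_entries (M n) N x (real n powr (\<mu> - 1)) (positions (p n) n) (\<lambda>ij \<omega>. m n \<omega> ij)"
      unfolding m by (rule masked_entriesI[OF pM[OF n] pN x y[OF n] _ w y1[OF n] y0[OF n] pos a[OF n] b[OF n] ab[OF n]]) simp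
  qed (fact rvt \<mu> pn \<rho>)+
  obtain s where s: "0 < s" "s < \<alpha>" "\<mu> * \<alpha> < s * (1 + \<mu>)" "s \<le> 1 \<or> (1 \<le> s \<and> s \<le> 2 \<and> N.expectation x = 0)"
    using choose_moment[OF \<alpha> \<mu> lt cent] .
  (* a Potter bound with an exponent halfway between s and \<alpha> *)
  have int: "integrable N (\<lambda>\<omega>. cmod (x \<omega>) powr s)"
  proof (rule N.integrable_powr_of_tail[of _ _ "(s + \<alpha>) / 2"])
    show "eventually (\<lambda>t. N.prob {\<omega> \<in> space N. t < cmod (x \<omega>)} \<le> t powr - ((s + \<alpha>) / 2)) at_top"
      using E.rv.potter_upper[of "(s + \<alpha>) / 2"] s \<alpha> by (simp add: E.T_def)
  qed (use x s in auto)
  obtain \<delta> where \<delta>: "\<delta> \<longlonglongrightarrow> 0"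
    and loc: "rare M (\<lambda>n \<omega>. \<not> localized (p n) n (m n \<omega>) (r n \<omega>) l (\<delta> n))"
    using E.rare_not_localized[OF s(1) int s(4) s(3) l r] by auto
  show ?thesis
  proof (intro conjI allI impI)
    show "tendsto_in_prob M (\<lambda>n \<omega>. eigval_desc (\<Sigma> n \<omega>) l / (cmod (m n \<omega> (r n \<omega> l)))\<^sup>2) 1"
    proof (rule tendsto_in_probI[OF pM])
      fix \<epsilon> :: real assume "0 < \<epsilon>"
      then have "eventually (\<lambda>n. \<delta> n < \<epsilon>) sequentially" using \<delta> by (auto dest: order_tendstoD)
      then show "rare M (\<lambda>n \<omega>. \<bar>eigval_desc (\<Sigma> n \<omega>) l / (cmod (m n \<omega> (r n \<omega> l)))\<^sup>2 - 1\<bar> > \<epsilon>)"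
      proof (intro rare_mono[OF loc], eventually_elim)
        case (elim n)
        have "\<bar>eigval_desc (\<Sigma> n \<omega>) l / (cmod (m n \<omega> (r n \<omega> l)))\<^sup>2 - 1\<bar> \<le> \<delta> n"
          if "localized (p n) n (m n \<omega>) (r n \<omega>) l (\<delta> n)" for \<omega>
        proof -
          define ml where "ml = cmod (m n \<omega> (r n \<omega> l))"
          have ml: "0 < ml\<^sup>2" and ev: "\<bar>eigval_desc (\<Sigma> n \<omega>) l - ml\<^sup>2\<bar> \<le> \<delta> n * ml\<^sup>2"
            using that unfolding localized_def \<Sigma> ml_def by auto
          have "eigval_desc (\<Sigma> n \<omega>) l / ml\<^sup>2 - 1 = (eigval_desc (\<Sigma> n \<omega>) l - ml\<^sup>2) / ml\<^sup>2"
            using ml by (simp add: diff_divide_distrib)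
          then have "\<bar>eigval_desc (\<Sigma> n \<omega>) l / ml\<^sup>2 - 1\<bar> = \<bar>eigval_desc (\<Sigma> n \<omega>) l - ml\<^sup>2\<bar> / ml\<^sup>2" by simp
          also have "\<dots> \<le> \<delta> n" using ev ml by (simp add: pos_divide_le_eq)
          finally show ?thesis by (simp add: ml_def)
        qed
        then show ?case using elim by force
      qed
    qed
    fix v assume v: "\<forall>n\<ge>1. \<forall>\<omega>\<in>space (M n). l \<le> p n \<longrightarrow> unit_eigenvector (\<Sigma> n \<omega>) l (v n \<omega>)"
    define \<theta> where "\<theta> n \<omega> = phase_to_real (v n \<omega> $ fst (r n \<omega> l))" for n \<omega>
    have "tendsto_in_prob M (\<lambda>n \<omega>. norm2 (\<theta> n \<omega> \<cdot>\<^sub>v v n \<omega> - unit_vec (p n) (fst (r n \<omega> l)))) 0"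
    proof (rule tendsto_in_probI[OF pM])
      fix \<epsilon> :: real assume \<epsilon>: "0 < \<epsilon>"
      show "rare M (\<lambda>n \<omega>. \<bar>norm2 (\<theta> n \<omega> \<cdot>\<^sub>v v n \<omega> - unit_vec (p n) (fst (r n \<omega> l))) - 0\<bar> > \<epsilon>)"
        unfolding rare_def
      proof (intro allI impI)
        fix \<eta> :: real assume "0 < \<eta>"
        then have h: "0 < \<eta> / 2" by simp
        obtain c where c: "1 < c" and sep: "eventually (\<lambda>n. \<exists>E\<in>sets (M n). measure (M n) E \<le> \<eta> / 2 \<and>
            (\<forall>\<omega>\<in>space (M n) - E. \<forall>q\<in>positions (p n) n. q \<noteq> r n \<omega> l \<longrightarrow>
              c * cmod (m n \<omega> q) \<le> cmod (m n \<omega> (r n \<omega> l)) \<or> c * cmod (m n \<omega> (r n \<omega> l)) \<le> cmod (m n \<omega> q))) sequentially"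
          using E.eventually_separated[OF l h r] by auto
        have g: "0 < 1 - 1 / c\<^sup>2" using c by (simp add: one_less_power)
        have "(\<lambda>n. 2 * (\<delta> n / (1 - 1 / c\<^sup>2 - \<delta> n))) \<longlonglongrightarrow> 2 * (0 / (1 - 1 / c\<^sup>2 - 0))"
          using g by (intro tendsto_intros \<delta>) auto
        then have ev1: "eventually (\<lambda>n. 2 * (\<delta> n / (1 - 1 / c\<^sup>2 - \<delta> n)) < \<epsilon>) sequentially"
          by (rule order_tendstoD(2)) (use \<epsilon> in simp)
        have ev2: "eventually (\<lambda>n. \<delta> n < 1 - 1 / c\<^sup>2) sequentially" by (rule order_tendstoD(2)[OF \<delta> g])
        show "eventually (\<lambda>n. \<exists>E\<in>sets (M n). measure (M n) E \<le> \<eta> \<and>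
            (\<forall>\<omega>\<in>space (M n) - E. \<not> \<bar>norm2 (\<theta> n \<omega> \<cdot>\<^sub>v v n \<omega> - unit_vec (p n) (fst (r n \<omega> l))) - 0\<bar> > \<epsilon>)) sequentially"
          using loc[unfolded rare_def, rule_format, OF h] sep ev1 ev2 eventually_ge_at_top[of 1]
        proof eventually_elim
          case (elim n)
          obtain F where F: "F \<in> sets (M n)" "measure (M n) F \<le> \<eta> / 2"
            "\<And>\<omega>. \<omega> \<in> space (M n) - F \<Longrightarrow> localized (p n) n (m n \<omega>) (r n \<omega>) l (\<delta> n)"
            using elim(1) by blast
          obtain G where G: "G \<in> sets (M n)" "measure (M n) G \<le> \<eta> / 2"
            "\<And>\<omega>. \<omega> \<in> space (M n) - G \<Longrightarrow> \<forall>q\<in>positions (p n) n. q \<noteq> r n \<omega> l \<longrightarrow>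
              c * cmod (m n \<omega> q) \<le> cmod (m n \<omega> (r n \<omega> l)) \<or> c * cmod (m n \<omega> (r n \<omega> l)) \<le> cmod (m n \<omega> q)"
            using elim(2) by blast
          interpret Mn: prob_space "M n" by (rule pM[OF elim(5)])
          have "measure (M n) (F \<union> G) \<le> measure (M n) F + measure (M n) G" by (rule measure_Un_le[OF F(1) G(1)])
          then have FG: "measure (M n) (F \<union> G) \<le> \<eta>" using F(2) G(2) by simp
          have "\<not> \<bar>norm2 (\<theta> n \<omega> \<cdot>\<^sub>v v n \<omega> - unit_vec (p n) (fst (r n \<omega> l))) - 0\<bar> > \<epsilon>"
            if \<omega>: "\<omega> \<in> space (M n) - (F \<union> G)" for \<omega>
          proof -
            have lo: "localized (p n) n (m n \<omega>) (r n \<omega>) l (\<delta> n)" using F(3) \<omega> by blast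
            then have "l \<le> p n" by (simp add: localized_def)
            then have ue: "unit_eigenvector (sample_covariance (p n) n (m n \<omega>)) l (v n \<omega>)"
              using v elim(5) \<omega> by (simp add: \<Sigma>)
            have sp: "\<forall>q\<in>positions (p n) n. q \<noteq> r n \<omega> l \<longrightarrow>
              c * cmod (m n \<omega> q) \<le> cmod (m n \<omega> (r n \<omega> l)) \<or> c * cmod (m n \<omega> (r n \<omega> l)) \<le> cmod (m n \<omega> q)"
              using G(3) \<omega> by blast
            have "norm2 (\<theta> n \<omega> \<cdot>\<^sub>v v n \<omega> - unit_vec (p n) (fst (r n \<omega> l))) \<le> 2 * (\<delta> n / (1 - 1 / c\<^sup>2 - \<delta> n))"
              unfolding \<theta>_def using lo[unfolded localized_def] c sp elim(4) ue by blast
            moreover have "0 \<le> norm2 (\<theta> n \<omega> \<cdot>\<^sub>v v n \<omega> - unit_vec (p n) (fst (r n \<omega> l)))"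
              by (simp add: norm2_def sum_nonneg)
            ultimately show ?thesis using elim(3) by simp
          qed
          then show ?case using F(1) G(1) FG by (intro bexI[of _ "F \<union> G"] conjI ballI) auto
        qed
      qed
    qed
    moreover have "\<forall>n \<omega>. cmod (\<theta> n \<omega>) = 1" by (simp add: \<theta>_def)
    ultimately show "\<exists>\<theta>. (\<forall>n \<omega>. cmod (\<theta> n \<omega>) = 1) \<and> tendsto_in_prob M
        (\<lambda>n \<omega>. norm2 (\<theta> n \<omega> \<cdot>\<^sub>v v n \<omega> - unit_vec (p n) (fst (r n \<omega> l)))) 0"
      by blast
  qed
qed

end
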